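(* If the polynomial $P_n^{\mathcal{B}^c}(x_{ij},y_{ij},z_i)$ is a reduced form of $m^{\mathcal{B}^c}[T^l]$ (in $\mathcal{B}^c(C_n)$) for a well-structured graph $T^l$ on the vertex set $[n]$, then $$P_n^{\mathcal{B}^c}(x_{ij}=y_{ij}=z_i=1)=f_{T^l},$$ where $f_{T^l}$ is the number of alternating well-structured spanning graphs $G$ of $\overline{T^l}$.
   Context: A signed graph on $[n]=\{1,\dots,n\}$ is a finite multigraph (loops allowed) with each edge labeled $+$ or $-$; all loops are labeled $+$. An edge with endpoints $i,j$ and sign $\epsilon$ is written $(i,j,\epsilon)=(j,i,\epsilon)$. A positive edge is incident with a positive sign to both endpoints; a negative edge is incident with a positive sign to its smaller endpoint and with a negative sign to its larger one. A graph is alternating if at every vertex all incident edges are incident with the same sign. A graph $H$ on $[n]$ is well-structured if: (i) $H$ is noncrossing, i.e. there are no $i<j<k<l$ with edges $(i,k,\epsilon_1),(j,l,\epsilon_2)$ of $H$; (ii) for any edges $(i,j,+),(k,l,+)$ with $i<j$, $k<l$: $i<l$ and $k<j$; (iii) for any edges $(i,i,+),(k,l,+)$ with $k<l$: $k\le i\le l$; (iv) there are no edges $(i,i,+),(k,j,-)$ with $k<i<j$; (v) there are no edges $(i,j,+),(k,l,-)$ with $k\le i<j\le l$; (vi) $H$ is connected, contains exactly one loop, and contains no nonloop cycles. Transitive closure: let $e_1,\dots,e_n$ be the standard basis of $\mathbb{R}^n$; for $i\le j$ put $\mathrm{v}(i,j,-)=e_i-e_j$ (here $i<j$), $\mathrm{v}(i,j,+)=e_i+e_j$;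 $\mathcal{C}(G)$ is the set of nonnegative combinations of $\mathrm{v}(e)$, $e\in E(G)$. $\overline{G}$ is the graph on $[n]$ whose edges are all $(i,j,\epsilon)$ (including positive loops $(i,i,+)$) with $\mathrm{v}(i,j,\epsilon)\in\mathcal{C}(G)$. A spanning graph of $\overline{T^l}$ is a graph on $[n]$ all of whose edges are in $\overline{T^l}$. $m^{\mathcal{B}^c}[G]=\prod_{e\in E(G)}\mathrm{w}(e)$ is the commutative monomial with, for $i<j$, $\mathrm{w}(i,j,-)=x_{ij}$, $\mathrm{w}(i,j,+)=y_{ij}$, and $\mathrm{w}(i,i,+)=z_i$. Reduced forms in $\mathcal{B}^c(C_n)$ (the commutative counterpart of the bracket algebra of type $C_n$): all variables $x_{ij},y_{ij}$ $(i<j)$, $z_k$ commute, coefficients are in $\mathbb{Q}$, and the reduction rules (replace the product of two variables on the left, occurring in a monomial, by the right-hand side) are, for $i<j<k$ in the first four and $i<j$ in the last: $x_{ij}x_{jk}\to x_{ik}x_{ij}+x_{jk}x_{ik}$; $x_{ij}y_{jk}\to y_{ik}x_{ij}+y_{jk}y_{ik}$; $x_{ik}y_{jk}\to y_{jk}y_{ij}+y_{ij}x_{ik}$; $y_{ik}x_{jk}\to x_{jk}y_{ij}+y_{ij}y_{ik}$; $x_{ij}z_j\to z_ix_{ij}+y_{ij}z_i+z_jy_{ij}$. A reduced form of a monomial is a polynomial obtained from it by successively applying these rules to monomials of the current polynomial, in any order, until no rule can be applied. *)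

theory Defs
  imports Complex_Main "HOL-Library.Multiset" "HOL-Library.Poly_Mapping"
begin

section \<open>Signed graphs\<close>

datatype sign = Pos | Neg

text \<open>
  The identification \<open>(i,j,\<epsilon>) = (j,i,\<epsilon>)\<close> is implemented by storing the smaller endpoint first:
  in a graph every edge \<open>(i,j,\<epsilon>)\<close> satisfies \<open>i \<le> j\<close>.  A graph is the finite multiset of its edges;
  the vertex set \<open>[n]\<close> is passed separately.
\<close>

type_synonym edge = "nat \<times> nat \<times> sign"
type_synonym sgraph = "edge multiset"

fun edge_on :: "nat \<Rightarrow> edge \<Rightarrow> bool" where
  "edge_on n (i, j, s) \<longleftrightarrow> 1 \<le> i \<and> i \<le> j \<and> j \<le> n \<and> (i = j \<longrightarrow> s = Pos)"

definition graph_on :: "nat \<Rightarrow> sgraph \<Rightarrow> bool" where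
  "graph_on n G \<longleftrightarrow> (\<forall>e\<in>#G. edge_on n e)"

fun endpoints :: "edge \<Rightarrow> nat set" where
  "endpoints (i, j, s) = {i, j}"

fun is_loop :: "edge \<Rightarrow> bool" where
  "is_loop (i, j, s) \<longleftrightarrow> i = j"

text \<open>\<open>(v, s) \<in> incidences e\<close>: the edge \<open>e\<close> is incident with sign \<open>s\<close> to the vertex \<open>v\<close>.\<close>

fun incidences :: "edge \<Rightarrow> (nat \<times> sign) set" where
  "incidences (i, j, Pos) = {(i, Pos), (j, Pos)}"
| "incidences (i, j, Neg) = {(i, Pos), (j, Neg)}"

definition alternating :: "sgraph \<Rightarrow> bool" where
  "alternating G \<longleftrightarrow>
     (\<forall>e\<in>#G. \<forall>e'\<in>#G. \<forall>v s s'. (v, s) \<in> incidences e \<longrightarrow> (v, s') \<in> incidences e' \<longrightarrow> s = s')"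


section \<open>Well-structured graphs\<close>

definition noncrossing :: "sgraph \<Rightarrow> bool" where
  "noncrossing G \<longleftrightarrow>
     \<not> (\<exists>i j k l s t. i < j \<and> j < k \<and> k < l \<and> (i, k, s) \<in># G \<and> (j, l, t) \<in># G)"

definition connected_on :: "nat \<Rightarrow> sgraph \<Rightarrow> bool" where
  "connected_on n G \<longleftrightarrow>
     (\<forall>u\<in>{1..n}. \<forall>v\<in>{1..n}. (u, v) \<in> {(a, b). \<exists>e\<in>#G. endpoints e = {a, b}}\<^sup>*)"

text \<open>
  A nonloop cycle is a closed walk of length at least 2 through distinct vertices along distinct edges.
  Since \<open>mset es \<subseteq># G\<close>, two parallel edges form a cycle of length 2, but a single edge traversed
  back and forth does not.
\<close>

definition nonloop_cycle :: "sgraph \<Rightarrow> nat list \<Rightarrow> edge list \<Rightarrow> bool" where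
  "nonloop_cycle G vs es \<longleftrightarrow>
     2 \<le> length vs \<and> length es = length vs \<and> distinct vs \<and> mset es \<subseteq># G \<and>
     (\<forall>k<length vs. endpoints (es ! k) = {vs ! k, vs ! (Suc k mod length vs)})"

definition well_structured :: "nat \<Rightarrow> sgraph \<Rightarrow> bool" where
  "well_structured n H \<longleftrightarrow>
     graph_on n H \<and>
     noncrossing H \<and>
     (\<forall>i j k l. (i, j, Pos) \<in># H \<longrightarrow> (k, l, Pos) \<in># H \<longrightarrow> i < j \<longrightarrow> k < l \<longrightarrow> i < l \<and> k < j) \<and>
     (\<forall>i k l. (i, i, Pos) \<in># H \<longrightarrow> (k, l, Pos) \<in># H \<longrightarrow> k < l \<longrightarrow> k \<le> i \<and> i \<le> l) \<and>
     \<not> (\<exists>i j k. (i, i, Pos) \<in># H \<and> (k, j, Neg) \<in># H \<and> k < i \<and> i < j) \<and>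
     \<not> (\<exists>i j k l. (i, j, Pos) \<in># H \<and> (k, l, Neg) \<in># H \<and> k \<le> i \<and> i < j \<and> j \<le> l) \<and>
     connected_on n H \<and>
     size (filter_mset is_loop H) = 1 \<and>
     \<not> (\<exists>vs es. nonloop_cycle H vs es)"


section \<open>Transitive closure\<close>

text \<open>
  Vectors of \<open>\<real>\<^sup>n\<close> are real functions on the naturals that vanish outside \<open>{1..n}\<close>.
\<close>

definition unit_vec :: "nat \<Rightarrow> nat \<Rightarrow> real" where
  "unit_vec i = (\<lambda>k. if k = i then 1 else 0)"

fun edge_vec :: "edge \<Rightarrow> nat \<Rightarrow> real" where
  "edge_vec (i, j, Neg) = (\<lambda>k. unit_vec i k - unit_vec j k)"
| "edge_vec (i, j, Pos) = (\<lambda>k. unit_vec i k + unit_vec j k)"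

definition edge_cone :: "sgraph \<Rightarrow> (nat \<Rightarrow> real) set" where
  "edge_cone G = {\<lambda>k. \<Sum>e\<in>set_mset G. c e * edge_vec e k | c. \<forall>e\<in>set_mset G. 0 \<le> c e}"

text \<open>The closure has no repeated edges, so it is given by its edge set.\<close>

definition trans_closure :: "nat \<Rightarrow> sgraph \<Rightarrow> edge set" where
  "trans_closure n G = {e. edge_on n e \<and> edge_vec e \<in> edge_cone G}"

definition spanning_graph_of_closure :: "nat \<Rightarrow> sgraph \<Rightarrow> sgraph \<Rightarrow> bool" where
  "spanning_graph_of_closure n T G \<longleftrightarrow> graph_on n G \<and> set_mset G \<subseteq> trans_closure n T"

definition alt_ws_spanning :: "nat \<Rightarrow> sgraph \<Rightarrow> sgraph set" where
  "alt_ws_spanning n T =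
     {G. spanning_graph_of_closure n T G \<and> alternating G \<and> well_structured n G}"

definition f_number :: "nat \<Rightarrow> sgraph \<Rightarrow> nat" where
  "f_number n T = card (alt_ws_spanning n T)"


section \<open>Reduced forms\<close>

text \<open>
  A monomial is the multiset of its variables (with \<open>+\<close> as multiplication), and the commutative
  polynomial ring over the rationals is the monoid algebra of these monomials.
\<close>

datatype var = X nat nat | Y nat nat | Z nat

type_synonym monom = "var multiset"
type_synonym cpoly = "monom \<Rightarrow>\<^sub>0 rat"

definition Var :: "var \<Rightarrow> cpoly" where
  "Var v = Poly_Mapping.single {#v#} 1"

definition eval_cpoly :: "(var \<Rightarrow> rat) \<Rightarrow> cpoly \<Rightarrow> rat" where
  "eval_cpoly a P =
     (\<Sum>M\<in>Poly_Mapping.keys P. Poly_Mapping.lookup P M * (\<Prod>v\<in>#M. a v))"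

fun edge_var :: "edge \<Rightarrow> var" where
  "edge_var (i, j, Neg) = X i j"
| "edge_var (i, j, Pos) = (if i = j then Z i else Y i j)"

definition graph_monomial :: "sgraph \<Rightarrow> cpoly" where
  "graph_monomial G = (\<Prod>e\<in>#G. Var (edge_var e))"

inductive red_rule :: "monom \<Rightarrow> cpoly \<Rightarrow> bool" where
  "i < j \<Longrightarrow> j < k \<Longrightarrow>
     red_rule {#X i j, X j k#} (Var (X i k) * Var (X i j) + Var (X j k) * Var (X i k))"
| "i < j \<Longrightarrow> j < k \<Longrightarrow>
     red_rule {#X i j, Y j k#} (Var (Y i k) * Var (X i j) + Var (Y j k) * Var (Y i k))"
| "i < j \<Longrightarrow> j < k \<Longrightarrow>
     red_rule {#X i k, Y j k#} (Var (Y j k) * Var (Y i j) + Var (Y i j) * Var (X i k))"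
| "i < j \<Longrightarrow> j < k \<Longrightarrow>
     red_rule {#Y i k, X j k#} (Var (X j k) * Var (Y i j) + Var (Y i j) * Var (Y i k))"
| "i < j \<Longrightarrow>
     red_rule {#X i j, Z j#}
       (Var (Z i) * Var (X i j) + Var (Y i j) * Var (Z i) + Var (Z j) * Var (Y i j))"

text \<open>
  One reduction step picks a monomial \<open>M\<close> of \<open>P\<close>, with its coefficient, and a rule whose left-hand
  side divides \<open>M\<close>.
\<close>

definition red_step :: "cpoly \<Rightarrow> cpoly \<Rightarrow> bool" where
  "red_step P Q \<longleftrightarrow>
     (\<exists>M L R. M \<in> Poly_Mapping.keys P \<and> red_rule L R \<and> L \<subseteq># M \<and>
        Q = P - Poly_Mapping.single M (Poly_Mapping.lookup P M)
              + Poly_Mapping.single (M - L) (Poly_Mapping.lookup P M) * R)"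

definition reduced_form_of :: "cpoly \<Rightarrow> cpoly \<Rightarrow> bool" where
  "reduced_form_of m P \<longleftrightarrow> red_step\<^sup>*\<^sup>* m P \<and> \<not> (\<exists>Q. red_step P Q)"


section \<open>The counted set is finite\<close>

lemma finite_edge_on: "finite {e. edge_on n e}"
proof (rule finite_subset)
  show "{e. edge_on n e} \<subseteq> {1..n} \<times> {1..n} \<times> {Pos, Neg}"
  proof
    fix e assume "e \<in> {e. edge_on n e}"
    moreover obtain i j s where "e = (i, j, s)"
      by (cases e) auto
    ultimately show "e \<in> {1..n} \<times> {1..n} \<times> {Pos, Neg}"
      by (cases s) auto
  qed
qed simp

lemma well_structured_count_le_1:
  assumes "well_structured n G"
  shows "count G e \<le> 1"
proof (rule ccontr)
  assume "\<not> count G e \<le> 1"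
  then have sub: "{#e, e#} \<subseteq># G"
    by (auto simp: subseteq_mset_def)
  obtain i j s where e: "e = (i, j, s)"
    by (cases e) auto
  show False
  proof (cases "i = j")
    case True
    then have "{#e, e#} \<subseteq># filter_mset is_loop G"
      using multiset_filter_mono[OF sub, of is_loop] e by simp
    then have "2 \<le> size (filter_mset is_loop G)"
      using size_mset_mono by fastforce
    then show False
      using assms by (simp add: well_structured_def)
  next
    case False
    have "nonloop_cycle G [i, j] [e, e]"
      using sub e False by (auto simp: nonloop_cycle_def less_Suc_eq numeral_2_eq_2)
    then show False
      using assms by (auto simp: well_structured_def)
  qed
qed

lemma finite_alt_ws_spanning: "finite (alt_ws_spanning n T)"
proof (rule finite_subset)
  show "alt_ws_spanning n T \<subseteq> mset_set ` Pow {e. edge_on n e}"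
  proof
    fix G assume "G \<in> alt_ws_spanning n T"
    then have ws: "well_structured n G"
      by (simp add: alt_ws_spanning_def)
    have "G = mset_set (set_mset G)"
    proof (rule multiset_eqI)
      fix e
      show "count G e = count (mset_set (set_mset G)) e"
        using well_structured_count_le_1[OF ws, of e]
        by (cases "e \<in># G") (auto simp: count_mset_set' le_Suc_eq simp flip: count_greater_zero_iff)
    qed
    moreover have "set_mset G \<in> Pow {e. edge_on n e}"
      using ws by (auto simp: well_structured_def graph_on_def)
    ultimately show "G \<in> mset_set ` Pow {e. edge_on n e}"
      by blast
  qed
  show "finite (mset_set ` Pow {e. edge_on n e})"
    by (simp add: finite_edge_on)
qed

end

theory Submission
  imports Defs
begin

text \<open>
  All edge vectors have \<open>\<ell>\<^sub>1\<close>-norm 2, and each reduction rule replaces a simplicial cone by cones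
  that cover the same lattice points and have disjoint interiors.  An irreducible graph is
  alternating, so its cone lies in one orthant, where the norm is linear: the number of its lattice
  points of norm \<open>2r\<close> depends only on \<open>r\<close> and the number of edges.  Hence the number of terms of a
  reduced form is determined by the growth of the number of lattice points of norm \<open>2r\<close> in the cone
  of \<open>T\<close>, whatever reductions were chosen.

  The same count applies to the alternating well-structured graphs in the closure of \<open>T\<close>.  Their
  cones cover that of \<open>T\<close>, since a well-structured graph that is not alternating has a reduction
  whose results are all well-structured.  Their interiors are disjoint, since a lattice point is
  decomposed greedily in at most one way into edges satisfying the conditions (i)--(v).
\<close>

section \<open>Linear independence of edge vectors\<close>

text \<open>Reductions in arbitrary order destroy well-structuredness, so only linear invariants are
  carried along: independence of the edge vectors, which makes the cones simplicial, and
  independence of the vectors with signs forgotten. The second is needed because no rule applies to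
  the pair \<open>(i, j, Neg)\<close>, \<open>(i, j, Pos)\<close>, which is not alternating although
  its edge vectors are independent. The obstacle to an exact count is that the parts produced by a
  rule share faces. Instead of tracking faces, all combinations are used to bound the number of
  points of the cone of \<open>T\<close> from above, and the strictly positive ones to bound it from
  below. For an alternating graph with \<open>m\<close> edges the two counts differ only by a shift
  of \<open>r\<close> by \<open>m\<close>, which does not affect the leading growth. The transitive
  closure is defined with real coefficients, whereas the points counted are sums of edges. The gap
  closes because a well-structured graph is unimodular: thanks to its loop, its edges generate every
  edge vector with integer coefficients.\<close>

definition indep :: "(edge \<Rightarrow> nat \<Rightarrow> real) \<Rightarrow> sgraph \<Rightarrow> bool" where
  "indep f G \<longleftrightarrow> (\<forall>e. count G e \<le> 1) \<and>
     (\<forall>c. (\<forall>k. (\<Sum>e\<in>#G. c e * f e k) = 0) \<longrightarrow> (\<forall>e\<in>#G. c e = 0))"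

lemma indep_count: "indep f G \<Longrightarrow> count G e \<le> 1"
  unfolding indep_def by blast

lemma indepD: "indep f G \<Longrightarrow> (\<And>k. (\<Sum>e\<in>#G. c e * f e k) = 0) \<Longrightarrow> e \<in># G \<Longrightarrow> c e = 0"
  by (auto simp: indep_def)

lemma indep_swap: "indep f (add_mset a (add_mset b G)) \<Longrightarrow> indep f (add_mset b (add_mset a G))"
  by (simp add: add_mset_commute)

lemma sum_mset_coeff_cong:
  "(\<And>e. e \<in># G \<Longrightarrow> c e = d e) \<Longrightarrow> (\<Sum>e\<in>#G. c e * f e) = (\<Sum>e\<in>#G. d e * (f e :: real))"
  by (rule arg_cong[where f = sum_mset], rule image_mset_cong) simp

text \<open>Steinitz exchange of one vector. It must also be shown that \<open>b\<close> is not
  already an edge: coefficients belong to edges and not to occurrences, so \<open>indep\<close> has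
  to bound multiplicities separately. If \<open>b\<close> were already present, the formula for it
  would be a dependence with the nonzero coefficient \<alpha> at \<open>a\<close>.\<close>

lemma indep_exchange:
  assumes "indep f (add_mset a (add_mset a' G))" and "\<alpha> \<noteq> 0"
    and b: "\<And>k. f b k = \<alpha> * f a k + \<beta> * f a' k"
  shows "indep f (add_mset b (add_mset a' G))"
proof -
  have cnt: "count (add_mset a (add_mset a' G)) e \<le> 1" for e
    using assms(1) by (rule indep_count)
  have a: "a \<notin># G" "a \<noteq> a'"
    using cnt[of a] by (auto simp: not_in_iff split: if_splits)
  have a': "a' \<notin># G"
    using cnt[of a'] by (auto simp: not_in_iff split: if_splits)
  have bnot: "b \<notin># add_mset a' G"
  proof
    assume "b \<in># add_mset a' G"
    then consider "b = a'" | "b \<in># G" "b \<noteq> a'" by auto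
    then show False
    proof cases
      case 1
      define c where "c = (\<lambda>e. 0::real)(a := \<alpha>, a' := \<beta> - 1)"
      have "c a = 0"
      proof (rule indepD[OF assms(1)])
        have *: "(\<Sum>e\<in>#G. c e * f e k) = 0" for k
          using a a' by (subst sum_mset_coeff_cong[where d = "\<lambda>_. 0"]) (auto simp: c_def)
        show "(\<Sum>e\<in>#add_mset a (add_mset a' G). c e * f e k) = 0" for k
          using a b[of k] 1 * by (simp add: c_def algebra_simps)
      qed simp
      then show False using a assms(2) by (simp add: c_def)
    next
      case 2
      define G0 where "G0 = G - {#b#}"
      have G: "G = add_mset b G0" using 2 by (simp add: G0_def)
      have bG0: "b \<notin># G0" using cnt[of b] by (auto simp: G not_in_iff split: if_splits)
      have ab: "a \<noteq> b" using a G by auto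
      define c where "c = (\<lambda>e. 0::real)(a := \<alpha>, a' := \<beta>, b := -1)"
      have "c a = 0"
      proof (rule indepD[OF assms(1)])
        have *: "(\<Sum>e\<in>#G0. c e * f e k) = 0" for k
          using a a' bG0 G by (subst sum_mset_coeff_cong[where d = "\<lambda>_. 0"]) (auto simp: c_def)
        show "(\<Sum>e\<in>#add_mset a (add_mset a' G). c e * f e k) = 0" for k
          using a ab 2 b[of k] * by (simp add: c_def G algebra_simps)
      qed simp
      then show False using a ab assms(2) by (simp add: c_def)
    qed
  qed
  show ?thesis
    unfolding indep_def
  proof (intro conjI allI impI)
    show "count (add_mset b (add_mset a' G)) e \<le> 1" for e
      using cnt[of e] bnot by (auto simp: not_in_iff split: if_splits)
  next
    fix c assume c: "\<forall>k. (\<Sum>e\<in>#add_mset b (add_mset a' G). c e * f e k) = 0"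
    \<comment> \<open>Substituting the formula for \<open>b\<close> turns a dependence of the new
      graph into one of the old graph with these coefficients.\<close>
    define d where "d = c(a := c b * \<alpha>, a' := c b * \<beta> + c a')"
    have d0: "d e = 0" if "e \<in># add_mset a (add_mset a' G)" for e
    proof (rule indepD[OF assms(1) _ that])
      fix k
      have "(\<Sum>e\<in>#G. d e * f e k) = (\<Sum>e\<in>#G. c e * f e k)"
        using a a' by (intro sum_mset_coeff_cong) (auto simp: d_def)
      then show "(\<Sum>e\<in>#add_mset a (add_mset a' G). d e * f e k) = 0"
        using c[rule_format, of k] b[of k] a by (simp add: d_def algebra_simps)
    qed
    have "d a = 0" "d a' = 0" using d0 by auto
    then have cb: "c b = 0" "c a' = 0" using a assms(2) by (auto simp: d_def split: if_splits)
    show "\<forall>e\<in>#add_mset b (add_mset a' G). c e = 0"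
    proof
      fix e assume "e \<in># add_mset b (add_mset a' G)"
      then consider "e = b" | "e = a'" | "e \<in># G" by auto
      then show "c e = 0"
      proof cases
        case 3
        then have "e \<noteq> a" "e \<noteq> a'" using a a' by auto
        then show ?thesis using d0[of e] 3 by (simp add: d_def)
      qed (use cb in auto)
    qed
  qed
qed


section \<open>Lattice points of the cone of a graph\<close>

text \<open>A multiset of edges stands for a nonnegative integer combination, its multiplicities
  being the coefficients.\<close>

definition vsum :: "sgraph \<Rightarrow> nat \<Rightarrow> real" where
  "vsum E = (\<lambda>k. \<Sum>e\<in>#E. edge_vec e k)"

lemma vsum_add_mset: "vsum (add_mset e E) k = edge_vec e k + vsum E k"
  by (simp add: vsum_def)

lemma vsum_add: "vsum (E + E') k = vsum E k + vsum E' k"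
  by (simp add: vsum_def)

lemma vsum_empty [simp]: "vsum {#} k = 0"
  by (simp add: vsum_def)

lemma vsum_replicate: "vsum (replicate_mset m e) k = real m * edge_vec e k"
  by (simp add: vsum_def)

definition ncone :: "edge set \<Rightarrow> (nat \<Rightarrow> real) set" where
  "ncone A = vsum ` {E. set_mset E \<subseteq> A}"

text \<open>Equality of supports says that every coefficient is positive. For independent edges
  these combinations lie in the relative interior of the cone.\<close>

definition nint :: "edge set \<Rightarrow> (nat \<Rightarrow> real) set" where
  "nint A = vsum ` {E. set_mset E = A}"

lemma nint_subset_ncone: "nint A \<subseteq> ncone A"
  by (auto simp: nint_def ncone_def)

lemma ncone_mono: "A \<subseteq> B \<Longrightarrow> ncone A \<subseteq> ncone B"
  by (auto simp: ncone_def)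

lemma edge_vec_in_ncone: "e \<in> A \<Longrightarrow> edge_vec e \<in> ncone A"
  unfolding ncone_def by (rule image_eqI[of _ _ "{#e#}"]) (auto simp: vsum_def)

lemma ncone_closed:
  assumes "\<And>e. e \<in> A \<Longrightarrow> edge_vec e \<in> ncone B"
  shows "ncone A \<subseteq> ncone B"
proof -
  have "\<exists>E'. set_mset E' \<subseteq> B \<and> vsum E' = vsum E" if "set_mset E \<subseteq> A" for E
    using that
  proof (induction E)
    case empty
    then show ?case by (intro exI[of _ "{#}"]) auto
  next
    case (add e E)
    then obtain E' where E': "set_mset E' \<subseteq> B" "vsum E' = vsum E" by auto
    obtain F where F: "set_mset F \<subseteq> B" "edge_vec e = vsum F"
      using assms[of e] add.prems by (auto simp: ncone_def)
    show ?case
      by (intro exI[of _ "F + E'"] conjI ext) (use E' F in \<open>auto simp: vsum_add vsum_add_mset\<close>)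
  qed
  then show ?thesis unfolding ncone_def by (auto simp: image_iff) metis
qed

lemma sum_mset_conv_count:
  fixes g :: "edge \<Rightarrow> real"
  assumes "set_mset E \<subseteq> set_mset G" and "\<And>e. count G e \<le> 1"
  shows "(\<Sum>e\<in>#E. g e) = (\<Sum>e\<in>#G. real (count E e) * g e)"
  using assms(1)
proof (induction E)
  case (add x E)
  have "count G x = 1"
    using add.prems assms(2)[of x] by (simp add: le_antisym)
  then have "(\<Sum>e\<in>#G. if e = x then g x else 0) = g x"
    by (simp add: sum_mset_delta)
  moreover have "(\<Sum>e\<in>#G. real (count (add_mset x E) e) * g e) =
      (\<Sum>e\<in>#G. (if e = x then g x else 0) + real (count E e) * g e)"
    by (rule arg_cong[where f = sum_mset], rule image_mset_cong) (auto simp: algebra_simps)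
  ultimately show ?case
    using add by (simp add: sum_mset.distrib)
qed auto

text \<open>The difference of the two multiplicity functions is a linear dependence on
  \<open>G\<close>.\<close>

lemma indep_vsum_inj:
  assumes "indep edge_vec G" "set_mset E \<subseteq> set_mset G" "set_mset E' \<subseteq> set_mset G" "vsum E = vsum E'"
  shows "E = E'"
proof (rule multiset_eqI)
  fix e
  have cnt: "\<And>e. count G e \<le> 1" using assms(1) by (rule indep_count)
  show "count E e = count E' e"
  proof (cases "e \<in># G")
    case True
    have "real (count E e) - real (count E' e) = 0"
    proof (rule indepD[OF assms(1) _ True])
      fix k
      have "(\<Sum>e\<in>#G. (real (count E e) - real (count E' e)) * edge_vec e k) =
         (\<Sum>e\<in>#G. real (count E e) * edge_vec e k + - (real (count E' e) * edge_vec e k))"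
        by (simp add: left_diff_distrib)
      also have "\<dots> = (\<Sum>e\<in>#G. real (count E e) * edge_vec e k)
           + (\<Sum>e\<in>#G. - (real (count E' e) * edge_vec e k))"
        by (rule sum_mset.distrib)
      also have "(\<Sum>e\<in>#G. - (real (count E' e) * edge_vec e k)) = - (\<Sum>e\<in>#G. real (count E' e) * edge_vec e k)"
        by (induction G) auto
      also have "(\<Sum>e\<in>#G. real (count E e) * edge_vec e k) = vsum E k"
        unfolding vsum_def using sum_mset_conv_count[OF assms(2) cnt] by simp
      also have "(\<Sum>e\<in>#G. real (count E' e) * edge_vec e k) = vsum E' k"
        unfolding vsum_def using sum_mset_conv_count[OF assms(3) cnt] by simp
      finally show "(\<Sum>e\<in>#G. (real (count E e) - real (count E' e)) * edge_vec e k) = 0"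
        using assms(4) by simp
    qed
    then show ?thesis by simp
  next
    case False
    then have "e \<notin># E" "e \<notin># E'" using assms by auto
    then show ?thesis by (simp add: not_in_iff)
  qed
qed

lemma mset_two_split:
  assumes "a \<noteq> b"
  shows "E = filter_mset (\<lambda>e. e \<noteq> a \<and> e \<noteq> b) E + replicate_mset (count E a) a + replicate_mset (count E b) b"
  by (rule multiset_eqI) (use assms in auto)

text \<open>With coefficients \<open>x\<close> of \<open>a\<close> and \<open>y\<close> of
  \<open>b\<close>, the smaller one can be moved entirely to \<open>c\<close>, which leaves the
  difference at \<open>a\<close> or at \<open>b\<close>.\<close>

lemma ncone_split:
  assumes "a \<noteq> b" and c: "\<And>k. edge_vec c k = edge_vec a k + edge_vec b k"
  shows "ncone (insert a (insert b A)) \<subseteq> ncone (insert a (insert c A)) \<union> ncone (insert b (insert c A))"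
proof
  fix p assume "p \<in> ncone (insert a (insert b A))"
  then obtain E where E: "set_mset E \<subseteq> insert a (insert b A)" "p = vsum E"
    by (auto simp: ncone_def)
  define R where "R = filter_mset (\<lambda>e. e \<noteq> a \<and> e \<noteq> b) E"
  define x y where "x = count E a" and "y = count E b"
  have Eq: "E = R + replicate_mset x a + replicate_mset y b"
    unfolding R_def x_def y_def using assms(1) by (rule mset_two_split)
  have R: "set_mset R \<subseteq> A"
    using E(1) by (auto simp: R_def)
  have p: "p k = vsum R k + real x * edge_vec a k + real y * edge_vec b k" for k
    using E(2) by (simp add: Eq vsum_add vsum_replicate)
  show "p \<in> ncone (insert a (insert c A)) \<union> ncone (insert b (insert c A))"
  proof (cases "y \<le> x")
    case True
    let ?E = "R + replicate_mset (x - y) a + replicate_mset y c"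
    have "p = vsum ?E"
      using True by (intro ext) (simp add: p c vsum_add vsum_replicate of_nat_diff algebra_simps)
    moreover have "set_mset ?E \<subseteq> insert a (insert c A)"
      using R by (auto split: if_splits)
    ultimately show ?thesis by (auto simp: ncone_def)
  next
    case False
    let ?E = "R + replicate_mset (y - x) b + replicate_mset x c"
    have "p = vsum ?E"
      using False by (intro ext) (simp add: p c vsum_add vsum_replicate of_nat_diff algebra_simps)
    moreover have "set_mset ?E \<subseteq> insert b (insert c A)"
      using R by (auto split: if_splits)
    ultimately show ?thesis by (auto simp: ncone_def)
  qed
qed

text \<open>Expanding \<open>c\<close> turns coefficients \<open>x\<close> of \<open>a\<close> and
  \<open>y\<close> of \<open>c\<close> into \<open>x + y\<close> of \<open>a\<close> and
  \<open>y\<close> of \<open>b\<close>; as \<open>x\<close> is positive, \<open>a\<close> gets the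
  larger one.\<close>

lemma nint_split_aux:
  assumes "a \<noteq> b" "a \<notin> A" "a \<noteq> c" "c \<notin> A"
    and c: "\<And>k. edge_vec c k = edge_vec a k + edge_vec b k"
    and "p \<in> nint (insert a (insert c A))" "b \<notin> A"
  shows "\<exists>E. set_mset E = insert a (insert b A) \<and> p = vsum E \<and> count E b < count E a"
proof -
  obtain E where E: "set_mset E = insert a (insert c A)" "p = vsum E"
    using assms(6) by (auto simp: nint_def)
  define R where "R = filter_mset (\<lambda>e. e \<noteq> a \<and> e \<noteq> c) E"
  define x y where "x = count E a" and "y = count E c"
  have Eq: "E = R + replicate_mset x a + replicate_mset y c"
    unfolding R_def x_def y_def using assms(3) by (rule mset_two_split)
  have R: "set_mset R = A"
    using E(1) assms by (auto simp: R_def)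
  have xy: "x > 0" "y > 0"
    using E(1) by (auto simp: x_def y_def)
  let ?E = "R + replicate_mset (x + y) a + replicate_mset y b"
  have "p = vsum ?E"
    by (intro ext) (simp add: E(2) Eq c vsum_add vsum_replicate algebra_simps)
  moreover have "set_mset ?E = insert a (insert b A)"
    using R xy by auto
  moreover have "count ?E b < count ?E a"
    using R xy assms by (auto simp: not_in_iff)
  ultimately show ?thesis by blast
qed

text \<open>The two parts are told apart by which of \<open>a\<close> and \<open>b\<close> has the
  larger coefficient in the original graph, and independence makes these coefficients unique. Points
  with equal coefficients lie in neither part, hence inclusions instead of a partition.\<close>

lemma nint_split:
  assumes ind: "indep edge_vec (add_mset a (add_mset b G))"
    and c: "\<And>k. edge_vec c k = edge_vec a k + edge_vec b k"
  defines "A \<equiv> set_mset G"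
  shows "nint (insert a (insert c A)) \<subseteq> nint (insert a (insert b A))"
    and "nint (insert b (insert c A)) \<subseteq> nint (insert a (insert b A))"
    and "nint (insert a (insert c A)) \<inter> nint (insert b (insert c A)) = {}"
proof -
  have ind_ac: "indep edge_vec (add_mset c (add_mset a G))"
    by (rule indep_exchange[OF indep_swap[OF ind], of 1 _ 1]) (use c in auto)
  have ind_bc: "indep edge_vec (add_mset c (add_mset b G))"
    by (rule indep_exchange[OF ind, of 1 _ 1]) (use c in auto)
  have ne: "a \<noteq> b" "a \<notin> A" "b \<notin> A" "a \<noteq> c" "c \<notin> A" "b \<noteq> c"
    using indep_count[OF ind, of a] indep_count[OF ind, of b] indep_count[OF ind_ac, of c]
      indep_count[OF ind_bc, of c]
    by (auto simp: A_def not_in_iff split: if_splits)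
  note aux1 = nint_split_aux[OF ne(1) ne(2) ne(4) ne(5) c _ ne(3)]
  have c': "\<And>k. edge_vec c k = edge_vec b k + edge_vec a k" by (simp add: c)
  note aux2 = nint_split_aux[OF ne(1)[symmetric] ne(3) ne(6) ne(5) c' _ ne(2)]
  show "nint (insert a (insert c A)) \<subseteq> nint (insert a (insert b A))"
  proof
    fix p assume "p \<in> nint (insert a (insert c A))"
    from aux1[OF this] show "p \<in> nint (insert a (insert b A))" by (auto simp: nint_def)
  qed
  show "nint (insert b (insert c A)) \<subseteq> nint (insert a (insert b A))"
  proof
    fix p assume "p \<in> nint (insert b (insert c A))"
    from aux2[OF this] show "p \<in> nint (insert a (insert b A))"
      by (auto simp: nint_def insert_commute)
  qed
  show "nint (insert a (insert c A)) \<inter> nint (insert b (insert c A)) = {}"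
  proof (rule ccontr)
    assume "\<not> ?thesis"
    then obtain p where p: "p \<in> nint (insert a (insert c A))" "p \<in> nint (insert b (insert c A))" by auto
    obtain E where E: "set_mset E = insert a (insert b A)" "p = vsum E" "count E b < count E a"
      using aux1[OF p(1)] by blast
    obtain E' where E': "set_mset E' = insert b (insert a A)" "p = vsum E'" "count E' a < count E' b"
      using aux2[OF p(2)] by blast
    have "E = E'"
    proof (rule indep_vsum_inj[OF ind])
      show "set_mset E \<subseteq> set_mset (add_mset a (add_mset b G))" "set_mset E' \<subseteq> set_mset (add_mset a (add_mset b G))"
        unfolding E(1) E'(1) by (auto simp: A_def)
      show "vsum E = vsum E'" using E(2) E'(2) by metis
    qed
    then show False using E(3) E'(3) by simp
  qed
qed

section \<open>Norm levels and the number of lattice points on them\<close>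

definition l1_norm :: "nat \<Rightarrow> (nat \<Rightarrow> real) \<Rightarrow> real" where
  "l1_norm n p = (\<Sum>k=1..n. \<bar>p k\<bar>)"

text \<open>The coordinates are integers bounded by the norm, and they vanish outside
  \<open>{1..n}\<close>.\<close>

lemma finite_ncone_le:
  assumes "\<And>e. e \<in> A \<Longrightarrow> edge_on n e"
  shows "finite {p \<in> ncone A. l1_norm n p = real r}"
proof -
  define B where "B = real_of_int ` {- int r..int r}"
  have "finite {p. \<forall>k. (k \<in> {1..n} \<longrightarrow> p k \<in> B) \<and> (k \<notin> {1..n} \<longrightarrow> p k = (0::real))}"
    by (rule finite_set_of_finite_funs) (auto simp: B_def)
  moreover have "p k \<in> B" if p: "p \<in> ncone A" and r: "l1_norm n p = real r" and k: "k \<in> {1..n}" for p k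
  proof -
    obtain E where E: "set_mset E \<subseteq> A" "p = vsum E" using p by (auto simp: ncone_def)
    have "vsum E k \<in> \<int>" for E
    proof (induction E)
      case (add e E)
      have "edge_vec e k \<in> \<int>"
        by (cases e; cases "snd (snd e)") (auto simp: unit_vec_def)
      then show ?case using add by (simp add: vsum_add_mset)
    qed simp
    then have "p k \<in> \<int>" using E by simp
    then obtain z where z: "p k = of_int z" by (rule Ints_cases)
    have "\<bar>p k\<bar> \<le> real r" unfolding r[symmetric] l1_norm_def using k by (intro member_le_sum) auto
    then show ?thesis unfolding B_def z by (intro imageI) auto
  qed
  moreover have "p k = 0" if p: "p \<in> ncone A" and k: "k \<notin> {1..n}" for p k
  proof -
    obtain E where E: "set_mset E \<subseteq> A" "p = vsum E" using p by (auto simp: ncone_def)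
    have "vsum E k = 0" using E(1)
    proof (induction E)
      case (add e E)
      then have "edge_on n e" using assms by auto
      then have "edge_vec e k = 0" using k
        by (cases e; cases "snd (snd e)") (auto simp: unit_vec_def)
      then show ?case using add by (simp add: vsum_add_mset)
    qed simp
    then show ?thesis using E by simp
  qed
  ultimately show ?thesis
    by (auto elim!: finite_subset[rotated])
qed

lemma l1_norm_edge_vec:
  assumes "edge_on n e"
  shows "l1_norm n (edge_vec e) = 2"
proof -
  obtain i j s where e: "e = (i, j, s)" by (cases e)
  have ij: "i \<in> {1..n}" "j \<in> {1..n}" using assms e by auto
  have "\<bar>edge_vec e k\<bar> = unit_vec i k + unit_vec j k" if "i \<noteq> j \<or> s = Pos" for k
    using that by (cases s) (auto simp: e unit_vec_def)
  moreover have "i \<noteq> j \<or> s = Pos" using assms e by auto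
  moreover have "(\<Sum>k=1..n. unit_vec i k) = 1" if "i \<in> {1..n}" for i
    using that by (simp add: unit_vec_def)
  ultimately show ?thesis using ij by (simp add: l1_norm_def sum.distrib)
qed

lemma edge_vec_pos_iff: "edge_on n e \<Longrightarrow> 0 < edge_vec e k \<longleftrightarrow> (k, Pos) \<in> incidences e"
  and edge_vec_neg_iff: "edge_on n e \<Longrightarrow> edge_vec e k < 0 \<longleftrightarrow> (k, Neg) \<in> incidences e"
  by (cases e; cases "snd (snd e)"; auto simp: unit_vec_def)+

lemma alternating_subset:
  "alternating G \<Longrightarrow> set_mset E \<subseteq> set_mset G \<Longrightarrow> alternating E"
  unfolding alternating_def by (meson subsetD)

lemma alternating_sign:
  assumes "alternating E" "graph_on n E"
  shows "(\<forall>e\<in>#E. 0 \<le> edge_vec e k) \<or> (\<forall>e\<in>#E. edge_vec e k \<le> 0)"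
proof (rule ccontr)
  assume "\<not> ?thesis"
  then obtain e e' where "e \<in># E" "edge_vec e k < 0" "e' \<in># E" "0 < edge_vec e' k"
    by (auto simp: not_le)
  moreover from this have "edge_on n e" "edge_on n e'" using assms(2) by (auto simp: graph_on_def)
  ultimately have "(k, Neg) \<in> incidences e" "(k, Pos) \<in> incidences e'" "e \<in># E" "e' \<in># E"
    by (auto simp: edge_vec_pos_iff edge_vec_neg_iff)
  then show False using assms(1) unfolding alternating_def by blast
qed

lemma sum_mset_abs_same_sign:
  fixes f :: "'a \<Rightarrow> real"
  assumes "(\<forall>e\<in>#E. 0 \<le> f e) \<or> (\<forall>e\<in>#E. f e \<le> 0)"
  shows "\<bar>\<Sum>e\<in>#E. f e\<bar> = (\<Sum>e\<in>#E. \<bar>f e\<bar>)"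
proof -
  have "(\<Sum>e\<in>#E. f e) \<ge> 0 \<and> \<bar>\<Sum>e\<in>#E. f e\<bar> = (\<Sum>e\<in>#E. \<bar>f e\<bar>)" if "\<forall>e\<in>#E. 0 \<le> f e"
    using that by (induction E) auto
  moreover have "(\<Sum>e\<in>#E. f e) \<le> 0 \<and> \<bar>\<Sum>e\<in>#E. f e\<bar> = (\<Sum>e\<in>#E. \<bar>f e\<bar>)" if "\<forall>e\<in>#E. f e \<le> 0"
    using that by (induction E) auto
  ultimately show ?thesis using assms by blast
qed

text \<open>All edges agree in sign at each vertex, so absolute values move inside the sum and every
  edge contributes its own norm.\<close>

lemma l1_norm_vsum_alternating:
  assumes "alternating E" "graph_on n E"
  shows "l1_norm n (vsum E) = 2 * real (size E)"
proof -
  have "l1_norm n (vsum E) = (\<Sum>k=1..n. \<Sum>e\<in>#E. \<bar>edge_vec e k\<bar>)"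
    unfolding vsum_def l1_norm_def
    by (rule sum.cong[OF refl], rule sum_mset_abs_same_sign, rule alternating_sign[OF assms])
  also have "\<dots> = (\<Sum>e\<in>#E. \<Sum>k=1..n. \<bar>edge_vec e k\<bar>)"
    by (induction E) (auto simp: sum.distrib)
  also have "\<dots> = (\<Sum>e\<in>#E. 2)"
  proof (rule arg_cong[where f = sum_mset], rule image_mset_cong)
    fix e assume "e \<in># E"
    then have "edge_on n e" using assms(2) by (simp add: graph_on_def)
    then show "(\<Sum>k=1..n. \<bar>edge_vec e k\<bar>) = 2" using l1_norm_edge_vec unfolding l1_norm_def by blast
  qed
  finally show ?thesis by simp
qed

lemma size_eq_card_set_mset:
  assumes "\<And>e. count G e \<le> 1"
  shows "size G = card (set_mset G)"
proof -
  have "size G = (\<Sum>e\<in>set_mset G. count G e)" by (simp add: size_multiset_overloaded_eq)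
  also have "\<dots> = (\<Sum>e\<in>set_mset G. 1)"
  proof (rule sum.cong[OF refl])
    fix e assume "e \<in># G"
    then have "count G e \<ge> 1" by simp
    then show "count G e = 1" using assms[of e] by linarith
  qed
  finally show ?thesis by simp
qed

text \<open>Norm \<open>2 * r\<close> singles out the combinations with \<open>r\<close> edges
  counted with multiplicity. Independence makes them distinct points, so what is counted are the
  multisets of size \<open>r\<close>.\<close>

lemma card_ncone_alternating:
  assumes "indep edge_vec G" "alternating G" "graph_on n G"
  shows "card {p \<in> ncone (set_mset G). l1_norm n p = real (2 * r)} = (size G + r - 1) choose r"
proof -
  have sz: "size G = card (set_mset G)"
    by (rule size_eq_card_set_mset[OF indep_count[OF assms(1)]])
  have graph: "alternating E" "graph_on n E" if "set_mset E \<subseteq> set_mset G" for E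
    using that assms by (auto simp: graph_on_def intro: alternating_subset)
  have "{p \<in> ncone (set_mset G). l1_norm n p = real (2 * r)} = vsum ` multisets_of_size (set_mset G) r"
  proof (intro equalityI subsetI)
    fix p assume "p \<in> {p \<in> ncone (set_mset G). l1_norm n p = real (2 * r)}"
    then obtain E where E: "set_mset E \<subseteq> set_mset G" "p = vsum E" "l1_norm n p = real (2 * r)"
      by (auto simp: ncone_def)
    then have "size E = r" using l1_norm_vsum_alternating[of E n] graph[of E] by simp
    then show "p \<in> vsum ` multisets_of_size (set_mset G) r"
      using E by (auto simp: multisets_of_size_def)
  next
    fix p assume "p \<in> vsum ` multisets_of_size (set_mset G) r"
    then show "p \<in> {p \<in> ncone (set_mset G). l1_norm n p = real (2 * r)}"
      using l1_norm_vsum_alternating graph by (auto simp: ncone_def multisets_of_size_def)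
  qed
  moreover have "inj_on vsum (multisets_of_size (set_mset G) r)"
    by (rule inj_onI, rule indep_vsum_inj[OF assms(1)]) (auto simp: multisets_of_size_def)
  ultimately show ?thesis
    by (simp add: card_image card_multisets_of_size sz)
qed

text \<open>Removing one copy of every edge maps the strictly positive combinations bijectively to
  all combinations. This lowers the number of edges by \<open>size G\<close>, which is why the level
  is shifted while the binomial coefficient is that of the closed cone.\<close>

lemma card_nint_alternating:
  assumes "indep edge_vec G" "alternating G" "graph_on n G"
  shows "card {p \<in> nint (set_mset G). l1_norm n p = real (2 * (size G + r))} = (size G + r - 1) choose r"
proof -
  have sz: "size G = card (set_mset G)"
    by (rule size_eq_card_set_mset[OF indep_count[OF assms(1)]])
  have graph: "alternating E" "graph_on n E" if "set_mset E \<subseteq> set_mset G" for E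
    using that assms by (auto simp: graph_on_def intro: alternating_subset)
  have "{p \<in> nint (set_mset G). l1_norm n p = real (2 * (size G + r))} =
     vsum ` ((+) G ` multisets_of_size (set_mset G) r)"
  proof (intro equalityI subsetI)
    fix p assume "p \<in> {p \<in> nint (set_mset G). l1_norm n p = real (2 * (size G + r))}"
    then obtain E where E: "set_mset E = set_mset G" "p = vsum E" "l1_norm n p = real (2 * (size G + r))"
      by (auto simp: nint_def)
    have sE: "size E = size G + r" using E l1_norm_vsum_alternating[of E n] graph[of E] by simp
    have "G \<subseteq># E"
    proof (rule mset_subset_eqI)
      fix e
      show "count G e \<le> count E e"
      proof (cases "e \<in># G")
        case True
        then have "1 \<le> count E e" using E(1) by simp
        then show ?thesis using indep_count[OF assms(1), of e] by linarith
      next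
        case False
        then show ?thesis by (simp add: not_in_iff)
      qed
    qed
    then have "E = G + (E - G)" by simp
    moreover have "E - G \<in> multisets_of_size (set_mset G) r"
      using sE E(1) \<open>G \<subseteq># E\<close> by (auto simp: multisets_of_size_def size_Diff_submset dest: in_diffD)
    ultimately show "p \<in> vsum ` ((+) G ` multisets_of_size (set_mset G) r)"
      using E by blast
  next
    fix p assume "p \<in> vsum ` ((+) G ` multisets_of_size (set_mset G) r)"
    then obtain E where "set_mset E \<subseteq> set_mset G" "size E = r" "p = vsum (G + E)"
      by (auto simp: multisets_of_size_def)
    then show "p \<in> {p \<in> nint (set_mset G). l1_norm n p = real (2 * (size G + r))}"
      using l1_norm_vsum_alternating[of "G + E" n] graph[of "G + E"]
      by (auto simp: nint_def intro!: image_eqI[of _ _ "G + E"])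
  qed
  moreover have "inj_on vsum ((+) G ` multisets_of_size (set_mset G) r)"
    by (rule inj_onI, rule indep_vsum_inj[OF assms(1)]) (auto simp: multisets_of_size_def)
  moreover have "inj_on ((+) G) (multisets_of_size (set_mset G) r)"
    by (auto simp: inj_on_def)
  ultimately show ?thesis
    by (simp add: card_image card_multisets_of_size sz)
qed


section \<open>Reduction rules on graphs\<close>

text \<open>Graph counterpart of \<open>red_rule\<close>. The terms of a right-hand side become a
  list, over which sums and pairwise disjointness can be stated.\<close>

inductive graph_rule :: "sgraph \<Rightarrow> sgraph list \<Rightarrow> bool" where
  NegNeg: "i < j \<Longrightarrow> j < k \<Longrightarrow> graph_rule {#(i, j, Neg), (j, k, Neg)#}
     [{#(i, k, Neg), (i, j, Neg)#}, {#(j, k, Neg), (i, k, Neg)#}]"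
| NegPos: "i < j \<Longrightarrow> j < k \<Longrightarrow> graph_rule {#(i, j, Neg), (j, k, Pos)#}
     [{#(i, k, Pos), (i, j, Neg)#}, {#(j, k, Pos), (i, k, Pos)#}]"
| OuterNeg: "i < j \<Longrightarrow> j < k \<Longrightarrow> graph_rule {#(i, k, Neg), (j, k, Pos)#}
     [{#(j, k, Pos), (i, j, Pos)#}, {#(i, j, Pos), (i, k, Neg)#}]"
| OuterPos: "i < j \<Longrightarrow> j < k \<Longrightarrow> graph_rule {#(i, k, Pos), (j, k, Neg)#}
     [{#(j, k, Neg), (i, j, Pos)#}, {#(i, j, Pos), (i, k, Pos)#}]"
| Loop: "i < j \<Longrightarrow> graph_rule {#(i, j, Neg), (j, j, Pos)#}
     [{#(i, i, Pos), (i, j, Neg)#}, {#(i, j, Pos), (i, i, Pos)#}, {#(j, j, Pos), (i, j, Pos)#}]"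

text \<open>Incidence vectors of the graph oriented from the smaller to the larger endpoint, signs
  forgotten. A loop gets a unit vector in place of zero, so that it does not by itself spoil
  independence. Unlike \<open>edge_vec\<close>, these vectors detect every nonloop cycle, in
  particular two edges with equal endpoints and opposite signs.\<close>

fun unsigned_vec :: "edge \<Rightarrow> nat \<Rightarrow> real" where
  "unsigned_vec (i, j, s) = (\<lambda>k. if i = j then unit_vec i k else unit_vec i k - unit_vec j k)"

text \<open>Geometrically a rule inserts the sum of the two edge vectors. The loop rule does so
  twice: \<open>x = (i, j, Neg)\<close> and \<open>z = (j, j, Pos)\<close> have the sum
  \<open>y = (i, j, Pos)\<close>, and the part of \<open>x\<close> and \<open>y\<close> is split
  again by their sum \<open>d = (i, i, Pos)\<close>. The part of \<open>z\<close> and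
  \<open>y\<close> stays whole, which makes three outcomes.\<close>

lemma graph_rule_split:
  assumes "graph_rule L Rs"
  obtains (two) a b c where "L = {#a, b#}" "Rs = [{#a, c#}, {#b, c#}]" "a \<noteq> b"
      "\<And>k. edge_vec c k = edge_vec a k + edge_vec b k"
  | (three) x z y d where "L = {#x, z#}" "Rs = [{#x, d#}, {#y, d#}, {#z, y#}]" "x \<noteq> z" "x \<noteq> y"
      "\<And>k. edge_vec y k = edge_vec x k + edge_vec z k"
      "\<And>k. edge_vec d k = edge_vec x k + edge_vec y k"
  using assms
proof cases
  case (NegNeg i j k)
  show ?thesis by (rule two[of "(i, j, Neg)" "(j, k, Neg)" "(i, k, Neg)"]) (use NegNeg in auto)
next
  case (NegPos i j k)
  show ?thesis by (rule two[of "(i, j, Neg)" "(j, k, Pos)" "(i, k, Pos)"]) (use NegPos in auto)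
next
  case (OuterNeg i j k)
  show ?thesis by (rule two[of "(j, k, Pos)" "(i, k, Neg)" "(i, j, Pos)"]) (use OuterNeg in auto)
next
  case (OuterPos i j k)
  show ?thesis by (rule two[of "(j, k, Neg)" "(i, k, Pos)" "(i, j, Pos)"]) (use OuterPos in auto)
next
  case (Loop i j)
  show ?thesis by (rule three[of "(i, j, Neg)" "(j, j, Pos)" "(i, i, Pos)" "(i, j, Pos)"]) (use Loop in auto)
qed

lemma graph_rule_indep:
  assumes "graph_rule L Rs" "indep edge_vec (L + G)" "R \<in> set Rs"
  shows "indep edge_vec (R + G)"
  using assms(1)
proof (cases rule: graph_rule_split)
  case (two a b c)
  have ab: "indep edge_vec (add_mset a (add_mset b G))" using assms(2) two by simp
  have "indep edge_vec (add_mset c (add_mset b G))"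
    by (rule indep_exchange[OF ab, of 1 _ 1]) (use two in auto)
  moreover have "indep edge_vec (add_mset c (add_mset a G))"
    by (rule indep_exchange[OF indep_swap[OF ab], of 1 _ 1]) (use two in auto)
  ultimately show ?thesis using assms(3) two by (auto simp: add_mset_commute)
next
  case (three x z y d)
  have xz: "indep edge_vec (add_mset x (add_mset z G))" using assms(2) three by simp
  have yz: "indep edge_vec (add_mset y (add_mset z G))"
    by (rule indep_exchange[OF xz, of 1 _ 1]) (use three in auto)
  have yx: "indep edge_vec (add_mset y (add_mset x G))"
    by (rule indep_exchange[OF indep_swap[OF xz], of 1 _ 1]) (use three in auto)
  have "indep edge_vec (add_mset d (add_mset x G))"
    by (rule indep_exchange[OF yx, of 1 _ 1]) (use three in auto)
  moreover have "indep edge_vec (add_mset d (add_mset y G))"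
    by (rule indep_exchange[OF indep_swap[OF yx], of 1 _ 1]) (use three in auto)
  ultimately show ?thesis using assms(3) three yz by (auto simp: add_mset_commute)
qed

text \<open>With signs forgotten the inserted edge need not be the sum: in the two outer rules it is
  a difference, and in the loop rule \<open>(i, j, Pos)\<close> has the same vector as
  \<open>(i, j, Neg)\<close>. Hence the treatment rule by rule, each time with coefficients suited
  to the exchange.\<close>

lemma graph_rule_indep_unsigned:
  assumes "graph_rule L Rs" "indep unsigned_vec (L + G)" "R \<in> set Rs"
  shows "indep unsigned_vec (R + G)"
  using assms(1)
proof cases
  case (NegNeg i j k)
  have ab: "indep unsigned_vec (add_mset (i, j, Neg) (add_mset (j, k, Neg) G))" using assms(2) NegNeg by simp
  have "indep unsigned_vec (add_mset (i, k, Neg) (add_mset (j, k, Neg) G))"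
    by (rule indep_exchange[OF ab, of 1 _ 1]) (use NegNeg in auto)
  moreover have "indep unsigned_vec (add_mset (i, k, Neg) (add_mset (i, j, Neg) G))"
    by (rule indep_exchange[OF indep_swap[OF ab], of 1 _ 1]) (use NegNeg in auto)
  ultimately show ?thesis using assms(3) NegNeg by (auto simp: add_mset_commute)
next
  case (NegPos i j k)
  have ab: "indep unsigned_vec (add_mset (i, j, Neg) (add_mset (j, k, Pos) G))" using assms(2) NegPos by simp
  have "indep unsigned_vec (add_mset (i, k, Pos) (add_mset (j, k, Pos) G))"
    by (rule indep_exchange[OF ab, of 1 _ 1]) (use NegPos in auto)
  moreover have "indep unsigned_vec (add_mset (i, k, Pos) (add_mset (i, j, Neg) G))"
    by (rule indep_exchange[OF indep_swap[OF ab], of 1 _ 1]) (use NegPos in auto)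
  ultimately show ?thesis using assms(3) NegPos by (auto simp: add_mset_commute)
next
  case (OuterNeg i j k)
  have ab: "indep unsigned_vec (add_mset (i, k, Neg) (add_mset (j, k, Pos) G))" using assms(2) OuterNeg by simp
  have "indep unsigned_vec (add_mset (i, j, Pos) (add_mset (j, k, Pos) G))"
    by (rule indep_exchange[OF ab, of 1 _ "-1"]) (use OuterNeg in auto)
  moreover have "indep unsigned_vec (add_mset (i, j, Pos) (add_mset (i, k, Neg) G))"
    by (rule indep_exchange[OF indep_swap[OF ab], of "-1" _ 1]) (use OuterNeg in auto)
  ultimately show ?thesis using assms(3) OuterNeg by (auto simp: add_mset_commute)
next
  case (OuterPos i j k)
  have ab: "indep unsigned_vec (add_mset (i, k, Pos) (add_mset (j, k, Neg) G))" using assms(2) OuterPos by simp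
  have "indep unsigned_vec (add_mset (i, j, Pos) (add_mset (j, k, Neg) G))"
    by (rule indep_exchange[OF ab, of 1 _ "-1"]) (use OuterPos in auto)
  moreover have "indep unsigned_vec (add_mset (i, j, Pos) (add_mset (i, k, Pos) G))"
    by (rule indep_exchange[OF indep_swap[OF ab], of "-1" _ 1]) (use OuterPos in auto)
  ultimately show ?thesis using assms(3) OuterPos by (auto simp: add_mset_commute)
next
  case (Loop i j)
  have xz: "indep unsigned_vec (add_mset (i, j, Neg) (add_mset (j, j, Pos) G))" using assms(2) Loop by simp
  have "indep unsigned_vec (add_mset (i, j, Pos) (add_mset (j, j, Pos) G))"
    by (rule indep_exchange[OF xz, of 1 _ 0]) (use Loop in auto)
  moreover have dx: "indep unsigned_vec (add_mset (i, i, Pos) (add_mset (i, j, Neg) G))"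
    by (rule indep_exchange[OF indep_swap[OF xz], of 1 _ 1]) (use Loop in auto)
  moreover have "indep unsigned_vec (add_mset (i, j, Pos) (add_mset (i, i, Pos) G))"
    by (rule indep_exchange[OF indep_swap[OF dx], of 1 _ 0]) (use Loop in auto)
  ultimately show ?thesis using assms(3) Loop by (auto simp: add_mset_commute)
qed

lemma graph_rule_ncone:
  assumes "graph_rule L Rs"
  shows "ncone (set_mset (L + G)) \<subseteq> (\<Union>R\<in>set Rs. ncone (set_mset (R + G)))"
  using assms
proof (cases rule: graph_rule_split)
  case (two a b c)
  then show ?thesis
    using ncone_split[of a b c "set_mset G"] by (auto simp: insert_commute)
next
  case (three x z y d)
  have "ncone (insert x (insert z (set_mset G))) \<subseteq>
      ncone (insert x (insert y (set_mset G))) \<union> ncone (insert z (insert y (set_mset G)))"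
    by (rule ncone_split) (use three in auto)
  moreover have "ncone (insert x (insert y (set_mset G))) \<subseteq>
      ncone (insert x (insert d (set_mset G))) \<union> ncone (insert y (insert d (set_mset G)))"
    by (rule ncone_split) (use three in auto)
  ultimately show ?thesis using three by (auto simp: insert_commute)
qed

lemma graph_rule_nint:
  assumes "graph_rule L Rs" "indep edge_vec (L + G)"
  shows "(\<forall>R\<in>set Rs. nint (set_mset (R + G)) \<subseteq> nint (set_mset (L + G))) \<and>
    sorted_wrt (\<lambda>R R'. nint (set_mset (R + G)) \<inter> nint (set_mset (R' + G)) = {}) Rs"
  using assms(1)
proof (cases rule: graph_rule_split)
  case (two a b c)
  have ab: "indep edge_vec (add_mset a (add_mset b G))" using assms(2) two by simp
  show ?thesis
    using nint_split[OF ab two(4)] two by (auto simp: insert_commute)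
next
  case (three x z y d)
  have xz: "indep edge_vec (add_mset x (add_mset z G))" using assms(2) three by simp
  have xy: "indep edge_vec (add_mset x (add_mset y G))"
    by (rule indep_swap, rule indep_exchange[OF indep_swap[OF xz], of 1 _ 1]) (use three in auto)
  \<comment> \<open>The second split refines the half of \<open>x\<close> and \<open>y\<close> from
    the first, so its parts inherit disjointness from the half of \<open>z\<close> and
    \<open>y\<close>.\<close>
  note 1 = nint_split[OF xz three(5)] and 2 = nint_split[OF xy three(6)]
  have "nint (set_mset ({#x, d#} + G)) \<subseteq> nint (set_mset (L + G))"
    "nint (set_mset ({#y, d#} + G)) \<subseteq> nint (set_mset (L + G))"
    "nint (set_mset ({#z, y#} + G)) \<subseteq> nint (set_mset (L + G))"
    using 1 2 three(1) by (auto simp: insert_commute)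
  moreover have "nint (set_mset ({#x, d#} + G)) \<inter> nint (set_mset ({#y, d#} + G)) = {}"
    using 2(3) by (simp add: insert_commute)
  moreover have "nint (set_mset ({#x, d#} + G)) \<inter> nint (set_mset ({#z, y#} + G)) = {}"
    using 1(3) 2(1) by (auto simp: insert_commute)
  moreover have "nint (set_mset ({#y, d#} + G)) \<inter> nint (set_mset ({#z, y#} + G)) = {}"
    using 1(3) 2(2) by (auto simp: insert_commute)
  ultimately show ?thesis by (simp add: three(2) del: union_mset_add_mset_left)
qed

lemma graph_rule_edge_vec:
  assumes "graph_rule L Rs" "R \<in> set Rs" "e \<in># R"
  shows "edge_vec e \<in> ncone (set_mset L)"
proof -
  have sum2: "edge_vec c \<in> ncone A"
    if a: "a \<in> A" and b: "edge_vec b \<in> ncone A"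
      and c: "\<And>k. edge_vec c k = edge_vec a k + edge_vec b k" for a b c A
  proof -
    obtain E where E: "set_mset E \<subseteq> A" "edge_vec b = vsum E" using b by (auto simp: ncone_def)
    have "edge_vec c = vsum (add_mset a E)"
      by (intro ext) (simp add: c E vsum_add_mset)
    then show ?thesis using E a by (auto simp: ncone_def)
  qed
  show ?thesis using assms(1)
  proof (cases rule: graph_rule_split)
    case (two a b c)
    have "edge_vec c \<in> ncone (set_mset L)"
      by (rule sum2[OF _ _ two(4)]) (auto simp: two(1) intro: edge_vec_in_ncone)
    then show ?thesis using two assms by (auto intro: edge_vec_in_ncone)
  next
    case (three x z y d)
    have y: "edge_vec y \<in> ncone (set_mset L)"
      by (rule sum2[OF _ _ three(5)]) (auto simp: three(1) intro: edge_vec_in_ncone)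
    have "edge_vec d \<in> ncone (set_mset L)"
      by (rule sum2[OF _ y three(6)]) (auto simp: three(1))
    then show ?thesis using y three assms by (auto intro: edge_vec_in_ncone)
  qed
qed

lemma graph_rule_size: "graph_rule L Rs \<Longrightarrow> R \<in> set Rs \<Longrightarrow> size R = size L"
  by (auto elim!: graph_rule.cases)

lemma graph_rule_loops:
  "graph_rule L Rs \<Longrightarrow> R \<in> set Rs \<Longrightarrow> size (filter_mset is_loop R) = size (filter_mset is_loop L)"
  by (auto elim!: graph_rule.cases)

lemma graph_rule_graph_on: "graph_rule L Rs \<Longrightarrow> R \<in> set Rs \<Longrightarrow> graph_on n L \<Longrightarrow> graph_on n R"
  by (auto elim!: graph_rule.cases simp: graph_on_def)

lemma graph_rule_valid: "graph_rule L Rs \<Longrightarrow> (i, j, s) \<in># L \<Longrightarrow> i \<le> j \<and> (i = j \<longrightarrow> s = Pos)"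
  by (auto elim!: graph_rule.cases)

text \<open>Invariants that survive a rule applied to any pair of edges. Well-structuredness does
  not: in the graph with edges \<open>(1, 1, Pos)\<close>, \<open>(1, 2, Neg)\<close>,
  \<open>(2, 3, Neg)\<close>, \<open>(2, 4, Neg)\<close>, reducing the second and the third inserts
  \<open>(1, 3, Neg)\<close>, which crosses the last.\<close>

definition good_graph :: "nat \<Rightarrow> nat \<Rightarrow> sgraph \<Rightarrow> bool" where
  "good_graph n m G \<longleftrightarrow> graph_on n G \<and> size G = m \<and> size (filter_mset is_loop G) = 1 \<and>
     indep edge_vec G \<and> indep unsigned_vec G"

lemma graph_rule_good:
  assumes "graph_rule L Rs" "good_graph n m (L + G)" "R \<in> set Rs"
  shows "good_graph n m (R + G)"
  using assms graph_rule_indep[OF assms(1) _ assms(3)] graph_rule_indep_unsigned[OF assms(1) _ assms(3)]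
    graph_rule_size[OF assms(1,3)] graph_rule_loops[OF assms(1,3)] graph_rule_graph_on[OF assms(1,3), of n]
  by (auto simp: good_graph_def graph_on_def)

lemma not_alternatingD:
  assumes "\<not> alternating G" "graph_on n G"
  shows "\<exists>i v e'. (i, v, Neg) \<in># G \<and> i < v \<and> e' \<in># G \<and> (v, Pos) \<in> incidences e'"
proof -
  obtain e0 e1 v s0 s1 where *: "e0 \<in># G" "e1 \<in># G" "(v, s0) \<in> incidences e0"
      "(v, s1) \<in> incidences e1" "s0 \<noteq> s1"
    using assms(1) unfolding alternating_def by blast
  obtain e e' where e: "e \<in># G" "e' \<in># G" "(v, Neg) \<in> incidences e" "(v, Pos) \<in> incidences e'"
    by (cases s0; cases s1; use * that in blast)
  have "edge_on n e" using e assms(2) by (auto simp: graph_on_def)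
  then obtain i where "e = (i, v, Neg)" "i < v"
    using e(3) by (cases e; cases "snd (snd e)") auto
  then show ?thesis using e by blast
qed

text \<open>A vertex \<open>v\<close> with both signs has an edge \<open>(i, v, Neg)\<close> and an
  edge positive at \<open>v\<close>, and the position of the latter selects one of the five rules.
  The only partner without a rule is \<open>(i, v, Pos)\<close>.\<close>

lemma good_graph_irreducible_alternating:
  assumes "good_graph n m G" and irred: "\<And>L Rs. graph_rule L Rs \<Longrightarrow> \<not> L \<subseteq># G"
  shows "alternating G"
proof (rule ccontr)
  assume "\<not> alternating G"
  then obtain i v e' where e': "(i, v, Neg) \<in># G" "i < v" "e' \<in># G" "(v, Pos) \<in> incidences e'"
    using not_alternatingD assms(1) unfolding good_graph_def by blast
  define e where "e = (i, v, Neg)"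
  have e: "e \<in># G" "e' \<in># G" "(v, Pos) \<in> incidences e'" and i: "e = (i, v, Neg)" "i < v"
    using e' by (auto simp: e_def)
  have on: "edge_on n e" "edge_on n e'" using e assms(1) by (auto simp: good_graph_def graph_on_def)
  have sub: "{#e, e'#} \<subseteq># G" if "e \<noteq> e'"
    using e that by (simp add: insert_subset_eq_iff in_diff_count)
  \<comment> \<open>Both edges have the same \<open>unsigned_vec\<close>, so the coefficients 1 and
    -1 give a dependence.\<close>
  have no_double: "(i, v, Pos) \<notin># G"
  proof
    assume p: "(i, v, Pos) \<in># G"
    have ind: "indep unsigned_vec G" using assms(1) by (simp add: good_graph_def)
    define c where "c = (\<lambda>_. 0::real)((i, v, Neg) := 1, (i, v, Pos) := -1)"
    have "{#(i, v, Neg), (i, v, Pos)#} \<subseteq># G"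
      using p e(1) i by (simp add: insert_subset_eq_iff in_diff_count)
    then obtain G0 where G0: "G = add_mset (i, v, Neg) (add_mset (i, v, Pos) G0)"
      by (auto simp: mset_subset_eq_exists_conv)
    have "(i, v, Neg) \<notin># G0" "(i, v, Pos) \<notin># G0"
      using indep_count[OF ind, of "(i, v, Neg)"] indep_count[OF ind, of "(i, v, Pos)"]
      by (auto simp: G0 not_in_iff)
    then have "(\<Sum>e\<in>#G0. c e * unsigned_vec e k) = 0" for k
      by (subst sum_mset_coeff_cong[where d = "\<lambda>_. 0"]) (auto simp: c_def)
    then have "(\<Sum>e\<in>#G. c e * unsigned_vec e k) = 0" for k
      by (simp add: G0) (simp add: c_def)
    from indepD[OF ind this, of "(i, v, Neg)"] have "c (i, v, Neg) = 0"
      by (simp add: G0)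
    then show False by (simp add: c_def)
  qed
  obtain a b s where e': "e' = (a, b, s)" by (cases e')
  have ab: "a \<le> b" using on e' by simp
  consider "s = Neg" "a = v" "v < b" | "s = Pos" "a = v" "v < b" | "s = Pos" "a = v" "b = v"
    | "s = Pos" "b = v" "a < v" "a < i" | "s = Pos" "b = v" "a < v" "i < a"
  proof (cases s)
    case Neg
    then show ?thesis using e(3) on(2) e' that(1) by auto
  next
    case Pos
    then have "v = a \<or> v = b" using e(3) e' by simp
    moreover have "a \<noteq> i" if "b = v" using e(2) e' Pos no_double that by auto
    ultimately show ?thesis using that ab Pos by (metis linorder_neqE_nat nat_less_le)
  qed
  then have "\<exists>L Rs. graph_rule L Rs \<and> L = {#e, e'#}"
  proof cases
    case 1 then show ?thesis unfolding i e' using i(2) by (blast intro: NegNeg)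
  next
    case 2 then show ?thesis unfolding i e' using i(2) by (blast intro: NegPos)
  next
    case 3 then show ?thesis unfolding i e' using i(2) by (blast intro: Loop)
  next
    case 4 then show ?thesis unfolding i e' using i(2) OuterPos[of a i v] by (auto simp: add_mset_commute)
  next
    case 5 then show ?thesis unfolding i e' using i(2) OuterNeg[of i a v] by (auto simp: add_mset_commute)
  qed
  moreover have "e \<noteq> e'" using e i by auto
  ultimately show False using irred sub by blast
qed


section \<open>Reduction of polynomials\<close>

definition graph_mono :: "sgraph \<Rightarrow> monom" where
  "graph_mono G = image_mset edge_var G"

fun var_edge :: "var \<Rightarrow> edge" where
  "var_edge (X i j) = (i, j, Neg)"
| "var_edge (Y i j) = (i, j, Pos)"
| "var_edge (Z i) = (i, i, Pos)"

text \<open>Weights are defined on graphs while polynomials are sums over monomials; this recovers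
  the graph from its monomial.\<close>

definition mono_graph :: "monom \<Rightarrow> sgraph" where
  "mono_graph M = image_mset var_edge M"

lemma var_edge_edge_var: "(fst e = fst (snd e) \<Longrightarrow> snd (snd e) = Pos) \<Longrightarrow> var_edge (edge_var e) = e"
  by (cases e rule: edge_var.cases) auto

lemma mono_graph_mono:
  assumes "\<And>i s. (i, i, s) \<in># G \<Longrightarrow> s = Pos"
  shows "mono_graph (graph_mono G) = G"
proof -
  have "mono_graph (graph_mono G) = image_mset id G"
    unfolding mono_graph_def graph_mono_def image_mset.compositionality
    by (rule image_mset_cong) (use assms in \<open>auto intro!: var_edge_edge_var\<close>)
  then show ?thesis by simp
qed

lemma mono_graph_mono_on: "graph_on n G \<Longrightarrow> mono_graph (graph_mono G) = G"
  by (rule mono_graph_mono) (force simp: graph_on_def)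

lemma graph_monomial_eq: "graph_monomial G = Poly_Mapping.single (graph_mono G) 1"
  unfolding graph_monomial_def graph_mono_def
  by (induction G) (auto simp: Var_def mult_single)

lemma red_rule_graph:
  assumes "red_rule L R"
  shows "\<exists>L' Rs. graph_rule L' Rs \<and> L = graph_mono L' \<and>
    R = (\<Sum>R'\<leftarrow>Rs. Poly_Mapping.single (graph_mono R') 1)"
  using assms
proof cases
  case (1 i j k)
  show ?thesis by (intro exI conjI, rule NegNeg[OF 1(3,4)])
    (use 1 in \<open>auto simp: graph_mono_def Var_def mult_single add_mset_commute\<close>)
next
  case (2 i j k)
  show ?thesis by (intro exI conjI, rule NegPos[OF 2(3,4)])
    (use 2 in \<open>auto simp: graph_mono_def Var_def mult_single add_mset_commute\<close>)
next
  case (3 i j k)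
  show ?thesis by (intro exI conjI, rule OuterNeg[OF 3(3,4)])
    (use 3 in \<open>auto simp: graph_mono_def Var_def mult_single add_mset_commute\<close>)
next
  case (4 i j k)
  show ?thesis by (intro exI conjI, rule OuterPos[OF 4(3,4)])
    (use 4 in \<open>auto simp: graph_mono_def Var_def mult_single add_mset_commute\<close>)
next
  case (5 i j)
  show ?thesis by (intro exI conjI, rule Loop[OF 5(3)])
    (use 5 in \<open>auto simp: graph_mono_def Var_def mult_single add_mset_commute\<close>)
qed

lemma graph_rule_red:
  assumes "graph_rule L Rs"
  shows "\<exists>R. red_rule (graph_mono L) R"
  using assms
  by cases (auto simp: graph_mono_def intro: red_rule.intros)

section \<open>Linear functionals on polynomials and their growth under reduction\<close>

definition pairing :: "(monom \<Rightarrow> rat) \<Rightarrow> cpoly \<Rightarrow> rat" where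
  "pairing w P = (\<Sum>M\<in>Poly_Mapping.keys P. Poly_Mapping.lookup P M * w M)"

lemma pairing_superset:
  assumes "finite S" "Poly_Mapping.keys P \<subseteq> S"
  shows "pairing w P = (\<Sum>M\<in>S. Poly_Mapping.lookup P M * w M)"
  unfolding pairing_def
  by (rule sum.mono_neutral_left) (use assms in \<open>auto simp: in_keys_iff\<close>)

lemma pairing_add: "pairing w (P + Q) = pairing w P + pairing w Q"
proof -
  let ?S = "Poly_Mapping.keys P \<union> Poly_Mapping.keys Q"
  have "Poly_Mapping.keys (P + Q) \<subseteq> ?S" by (rule keys_add)
  then have "pairing w (P + Q) = (\<Sum>M\<in>?S. Poly_Mapping.lookup (P + Q) M * w M)"
    by (intro pairing_superset) auto
  moreover have "pairing w P = (\<Sum>M\<in>?S. Poly_Mapping.lookup P M * w M)"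
    "pairing w Q = (\<Sum>M\<in>?S. Poly_Mapping.lookup Q M * w M)"
    by (intro pairing_superset; auto)+
  ultimately show ?thesis by (simp add: lookup_add distrib_right sum.distrib)
qed

lemma pairing_single [simp]: "pairing w (Poly_Mapping.single M c) = c * w M"
  by (simp add: pairing_def)

lemma pairing_diff: "pairing w (P - Q) = pairing w P - pairing w Q"
  using pairing_add[of w "P - Q" Q] by simp

lemma pairing_zero [simp]: "pairing w 0 = 0"
  by (simp add: pairing_def)

lemma pairing_sum_list: "pairing w (\<Sum>x\<leftarrow>xs. f x) = (\<Sum>x\<leftarrow>xs. pairing w (f x))"
  by (induction xs) (auto simp: pairing_add)

lemma lookup_sum_list: "Poly_Mapping.lookup (\<Sum>x\<leftarrow>xs. f x) M = (\<Sum>x\<leftarrow>xs. Poly_Mapping.lookup (f x) M)"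
  by (induction xs) (auto simp: lookup_add)

lemma eval_cpoly_one: "eval_cpoly (\<lambda>_. 1) P = pairing (\<lambda>_. 1) P"
  by (simp add: eval_cpoly_def pairing_def)

text \<open>Positivity of the coefficients belongs to the invariant: it preserves the direction of
  inequalities between weights and rules out cancellation.\<close>

definition good_poly :: "nat \<Rightarrow> nat \<Rightarrow> cpoly \<Rightarrow> bool" where
  "good_poly n m P \<longleftrightarrow> (\<forall>M\<in>Poly_Mapping.keys P.
     0 < Poly_Mapping.lookup P M \<and> (\<exists>G. M = graph_mono G \<and> good_graph n m G))"

lemma red_step_graph:
  assumes "red_step P Q" "good_poly n m P"
  obtains L Rs G c where "graph_rule L Rs" "good_graph n m (L + G)" "c > 0"
    "c = Poly_Mapping.lookup P (graph_mono (L + G))"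
    "Q = P - Poly_Mapping.single (graph_mono (L + G)) c
          + (\<Sum>R\<leftarrow>Rs. Poly_Mapping.single (graph_mono (R + G)) c)"
proof -
  obtain M L R where M: "M \<in> Poly_Mapping.keys P" "red_rule L R" "L \<subseteq># M"
    and Q: "Q = P - Poly_Mapping.single M (Poly_Mapping.lookup P M)
              + Poly_Mapping.single (M - L) (Poly_Mapping.lookup P M) * R"
    using assms(1) by (auto simp: red_step_def)
  obtain H where H: "M = graph_mono H" "good_graph n m H" and c: "0 < Poly_Mapping.lookup P M"
    using assms(2) M(1) by (auto simp: good_poly_def)
  obtain L' Rs where L': "graph_rule L' Rs" "L = graph_mono L'"
      "R = (\<Sum>R'\<leftarrow>Rs. Poly_Mapping.single (graph_mono R') 1)"
    using red_rule_graph[OF M(2)] by blast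
  have "mono_graph L = L'"
    using graph_rule_valid[OF L'(1)] L'(2) mono_graph_mono by blast
  moreover have "mono_graph M = H"
    using H mono_graph_mono_on by (auto simp: good_graph_def)
  ultimately have "L' \<subseteq># H"
    using image_mset_subseteq_mono[OF M(3), of var_edge] by (simp add: mono_graph_def)
  then obtain G where G: "H = L' + G" by (auto simp: mset_subset_eq_exists_conv)
  have "M - L = graph_mono G"
    by (simp add: H L' G graph_mono_def)
  then have "Poly_Mapping.single (M - L) (Poly_Mapping.lookup P M) * R =
      (\<Sum>R\<leftarrow>Rs. Poly_Mapping.single (graph_mono (R + G)) (Poly_Mapping.lookup P M))"
    by (simp add: L'(3) sum_list_const_mult[symmetric] mult_single graph_mono_def add.commute)
  then show ?thesis
    using that[OF L'(1) _ c, of G] H G Q by simp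
qed

lemma red_step_good_poly:
  assumes "red_step P Q" "good_poly n m P"
  shows "good_poly n m Q"
proof -
  obtain L Rs G c where r: "graph_rule L Rs" "good_graph n m (L + G)" "c > 0"
    "c = Poly_Mapping.lookup P (graph_mono (L + G))"
    "Q = P - Poly_Mapping.single (graph_mono (L + G)) c
          + (\<Sum>R\<leftarrow>Rs. Poly_Mapping.single (graph_mono (R + G)) c)"
    using red_step_graph[OF assms] .
  have Pnn: "Poly_Mapping.lookup P M \<ge> 0" for M
    using assms(2) by (cases "M \<in> Poly_Mapping.keys P") (auto simp: good_poly_def in_keys_iff intro: less_imp_le)
  show ?thesis unfolding good_poly_def
  proof (intro ballI conjI)
    fix M assume M: "M \<in> Poly_Mapping.keys Q"
    have look: "Poly_Mapping.lookup Q M = (Poly_Mapping.lookup P M - (c when graph_mono (L + G) = M))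
       + (\<Sum>R\<leftarrow>Rs. (c when graph_mono (R + G) = M))"
      by (simp add: r(5) lookup_add lookup_minus lookup_single lookup_sum_list)
    have 1: "(\<Sum>R\<leftarrow>Rs. (c when graph_mono (R + G) = M)) \<ge> 0"
      using r(3) by (intro sum_list_nonneg) (auto simp: when_def)
    \<comment> \<open>The reduced monomial loses its whole coefficient \<open>c\<close>, which
      leaves 0; at the others nothing is subtracted.\<close>
    have 2: "Poly_Mapping.lookup P M - (c when graph_mono (L + G) = M) \<ge> 0"
      using Pnn[of M] r(4) by (auto simp: when_def)
    have nz: "Poly_Mapping.lookup Q M \<noteq> 0" using M by (simp add: in_keys_iff)
    then show "0 < Poly_Mapping.lookup Q M" using 1 2 look by linarith
    show "\<exists>G. M = graph_mono G \<and> good_graph n m G"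
    proof (cases "\<exists>R\<in>set Rs. M = graph_mono (R + G)")
      case True
      then show ?thesis using graph_rule_good[OF r(1,2)] by blast
    next
      case False
      then have "(\<Sum>R\<leftarrow>Rs. (c when graph_mono (R + G) = M)) = 0"
        by (induction Rs) (auto simp: when_def)
      then have "Poly_Mapping.lookup P M \<noteq> 0" using nz look r(3,4) by (auto simp: when_def split: if_splits)
      then show ?thesis using assms(2) by (auto simp: good_poly_def in_keys_iff)
    qed
  qed
qed

text \<open>The functional can only grow if the weight of a graph is at most the total weight of its
  outcomes. The weights used are the number of closed points and the negated number of open
  points.\<close>

lemma red_step_pairing:
  assumes "red_step P Q" "good_poly n m P"
    and "\<And>L Rs G. graph_rule L Rs \<Longrightarrow> good_graph n m (L + G) \<Longrightarrow> w (L + G) \<le> (\<Sum>R\<leftarrow>Rs. w (R + G))"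
  shows "pairing (\<lambda>M. w (mono_graph M)) P \<le> pairing (\<lambda>M. w (mono_graph M)) Q"
proof -
  obtain L Rs G c where r: "graph_rule L Rs" "good_graph n m (L + G)" "c > 0"
    "c = Poly_Mapping.lookup P (graph_mono (L + G))"
    "Q = P - Poly_Mapping.single (graph_mono (L + G)) c
          + (\<Sum>R\<leftarrow>Rs. Poly_Mapping.single (graph_mono (R + G)) c)"
    using red_step_graph[OF assms(1,2)] .
  have mg: "mono_graph (graph_mono H) = H" if "good_graph n m H" for H
    using that mono_graph_mono_on by (auto simp: good_graph_def)
  have "(\<Sum>R\<leftarrow>Rs. c * w (mono_graph (graph_mono (R + G)))) = (\<Sum>R\<leftarrow>Rs. c * w (R + G))"
    using graph_rule_good[OF r(1,2)] by (intro arg_cong[where f = sum_list] map_cong) (auto simp: mg)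
  also have "\<dots> = c * (\<Sum>R\<leftarrow>Rs. w (R + G))"
    by (rule sum_list_const_mult)
  also have "\<dots> \<ge> c * w (L + G)"
    using assms(3)[OF r(1,2)] r(3) by (intro mult_left_mono) auto
  finally show ?thesis
    by (simp add: r(5) pairing_add pairing_diff pairing_sum_list mg[OF r(2)])
qed

lemma red_steps_pairing:
  assumes "red_step\<^sup>*\<^sup>* P Q" "good_poly n m P"
    and "\<And>L Rs G. graph_rule L Rs \<Longrightarrow> good_graph n m (L + G) \<Longrightarrow> w (L + G) \<le> (\<Sum>R\<leftarrow>Rs. w (R + G))"
  shows "good_poly n m Q \<and> pairing (\<lambda>M. w (mono_graph M)) P \<le> pairing (\<lambda>M. w (mono_graph M)) Q"
  using assms(1)
proof (induction rule: rtranclp_induct)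
  case base
  then show ?case using assms(2) by simp
next
  case (step y z)
  then show ?case
    using red_step_good_poly[of y z n m] red_step_pairing[of y z n m w, OF _ _ assms(3)] by force
qed

definition closed_points :: "nat \<Rightarrow> nat \<Rightarrow> sgraph \<Rightarrow> (nat \<Rightarrow> real) set" where
  "closed_points n r G = {p \<in> ncone (set_mset G). l1_norm n p = real (2 * r)}"

definition open_points :: "nat \<Rightarrow> nat \<Rightarrow> sgraph \<Rightarrow> (nat \<Rightarrow> real) set" where
  "open_points n r G = {p \<in> nint (set_mset G). l1_norm n p = real (2 * r)}"

lemma open_subset_closed: "open_points n r G \<subseteq> closed_points n r G"
  using nint_subset_ncone by (auto simp: open_points_def closed_points_def)

lemma finite_closed_points: "graph_on n G \<Longrightarrow> finite (closed_points n r G)"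
  unfolding closed_points_def by (rule finite_ncone_le) (auto simp: graph_on_def)

lemma finite_open_points: "graph_on n G \<Longrightarrow> finite (open_points n r G)"
  by (rule finite_subset[OF open_subset_closed finite_closed_points])

lemma card_UN_list_le: "card (\<Union>x\<in>set xs. f x) \<le> (\<Sum>x\<leftarrow>xs. card (f x))"
proof (induction xs)
  case (Cons x xs)
  have "card (f x \<union> (\<Union>x\<in>set xs. f x)) \<le> card (f x) + card (\<Union>x\<in>set xs. f x)" by (rule card_Un_le)
  then show ?case using Cons by simp
qed auto

lemma card_UN_list_disjoint:
  assumes "sorted_wrt (\<lambda>x y. f x \<inter> f y = {}) xs" "\<And>x. x \<in> set xs \<Longrightarrow> finite (f x)"
  shows "card (\<Union>x\<in>set xs. f x) = (\<Sum>x\<leftarrow>xs. card (f x))"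
  using assms
proof (induction xs)
  case (Cons x xs)
  have "card (f x \<union> (\<Union>x\<in>set xs. f x)) = card (f x) + card (\<Union>x\<in>set xs. f x)"
    by (rule card_Un_disjoint) (use Cons.prems in auto)
  then show ?case using Cons by simp
qed auto

lemma card_closed_points_rule:
  assumes "graph_rule L Rs" "good_graph n m (L + G)"
  shows "card (closed_points n r (L + G)) \<le> (\<Sum>R\<leftarrow>Rs. card (closed_points n r (R + G)))"
proof -
  have "closed_points n r (L + G) \<subseteq> (\<Union>R\<in>set Rs. closed_points n r (R + G))"
    using graph_rule_ncone[OF assms(1), of G] by (auto simp: closed_points_def)
  moreover have "finite (\<Union>R\<in>set Rs. closed_points n r (R + G))"
    using graph_rule_good[OF assms] by (intro finite_UN_I finite_set finite_closed_points) (auto simp: good_graph_def)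
  ultimately have "card (closed_points n r (L + G)) \<le> card (\<Union>R\<in>set Rs. closed_points n r (R + G))"
    by (intro card_mono)
  also have "\<dots> \<le> (\<Sum>R\<leftarrow>Rs. card (closed_points n r (R + G)))"
    by (rule card_UN_list_le)
  finally show ?thesis .
qed

text \<open>The outcomes are disjoint here but miss points on common faces, so the inequality is
  opposite to the one for closed points, where the outcomes cover everything but may
  overlap.\<close>

lemma card_open_points_rule:
  assumes "graph_rule L Rs" "good_graph n m (L + G)"
  shows "(\<Sum>R\<leftarrow>Rs. card (open_points n r (R + G))) \<le> card (open_points n r (L + G))"
proof -
  note * = graph_rule_nint[OF assms(1), of G]
  have ind: "indep edge_vec (L + G)" using assms(2) by (simp add: good_graph_def)
  have "sorted_wrt (\<lambda>R R'. open_points n r (R + G) \<inter> open_points n r (R' + G) = {}) Rs"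
    by (rule sorted_wrt_mono_rel[OF _ conjunct2[OF *[OF ind]]]) (auto simp: open_points_def)
  then have "(\<Sum>R\<leftarrow>Rs. card (open_points n r (R + G))) = card (\<Union>R\<in>set Rs. open_points n r (R + G))"
    using graph_rule_good[OF assms]
    by (intro card_UN_list_disjoint[symmetric] finite_open_points) (auto simp: good_graph_def)
  also have "\<dots> \<le> card (open_points n r (L + G))"
    using *[OF ind] assms(2) by (intro card_mono finite_open_points) (auto simp: open_points_def good_graph_def)
  finally show ?thesis .
qed

text \<open>The graphs occurring in \<open>P\<close> are alternating with \<open>m\<close> edges, so
  their counts coincide and factor out of the sum, leaving the coefficient sum \<open>N\<close>.
  Replacing the open points of \<open>T\<close> by its closed points in the lower bound makes both
  bounds speak of one function of the level.\<close>

lemma reduced_form_bounds: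
  assumes "good_graph n m T" "reduced_form_of (graph_monomial T) P"
  defines "N \<equiv> eval_cpoly (\<lambda>_. 1) P"
  shows "N \<ge> 0"
    and "N * of_nat ((m + r - 1) choose r) \<le> of_nat (card (closed_points n (m + r) T))"
    and "of_nat (card (closed_points n r T)) \<le> N * of_nat ((m + r - 1) choose r)"
proof -
  have P0: "graph_monomial T = Poly_Mapping.single (graph_mono T) 1" by (rule graph_monomial_eq)
  have mgT: "mono_graph (graph_mono T) = T"
    using assms(1) mono_graph_mono_on by (auto simp: good_graph_def)
  have good0: "good_poly n m (graph_monomial T)"
    using assms(1) by (auto simp: P0 good_poly_def)
  have steps: "red_step\<^sup>*\<^sup>* (graph_monomial T) P" and irr: "\<And>Q. \<not> red_step P Q"
    using assms(2) by (auto simp: reduced_form_of_def)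
  have closed: "good_poly n m P \<and> pairing (\<lambda>M. of_nat (card (closed_points n r (mono_graph M)))) (graph_monomial T) \<le>
      pairing (\<lambda>M. of_nat (card (closed_points n r (mono_graph M)))) P" for r
  proof (rule red_steps_pairing[OF steps good0])
    fix L Rs G assume "graph_rule L Rs" "good_graph n m (L + G)"
    from card_closed_points_rule[OF this, of r]
    have "(of_nat (card (closed_points n r (L + G))) :: rat) \<le> of_nat (\<Sum>R\<leftarrow>Rs. card (closed_points n r (R + G)))"
      by (simp only: of_nat_le_iff)
    also have "\<dots> = (\<Sum>R\<leftarrow>Rs. of_nat (card (closed_points n r (R + G))))"
      by (induction Rs) auto
    finally show "(of_nat (card (closed_points n r (L + G))) :: rat) \<le> (\<Sum>R\<leftarrow>Rs. of_nat (card (closed_points n r (R + G))))" .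
  qed
  have open': "pairing (\<lambda>M. - of_nat (card (open_points n r (mono_graph M)))) (graph_monomial T) \<le>
      pairing (\<lambda>M. - of_nat (card (open_points n r (mono_graph M)))) P" for r
  proof (rule conjunct2[OF red_steps_pairing[OF steps good0]])
    fix L Rs G assume "graph_rule L Rs" "good_graph n m (L + G)"
    from card_open_points_rule[OF this, of r]
    have "(of_nat (\<Sum>R\<leftarrow>Rs. card (open_points n r (R + G))) :: rat) \<le> of_nat (card (open_points n r (L + G)))"
      by (simp only: of_nat_le_iff)
    moreover have "(\<Sum>R\<leftarrow>Rs. - of_nat (card (open_points n r (R + G)))) =
       - (of_nat (\<Sum>R\<leftarrow>Rs. card (open_points n r (R + G))) :: rat)"
      by (induction Rs) auto
    ultimately show "- (of_nat (card (open_points n r (L + G))) :: rat) \<le> (\<Sum>R\<leftarrow>Rs. - of_nat (card (open_points n r (R + G))))"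
      by simp
  qed
  have good: "good_poly n m P" using closed by blast
  have key: "\<exists>G. M = graph_mono G \<and> mono_graph M = G \<and> good_graph n m G \<and> alternating G"
    if M: "M \<in> Poly_Mapping.keys P" for M
  proof -
    obtain G where G: "M = graph_mono G" "good_graph n m G" using good M by (auto simp: good_poly_def)
    have "\<not> L \<subseteq># G" if "graph_rule L Rs" for L Rs
    proof
      assume "L \<subseteq># G"
      then have "graph_mono L \<subseteq># M" by (simp add: G graph_mono_def image_mset_subseteq_mono)
      moreover obtain R where "red_rule (graph_mono L) R" using graph_rule_red[OF \<open>graph_rule L Rs\<close>] by blast
      ultimately show False using irr M unfolding red_step_def by blast
    qed
    then have "alternating G" using good_graph_irreducible_alternating[OF G(2)] by blast
    then show ?thesis using G mono_graph_mono_on by (auto simp: good_graph_def)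
  qed
  have N: "N = (\<Sum>M\<in>Poly_Mapping.keys P. Poly_Mapping.lookup P M)"
    by (simp add: N_def eval_cpoly_one pairing_def)
  show "N \<ge> 0"
    unfolding N using good by (intro sum_nonneg) (auto simp: good_poly_def intro: less_imp_le)
  have "pairing (\<lambda>M. of_nat (card (closed_points n r (mono_graph M)))) P = N * of_nat ((m + r - 1) choose r)"
    unfolding N pairing_def sum_distrib_right
  proof (rule sum.cong[OF refl])
    fix M assume "M \<in> Poly_Mapping.keys P"
    then obtain G where "mono_graph M = G" "good_graph n m G" "alternating G" using key by blast
    then show "Poly_Mapping.lookup P M * of_nat (card (closed_points n r (mono_graph M))) =
       Poly_Mapping.lookup P M * of_nat (m + r - 1 choose r)"
      using card_ncone_alternating[of G n r] by (simp add: closed_points_def good_graph_def)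
  qed
  then show "of_nat (card (closed_points n r T)) \<le> N * of_nat ((m + r - 1) choose r)"
    using closed[of r] by (simp add: P0 mgT)
  have "pairing (\<lambda>M. - of_nat (card (open_points n (m + r) (mono_graph M)))) P = - (N * of_nat ((m + r - 1) choose r))"
    unfolding N pairing_def sum_distrib_right sum_negf[symmetric]
  proof (rule sum.cong[OF refl])
    fix M assume "M \<in> Poly_Mapping.keys P"
    then obtain G where "mono_graph M = G" "good_graph n m G" "alternating G" using key by blast
    then show "Poly_Mapping.lookup P M * - of_nat (card (open_points n (m + r) (mono_graph M))) =
       - (Poly_Mapping.lookup P M * of_nat (m + r - 1 choose r))"
      using card_nint_alternating[of G n r] by (simp add: open_points_def good_graph_def)
  qed
  then have "N * of_nat ((m + r - 1) choose r) \<le> of_nat (card (open_points n (m + r) T))"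
    using open'[of "m + r"] by (simp add: P0 mgT)
  also have "\<dots> \<le> of_nat (card (closed_points n (m + r) T))"
    using assms(1) open_subset_closed by (simp add: card_mono finite_closed_points good_graph_def)
  finally show "N * of_nat ((m + r - 1) choose r) \<le> of_nat (card (closed_points n (m + r) T))" .
qed

section \<open>Polynomial against exponential growth\<close>

lemma binomial_power_bound: "(s + r - 1) choose r \<le> (r + 1) ^ s"
proof -
  \<comment> \<open>The induction step rests on \<open>Suc s + r \<le> Suc s * (r + 1)\<close>. For
    fixed \<open>s\<close> the bound is polynomial in \<open>r\<close>.\<close>
  have "(s + r) choose s \<le> (r + 1) ^ s"
  proof (induction s)
    case (Suc s)
    have "Suc s * ((Suc s + r) choose Suc s) = (Suc s + r) * ((s + r) choose s)"
      using Suc_times_binomial_eq[of "s + r" s] by (simp add: mult.commute)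
    also have "\<dots> \<le> (Suc s * (r + 1)) * (r + 1) ^ s"
      using Suc by (intro mult_mono) auto
    finally have "Suc s * ((Suc s + r) choose Suc s) \<le> Suc s * (r + 1) ^ Suc s"
      by (simp only: power_Suc mult.assoc)
    then show ?case by (metis Suc_mult_le_cancel1)
  qed simp
  moreover have "(s + r - 1) choose r \<le> (s + r) choose r"
    by (rule binomial_right_mono) simp
  moreover have "(s + r) choose r = (s + r) choose s"
    using binomial_symmetric[of s "s + r"] by simp
  ultimately show ?thesis by simp
qed

text \<open>Taking \<open>m\<close>-th roots leaves a linear function of \<open>k\<close> to be
  compared with the powers of a number above 1.\<close>

lemma exponential_beats_polynomial:
  fixes q :: real
  assumes "1 < q"
  shows "\<exists>k. real (k * m + 1) ^ m < q ^ k"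
proof (cases "m = 0")
  case True
  then show ?thesis using assms by (intro exI[of _ 1]) simp
next
  case False
  define y where "y = root m q"
  have y: "1 < y" "y ^ m = q" using assms False by (auto simp: y_def)
  have lim: "(\<lambda>k. real m * (real k * (1 / y) ^ k) + (1 / y) ^ k) \<longlonglongrightarrow> real m * 0 + 0"
    by (intro tendsto_intros powser_times_n_limit_0 LIMSEQ_realpow_zero) (use y in auto)
  have "eventually (\<lambda>k. real m * (real k * (1 / y) ^ k) + (1 / y) ^ k < 1) sequentially"
    using order_tendstoD(2)[OF lim, of 1] by simp
  then obtain k where "real m * (real k * (1 / y) ^ k) + (1 / y) ^ k < 1"
    by (auto simp: eventually_sequentially)
  then have "real (k * m + 1) * (1 / y) ^ k < 1" by (simp add: algebra_simps)
  then have "real (k * m + 1) < y ^ k" using y by (simp add: field_simps power_divide)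
  then have "real (k * m + 1) ^ m < (y ^ k) ^ m" using False by (intro power_strict_mono) auto
  then show ?thesis using y by (metis power_mult mult.commute)
qed

text \<open>Shifting \<open>r\<close> by \<open>m\<close> changes the binomial coefficient only by lower-order terms; iterating the
  hypothesis would otherwise force exponential growth.\<close>

lemma growth_compare:
  fixes a b :: rat
  assumes "\<And>r. a * of_nat ((m + r - 1) choose r) \<le> b * of_nat ((m + (m + r) - 1) choose (m + r))"
    and "0 \<le> a" "0 \<le> b"
  shows "a \<le> b"
proof (rule ccontr)
  assume ab: "\<not> a \<le> b"
  have iter: "a ^ k \<le> b ^ k * of_nat ((m + k * m - 1) choose (k * m))" for k
  proof (induction k)
    case (Suc k)
    have "a ^ Suc k \<le> a * (b ^ k * of_nat ((m + k * m - 1) choose (k * m)))"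
      using Suc assms(2) by (auto intro: mult_left_mono)
    also have "\<dots> = b ^ k * (a * of_nat ((m + k * m - 1) choose (k * m)))" by simp
    also have "\<dots> \<le> b ^ k * (b * of_nat ((m + (m + k * m) - 1) choose (m + k * m)))"
      using assms by (intro mult_left_mono) auto
    finally show ?case by (simp add: algebra_simps)
  qed simp
  have b: "b > 0" using iter[of 1] ab assms(3) by (cases "b = 0") auto
  define q where "q = real_of_rat (a / b)"
  have "1 < q" using ab b by (simp add: q_def)
  then obtain k where k: "real (k * m + 1) ^ m < q ^ k" using exponential_beats_polynomial by blast
  have "of_nat ((m + k * m - 1) choose (k * m)) \<le> (of_nat ((k * m + 1) ^ m) :: rat)"
    using binomial_power_bound[of m "k * m"] by (simp only: of_nat_le_iff)
  then have "b ^ k * of_nat ((m + k * m - 1) choose (k * m)) \<le> b ^ k * of_nat ((k * m + 1) ^ m)"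
    using b by (intro mult_left_mono) auto
  with iter[of k] have "a ^ k \<le> b ^ k * of_nat ((k * m + 1) ^ m)" by linarith
  then have "(a / b) ^ k \<le> of_nat ((k * m + 1) ^ m)"
    using b by (simp add: power_divide field_simps)
  then have "real_of_rat ((a / b) ^ k) \<le> real_of_rat (of_nat ((k * m + 1) ^ m))"
    by (simp only: of_rat_less_eq)
  then have "q ^ k \<le> real ((k * m + 1) ^ m)"
    by (simp only: q_def of_rat_power of_rat_of_nat_eq)
  then show False using k by simp
qed


section \<open>Acyclic graphs and independence\<close>

lemma distinct_mset_subseteq:
  assumes "distinct xs" "set xs \<subseteq> set_mset T"
  shows "mset xs \<subseteq># T"
proof (rule mset_subset_eqI)
  fix a
  show "count (mset xs) a \<le> count T a"
  proof (cases "a \<in> set xs")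
    case True
    then have "a \<in># T" using assms(2) by auto
    then have "1 \<le> count T a" by simp
    moreover have "count (mset xs) a = 1" using assms(1) True by (simp add: distinct_count_atmost_1)
    ultimately show ?thesis by simp
  qed (simp add: count_eq_zero_iff[THEN iffD2])
qed

lemma endpoints_other: "v \<in> endpoints e \<Longrightarrow> \<not> is_loop e \<Longrightarrow> \<exists>w. endpoints e = {v, w} \<and> w \<noteq> v"
  by (cases e) auto

lemma finite_endpoints: "finite (endpoints e)"
  by (cases e) auto

text \<open>All vertices of \<open>F\<close> except possibly \<open>x\<close> have degree at least
  two. A longest path cannot be extended at its first vertex, so a second edge there leads back to
  the path and closes a cycle. The exception \<open>x\<close> is meant for the vertex that carries
  the loop.\<close>

lemma exists_nonloop_cycle:
  assumes F: "F \<subseteq> set_mset T" "F \<noteq> {}" "\<And>e. e \<in> F \<Longrightarrow> \<not> is_loop e"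
    and deg: "\<And>v e. e \<in> F \<Longrightarrow> v \<in> endpoints e \<Longrightarrow> v \<noteq> x \<Longrightarrow> \<exists>e'\<in>F. e' \<noteq> e \<and> v \<in> endpoints e'"
  shows "\<exists>vs es. nonloop_cycle T vs es"
proof -
  define V where "V = (\<Union>e\<in>F. endpoints e)"
  have finV: "finite V" unfolding V_def using F(1) finite_subset by (auto intro!: finite_endpoints)
  obtain e0 s where e0: "e0 \<in> F" "s \<in> endpoints e0" "x \<in> V \<Longrightarrow> s = x"
  proof (cases "x \<in> V")
    case True then show ?thesis using that by (auto simp: V_def)
  next
    case False
    obtain e where "e \<in> F" using F(2) by auto
    moreover have "endpoints e \<noteq> {}" by (cases e) auto
    ultimately show ?thesis using that False by blast
  qed
  \<comment> \<open>Paths ending in \<open>s\<close>, which is the exceptional vertex \<open>x\<close> if possible, so that the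
      first vertex of a path is never exceptional.\<close>
  define path where "path = (\<lambda>(vs, es). distinct vs \<and> length vs = Suc (length es) \<and> set es \<subseteq> F \<and>
     set vs \<subseteq> V \<and> 2 \<le> length vs \<and> last vs = s \<and> (\<forall>k<length es. endpoints (es ! k) = {vs ! k, vs ! Suc k}))"
  obtain w0 where w0: "endpoints e0 = {s, w0}" "w0 \<noteq> s"
    using endpoints_other[OF e0(2) F(3)[OF e0(1)]] by blast
  have start: "path ([w0, s], [e0])"
    using e0(1) w0 by (auto simp: path_def V_def insert_commute)
  have bound: "length (fst p) < Suc (card V)" if "path p" for p
  proof -
    have "distinct (fst p)" "set (fst p) \<subseteq> V" using that by (auto simp: path_def)
    then show ?thesis using card_mono[OF finV, of "set (fst p)"] by (simp add: distinct_card)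
  qed
  \<comment> \<open>The vertices of a path are distinct elements of \<open>V\<close>, which bounds
    its length.\<close>
  obtain p where "path p" and max: "\<And>q. path q \<Longrightarrow> length (fst q) \<le> length (fst p)"
    using ex_has_greatest_nat[of path "([w0, s], [e0])" "length \<circ> fst" "Suc (card V)"] start bound
    unfolding comp_def by blast
  obtain vs es where p: "p = (vs, es)" by (cases p)
  have P: "distinct vs" "length vs = Suc (length es)" "set es \<subseteq> F" "set vs \<subseteq> V" "2 \<le> length vs" "last vs = s"
    "\<And>k. k < length es \<Longrightarrow> endpoints (es ! k) = {vs ! k, vs ! Suc k}"
    using \<open>path p\<close> by (auto simp: path_def p)
  have es0: "es ! 0 \<in> F" "endpoints (es ! 0) = {vs ! 0, vs ! Suc 0}"
  proof -
    have "0 < length es" using P(2,5) by linarith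
    then show "es ! 0 \<in> F" "endpoints (es ! 0) = {vs ! 0, vs ! Suc 0}"
      using P(3) P(7)[of 0] nth_mem[of 0 es] by blast+
  qed
  have "vs ! 0 \<noteq> s"
  proof
    assume "vs ! 0 = s"
    then have "vs ! 0 = vs ! (length vs - 1)" using P(5,6) by (metis last_conv_nth list.size(3) not_numeral_le_zero)
    moreover have "0 < length vs" "length vs - 1 < length vs" using P(5) by auto
    ultimately show False using P(1,5) nth_eq_iff_index_eq[of vs 0 "length vs - 1"] by simp
  qed
  moreover have v0V: "vs ! 0 \<in> V" using P(2,4) nth_mem[of 0 vs] by auto
  ultimately have "vs ! 0 \<noteq> x" using e0(3) by auto
  then obtain e' where e': "e' \<in> F" "e' \<noteq> es ! 0" "vs ! 0 \<in> endpoints e'"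
    using deg[OF es0(1), of "vs ! 0"] es0(2) by auto
  obtain w where w: "endpoints e' = {vs ! 0, w}" "w \<noteq> vs ! 0"
    using endpoints_other[OF e'(3) F(3)[OF e'(1)]] by blast
  have "w \<in> set vs"
  proof (rule ccontr)
    assume "w \<notin> set vs"
    have "path (w # vs, e' # es)"
      unfolding path_def prod.case
    proof (intro conjI allI impI)
      show "set (w # vs) \<subseteq> V" using P(4) e'(1) w by (auto simp: V_def)
      show "last (w # vs) = s" using P(5,6) by auto
      fix k assume "k < length (e' # es)"
      then show "endpoints ((e' # es) ! k) = {(w # vs) ! k, (w # vs) ! Suc k}"
        using P(7) w(1) by (cases k) auto
    qed (use P e' \<open>w \<notin> set vs\<close> in auto)
    then show False using max[of "(w # vs, e' # es)"] by (simp add: p)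
  qed
  then obtain j where j: "j < length vs" "w = vs ! j" by (metis in_set_conv_nth)
  have j0: "j > 0" using j w(2) by (cases j) auto
  have distes: "distinct es"
    unfolding distinct_conv_nth
  proof (intro allI impI notI)
    fix a b assume ab: "a < length es" "b < length es" "a \<noteq> b" "es ! a = es ! b"
    have "{vs ! a, vs ! Suc a} = {vs ! b, vs ! Suc b}" using P(7) ab by metis
    then show False using P(1,2) ab by (auto simp: doubleton_eq_iff nth_eq_iff_index_eq)
  qed
  have notin: "e' \<notin> set (take j es)"
  proof
    assume "e' \<in> set (take j es)"
    then obtain k where k: "k < length es" "e' = es ! k" by (auto simp: in_set_conv_nth)
    then have "vs ! 0 = vs ! k \<or> vs ! 0 = vs ! Suc k" using P(7) e'(3) by auto
    then have "k = 0" using P(1,2,5) k(1) by (auto simp: nth_eq_iff_index_eq)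
    then show False using k e'(2) by simp
  qed
  have len: "length (take j es) = j" using j P(2) by simp
  \<comment> \<open>The cycle runs along the path up to \<open>w = vs ! j\<close> and returns by
    \<open>e'\<close>. The case \<open>j = 1\<close> is that of two parallel edges.\<close>
  have "nonloop_cycle T (take (Suc j) vs) (take j es @ [e'])"
    unfolding nonloop_cycle_def
  proof (intro conjI allI impI)
    show "2 \<le> length (take (Suc j) vs)" using j j0 by simp
    show "length (take j es @ [e']) = length (take (Suc j) vs)" using j len by simp
    show "distinct (take (Suc j) vs)" using P(1) by simp
    show "mset (take j es @ [e']) \<subseteq># T"
      by (rule distinct_mset_subseteq)
        (use distes notin P(3) e'(1) F(1) in \<open>auto dest: in_set_takeD\<close>)
    fix k assume "k < length (take (Suc j) vs)"
    then have k: "k \<le> j" using j by simp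
    show "endpoints ((take j es @ [e']) ! k) =
       {take (Suc j) vs ! k, take (Suc j) vs ! (Suc k mod length (take (Suc j) vs))}"
    proof (cases "k = j")
      case True
      then show ?thesis using j w len by (simp add: nth_append insert_commute)
    next
      case False
      then have "k < j" using k by simp
      then show ?thesis using j P(2) P(7)[of k] len by (simp add: nth_append)
    qed
  qed
  then show ?thesis by blast
qed

lemma well_structured_loop:
  assumes "well_structured n T"
  obtains l where "(l, l, Pos) \<in># T" "\<And>e. e \<in># T \<Longrightarrow> is_loop e \<Longrightarrow> e = (l, l, Pos)"
proof -
  have "size (filter_mset is_loop T) = 1" and on: "graph_on n T"
    using assms by (auto simp: well_structured_def)
  then obtain e where e: "filter_mset is_loop T = {#e#}" by (metis size_1_singleton_mset)
  then have "e \<in># T" "is_loop e" by (metis filter_mset_eq_conv multi_member_last union_single_eq_member mset_subset_eqD multiset_filter_subset, metis filter_mset_eq_conv multi_member_last)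
  then obtain l where l: "e = (l, l, Pos)" using on by (cases e) (auto simp: graph_on_def)
  have "e' = (l, l, Pos)" if "e' \<in># T" "is_loop e'" for e'
  proof -
    have "e' \<in># filter_mset is_loop T" using that by simp
    then show ?thesis unfolding e l by simp
  qed
  then show ?thesis using that \<open>e \<in># T\<close> l by blast
qed

text \<open>Only the supports of the vectors matter, so one argument serves \<open>edge_vec\<close>
  and \<open>unsigned_vec\<close>. In a dependence no vertex meets exactly one edge with nonzero
  coefficient. Away from the loop vertex \<open>l\<close>, the nonloop edges with nonzero
  coefficient therefore have degree zero or at least two, which produces a cycle unless there are
  none. Then the loop is alone at \<open>l\<close>.\<close>

lemma well_structured_indep:
  assumes ws: "well_structured n T"
    and f: "\<And>e k. e \<in># T \<Longrightarrow> f e k = 0 \<longleftrightarrow> k \<notin> endpoints e"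
  shows "indep f T"
  unfolding indep_def
proof (intro conjI allI impI)
  show "count T e \<le> 1" for e by (rule well_structured_count_le_1[OF ws])
next
  fix c assume c: "\<forall>k. (\<Sum>e\<in>#T. c e * f e k) = 0"
  obtain l where l: "(l, l, Pos) \<in># T" "\<And>e. e \<in># T \<Longrightarrow> is_loop e \<Longrightarrow> e = (l, l, Pos)"
    using well_structured_loop[OF ws] by blast
  have acyclic: "\<not> (\<exists>vs es. nonloop_cycle T vs es)" using ws by (simp add: well_structured_def)
  define F where "F = {e \<in> set_mset T. \<not> is_loop e \<and> c e \<noteq> 0}"
  have single: "c e = 0" if e: "e \<in># T" "v \<in> endpoints e"
    and oth: "\<And>e'. e' \<in># T \<Longrightarrow> e' \<noteq> e \<Longrightarrow> v \<in> endpoints e' \<Longrightarrow> c e' = 0" for e v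
  proof -
    obtain T0 where T0: "T = add_mset e T0" using e(1) by (metis mset_add)
    have "e \<notin># T0" using well_structured_count_le_1[OF ws, of e] by (auto simp: T0 not_in_iff)
    have "c e' * f e' v = 0" if "e' \<in># T0" for e'
      using oth[of e'] f[of e' v] that \<open>e \<notin># T0\<close> by (auto simp: T0)
    then have "(\<Sum>e\<in>#T0. c e * f e v) = (\<Sum>e\<in>#T0. 0)"
      by (intro arg_cong[where f = sum_mset] image_mset_cong) simp
    then have "c e * f e v = 0" using c[rule_format, of v] by (simp add: T0)
    then show "c e = 0" using f[OF e(1), of v] e(2) by simp
  qed
  have "F = {}"
  proof (rule ccontr)
    assume "F \<noteq> {}"
    have "\<exists>vs es. nonloop_cycle T vs es"
    proof (rule exists_nonloop_cycle[where F = F and x = l])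
      fix v e assume e: "e \<in> F" "v \<in> endpoints e" "v \<noteq> l"
      show "\<exists>e'\<in>F. e' \<noteq> e \<and> v \<in> endpoints e'"
      proof (rule ccontr)
        assume no: "\<not> ?thesis"
        have "c e = 0"
        proof (rule single)
          fix e' assume e': "e' \<in># T" "e' \<noteq> e" "v \<in> endpoints e'"
          have "\<not> is_loop e'" using l(2)[OF e'(1)] e'(3) e(3) by auto
          then show "c e' = 0" using no e' unfolding F_def by blast
        qed (use e in \<open>auto simp: F_def\<close>)
        then show False using e by (simp add: F_def)
      qed
    qed (use \<open>F \<noteq> {}\<close> in \<open>auto simp: F_def\<close>)
    then show False using acyclic by blast
  qed
  then have nonloop: "c e = 0" if "e \<in># T" "\<not> is_loop e" for e
    using that unfolding F_def by blast
  have "c (l, l, Pos) = 0"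
  proof (rule single[OF l(1), of l])
    fix e' assume "e' \<in># T" "e' \<noteq> (l, l, Pos)"
    then show "c e' = 0" using nonloop[of e'] l(2)[of e'] by blast
  qed simp
  then show "\<forall>e\<in>#T. c e = 0" using nonloop l(2) by metis
qed

lemma well_structured_good_graph:
  assumes "well_structured n T"
  shows "good_graph n (size T) T"
proof -
  have on: "edge_on n e" if "e \<in># T" for e
    using assms that by (auto simp: well_structured_def graph_on_def)
  have "indep edge_vec T"
  proof (rule well_structured_indep[OF assms])
    fix e k assume "e \<in># T"
    from on[OF this] show "edge_vec e k = 0 \<longleftrightarrow> k \<notin> endpoints e"
      by (cases e; cases "snd (snd e)") (auto simp: unit_vec_def)
  qed
  moreover have "indep unsigned_vec T"
  proof (rule well_structured_indep[OF assms])
    fix e k assume "e \<in># T"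
    from on[OF this] show "unsigned_vec e k = 0 \<longleftrightarrow> k \<notin> endpoints e"
      by (cases e; cases "snd (snd e)") (auto simp: unit_vec_def)
  qed
  ultimately show ?thesis
    using assms by (simp add: good_graph_def well_structured_def)
qed

text \<open>The vectors along a cycle, signed by the direction of travel, telescope to zero. This
  recovers the acyclicity in condition (vi) after a rule has been applied.\<close>

lemma indep_unsigned_acyclic:
  assumes ind: "indep unsigned_vec G" and on: "graph_on n G"
  shows "\<not> nonloop_cycle G vs es"
proof
  assume cyc: "nonloop_cycle G vs es"
  define m where "m = length vs"
  define nx where "nx = (\<lambda>k. Suc k mod m)"
  have C: "2 \<le> m" "length es = m" "distinct vs" "mset es \<subseteq># G"
    "\<And>k. k < m \<Longrightarrow> endpoints (es ! k) = {vs ! k, vs ! nx k}"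
    using cyc by (auto simp: nonloop_cycle_def m_def nx_def)
  have cnt: "count G e \<le> 1" for e using ind by (rule indep_count)
  have "count (mset es) e \<le> 1" for e
    using C(4) cnt[of e] by (meson le_trans mset_subset_eq_count)
  then have dist: "distinct es"
    by (metis One_nat_def count_mset_0_iff distinct_count_atmost_1 le_Suc_eq le_zero_eq)
  have inG: "es ! k \<in># G" if "k < m" for k
    using C(2,4) that by (metis mset_subset_eqD nth_mem set_mset_mset)
  have ne: "vs ! k \<noteq> vs ! nx k" if "k < m" for k
  proof -
    have "nx k < length vs" "k < length vs" "nx k \<noteq> k"
      using C(1) that by (auto simp: nx_def m_def mod_Suc)
    then show ?thesis using C(3) by (simp add: nth_eq_iff_index_eq)
  qed
  define \<sigma> where "\<sigma> k = (if vs ! k < vs ! nx k then 1 else - 1 :: real)" for k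
  have \<sigma>: "\<sigma> k * unsigned_vec (es ! k) x = unit_vec (vs ! k) x - unit_vec (vs ! nx k) x" if "k < m" for k x
  proof -
    obtain i j s where e: "es ! k = (i, j, s)" by (cases "es ! k")
    have "i \<le> j" using inG[OF that] on by (auto simp: e graph_on_def)
    moreover have "{i, j} = {vs ! k, vs ! nx k}" using C(5)[OF that] e by simp
    ultimately show ?thesis using ne[OF that] by (auto simp: e \<sigma>_def doubleton_eq_iff)
  qed
  \<comment> \<open>The edges of the cycle are distinct, so at most one term of this sum is
    nonzero.\<close>
  define c where "c e = (\<Sum>k<m. if es ! k = e then \<sigma> k else 0)" for e
  have swap: "(\<Sum>e\<in>#H. \<Sum>k<m. g e k) = (\<Sum>k<m. \<Sum>e\<in>#H. g e k)" for H and g :: "edge \<Rightarrow> nat \<Rightarrow> real"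
    by (induction H) (auto simp: sum.distrib)
  have "(\<Sum>e\<in>#G. c e * unsigned_vec e x) = 0" for x
  proof -
    have "(\<Sum>e\<in>#G. c e * unsigned_vec e x) =
       (\<Sum>e\<in>#G. \<Sum>k<m. if e = es ! k then \<sigma> k * unsigned_vec (es ! k) x else 0)"
      unfolding c_def sum_distrib_right
      by (intro arg_cong[where f = sum_mset] image_mset_cong sum.cong) auto
    also have "\<dots> = (\<Sum>k<m. \<Sum>e\<in>#G. if e = es ! k then \<sigma> k * unsigned_vec (es ! k) x else 0)"
      by (rule swap)
    also have "\<dots> = (\<Sum>k<m. unit_vec (vs ! k) x - unit_vec (vs ! nx k) x)"
    proof (rule sum.cong[OF refl])
      fix k assume "k \<in> {..<m}"
      then have k: "k < m" by simp
      have "1 \<le> count G (es ! k)" using inG[OF k] by simp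
      then have "count G (es ! k) = 1" using cnt[of "es ! k"] by linarith
      then show "(\<Sum>e\<in>#G. if e = es ! k then \<sigma> k * unsigned_vec (es ! k) x else 0) =
        unit_vec (vs ! k) x - unit_vec (vs ! nx k) x"
        using \<sigma>[OF k] by (simp add: sum_mset_delta)
    qed
    also have "\<dots> = 0"
    proof -
      obtain m' where m': "m = Suc m'" using C(1) by (cases m) auto
      have "(\<Sum>k<m. unit_vec (vs ! nx k) x) = (\<Sum>k<m'. unit_vec (vs ! nx k) x) + unit_vec (vs ! 0) x"
        by (simp add: m' nx_def)
      also have "(\<Sum>k<m'. unit_vec (vs ! nx k) x) = (\<Sum>k<m'. unit_vec (vs ! Suc k) x)"
        by (rule sum.cong) (auto simp: nx_def m')
      also have "\<dots> + unit_vec (vs ! 0) x = (\<Sum>k<m. unit_vec (vs ! k) x)"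
        unfolding m' by (subst sum.lessThan_Suc_shift) simp
      finally show ?thesis by (simp add: sum_subtractf)
    qed
    finally show ?thesis .
  qed
  from indepD[OF ind this inG[of 0]] have "c (es ! 0) = 0" using C(1) by simp
  moreover have "c (es ! 0) = (\<Sum>k<m. if k = 0 then \<sigma> k else 0)"
    unfolding c_def using dist C(1,2) by (intro sum.cong) (auto simp: nth_eq_iff_index_eq)
  then have "c (es ! 0) = \<sigma> 0" using C(1) by simp
  ultimately show False by (simp add: \<sigma>_def split: if_splits)
qed


section \<open>The lattice spanned by a well-structured graph\<close>

definition zspan :: "sgraph \<Rightarrow> (nat \<Rightarrow> real) set" where
  "zspan G = {p. \<exists>z :: edge \<Rightarrow> int. \<forall>k. p k = (\<Sum>e\<in>#G. of_int (z e) * edge_vec e k)}"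

lemma zspan_combine:
  assumes "p \<in> zspan G" "q \<in> zspan G" "\<And>k. r k = of_int a * p k + of_int b * q k"
  shows "r \<in> zspan G"
proof -
  obtain z w where z: "\<And>k. p k = (\<Sum>e\<in>#G. of_int (z e) * edge_vec e k)"
    and w: "\<And>k. q k = (\<Sum>e\<in>#G. of_int (w e) * edge_vec e k)"
    using assms(1,2) by (auto simp: zspan_def)
  have "r k = (\<Sum>e\<in>#G. of_int (a * z e + b * w e) * edge_vec e k)" for k
    unfolding assms(3) z w by (induction G) (auto simp: algebra_simps)
  then show ?thesis unfolding zspan_def by (intro CollectI exI allI)
qed

lemma zspan_edge:
  assumes "e \<in># G" "count G e \<le> 1"
  shows "edge_vec e \<in> zspan G"
proof -
  have "1 \<le> count G e" using assms(1) by simp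
  then have cnt: "count G e = 1" using assms(2) by linarith
  have "edge_vec e k = (\<Sum>e'\<in>#G. of_int (if e' = e then 1 else 0) * edge_vec e' k)" for k
  proof -
    have "(\<Sum>e'\<in>#G. of_int (if e' = e then 1 else 0) * edge_vec e' k) =
       (\<Sum>e'\<in>#G. if e' = e then edge_vec e k else 0)"
      by (intro arg_cong[where f = sum_mset] image_mset_cong) auto
    then show ?thesis by (simp add: sum_mset_delta cnt)
  qed
  then show ?thesis unfolding zspan_def by (intro CollectI exI allI)
qed

text \<open>Following a path gives the sum or the difference of the unit vectors of any two
  vertices, but leaves no choice of sign. The loop supplies twice the unit vector of
  \<open>l\<close>, hence twice that of every vertex, and adding or subtracting such a vector
  switches the sign.\<close>

lemma well_structured_zspan:
  assumes ws: "well_structured n G" and e: "edge_on n e"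
  shows "edge_vec e \<in> zspan G"
proof -
  define adj where "adj = {(a, b). \<exists>e\<in>#G. endpoints e = {a, b}}"
  have conn: "(u, v) \<in> adj\<^sup>*" if "u \<in> {1..n}" "v \<in> {1..n}" for u v
    using ws that by (auto simp: well_structured_def connected_on_def adj_def)
  have on: "edge_on n e" if "e \<in># G" for e
    using ws that by (auto simp: well_structured_def graph_on_def)
  have inz: "edge_vec e \<in> zspan G" if "e \<in># G" for e
    using that well_structured_count_le_1[OF ws] by (rule zspan_edge)
  obtain l where l: "(l, l, Pos) \<in># G" using well_structured_loop[OF ws] by blast
  have l2: "(\<lambda>k. 2 * unit_vec l k) \<in> zspan G"
    by (rule zspan_combine[OF inz[OF l] inz[OF l], of _ 1 0]) simp
  define pm where "pm u v \<longleftrightarrow> (\<lambda>k. unit_vec u k + unit_vec v k) \<in> zspan G \<or>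
     (\<lambda>k. unit_vec u k - unit_vec v k) \<in> zspan G" for u v
  have edge: "pm v w" if vw: "(v, w) \<in> adj" for v w
  proof -
    obtain i j s where ijs: "(i, j, s) \<in># G" "{i, j} = {v, w}"
      using vw by (auto simp: adj_def)
    from inz[OF ijs(1)] show ?thesis
    proof (cases s)
      case Pos
      have "(\<lambda>k. unit_vec v k + unit_vec w k) \<in> zspan G"
        by (rule zspan_combine[OF inz[OF ijs(1)] inz[OF ijs(1)], of _ 1 0])
          (use Pos ijs(2) in \<open>auto simp: doubleton_eq_iff\<close>)
      then show ?thesis by (simp add: pm_def)
    next
      case Neg
      have "(\<lambda>k. unit_vec v k - unit_vec w k) \<in> zspan G"
        by (rule zspan_combine[OF inz[OF ijs(1)] inz[OF ijs(1)], of _ "if v = i then 1 else -1" 0])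
          (use Neg ijs(2) in \<open>auto simp: doubleton_eq_iff\<close>)
      then show ?thesis by (simp add: pm_def)
    qed
  qed
  have path: "pm u v" if "(u, v) \<in> adj\<^sup>*" for u v
    using that
  proof (induction rule: rtrancl_induct)
    case base
    show ?case unfolding pm_def
      by (rule disjI2, rule zspan_combine[OF l2 l2, of _ 0 0]) simp
  next
    case (step v w)
    consider (pp) "(\<lambda>k. unit_vec u k + unit_vec v k) \<in> zspan G" "(\<lambda>k. unit_vec v k + unit_vec w k) \<in> zspan G"
      | (pn) "(\<lambda>k. unit_vec u k + unit_vec v k) \<in> zspan G" "(\<lambda>k. unit_vec v k - unit_vec w k) \<in> zspan G"
      | (np) "(\<lambda>k. unit_vec u k - unit_vec v k) \<in> zspan G" "(\<lambda>k. unit_vec v k + unit_vec w k) \<in> zspan G"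
      | (nn) "(\<lambda>k. unit_vec u k - unit_vec v k) \<in> zspan G" "(\<lambda>k. unit_vec v k - unit_vec w k) \<in> zspan G"
      using step.IH edge[OF step.hyps(2)] unfolding pm_def by blast
    then show ?case unfolding pm_def
    proof cases
      case pp
      show "(\<lambda>k. unit_vec u k + unit_vec w k) \<in> zspan G \<or> (\<lambda>k. unit_vec u k - unit_vec w k) \<in> zspan G"
        by (rule disjI2, rule zspan_combine[OF pp, of _ 1 "-1"]) simp
    next
      case pn
      show "(\<lambda>k. unit_vec u k + unit_vec w k) \<in> zspan G \<or> (\<lambda>k. unit_vec u k - unit_vec w k) \<in> zspan G"
        by (rule disjI1, rule zspan_combine[OF pn, of _ 1 "-1"]) simp
    next
      case np
      show "(\<lambda>k. unit_vec u k + unit_vec w k) \<in> zspan G \<or> (\<lambda>k. unit_vec u k - unit_vec w k) \<in> zspan G"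
        by (rule disjI1, rule zspan_combine[OF np, of _ 1 1]) simp
    next
      case nn
      show "(\<lambda>k. unit_vec u k + unit_vec w k) \<in> zspan G \<or> (\<lambda>k. unit_vec u k - unit_vec w k) \<in> zspan G"
        by (rule disjI2, rule zspan_combine[OF nn, of _ 1 1]) simp
    qed
  qed
  have two: "(\<lambda>k. 2 * unit_vec v k) \<in> zspan G" if "v \<in> {1..n}" for v
  proof -
    have "l \<in> {1..n}" using on[OF l] by simp
    then have "pm l v" using path conn that by blast
    then show ?thesis unfolding pm_def
    proof
      assume a: "(\<lambda>k. unit_vec l k + unit_vec v k) \<in> zspan G"
      show ?thesis by (rule zspan_combine[OF a l2, of _ 2 "-1"]) simp
    next
      assume a: "(\<lambda>k. unit_vec l k - unit_vec v k) \<in> zspan G"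
      show ?thesis by (rule zspan_combine[OF a l2, of _ "-2" 1]) simp
    qed
  qed
  obtain i j s where ijs: "e = (i, j, s)" by (cases e)
  have ij: "i \<in> {1..n}" "j \<in> {1..n}" using e ijs by auto
  have "pm i j" using path conn ij by blast
  then show ?thesis unfolding pm_def
  proof
    assume a: "(\<lambda>k. unit_vec i k + unit_vec j k) \<in> zspan G"
    show ?thesis
      by (rule zspan_combine[OF a two[OF ij(2)], of _ 1 "if s = Pos then 0 else -1"]) (cases s; simp add: ijs)
  next
    assume a: "(\<lambda>k. unit_vec i k - unit_vec j k) \<in> zspan G"
    show ?thesis
      by (rule zspan_combine[OF a two[OF ij(2)], of _ 1 "if s = Pos then 1 else 0"]) (cases s; simp add: ijs)
  qed
qed

lemma sum_set_mset_eq: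
  fixes g :: "edge \<Rightarrow> real"
  assumes "\<And>e. count G e \<le> 1"
  shows "(\<Sum>e\<in>set_mset G. g e) = (\<Sum>e\<in>#G. g e)"
proof -
  have "mset_set (set_mset G) = G"
  proof (rule multiset_eqI)
    fix e
    show "count (mset_set (set_mset G)) e = count G e"
    proof (cases "e \<in># G")
      case True
      then have "1 \<le> count G e" by simp
      then have "count G e = 1" using assms[of e] by linarith
      then show ?thesis using True by simp
    qed (simp add: not_in_iff)
  qed
  then show ?thesis by (simp add: sum_unfold_sum_mset)
qed

lemma ncone_subset_edge_cone:
  assumes "p \<in> ncone (set_mset G)"
  shows "p \<in> edge_cone G"
proof -
  obtain E where E: "set_mset E \<subseteq> set_mset G" "p = vsum E" using assms by (auto simp: ncone_def)
  let ?H = "mset_set (set_mset G)"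
  have H: "count ?H e \<le> 1" for e by (cases "e \<in># G") auto
  have "p k = (\<Sum>e\<in>set_mset G. real (count E e) * edge_vec e k)" for k
  proof -
    have "p k = (\<Sum>e\<in>#?H. real (count E e) * edge_vec e k)"
      unfolding E(2) vsum_def by (rule sum_mset_conv_count[OF _ H]) (use E in auto)
    then show ?thesis by (simp add: sum_unfold_sum_mset)
  qed
  then show ?thesis unfolding edge_cone_def by (intro CollectI exI[of _ "\<lambda>e. real (count E e)"]) auto
qed

text \<open>By independence the real coefficients from \<open>edge_cone\<close> agree with the
  integer coefficients from \<open>zspan\<close>, so they are nonnegative integers.\<close>

lemma edge_cone_root_in_ncone:
  assumes ws: "well_structured n G" and e: "edge_on n e" "edge_vec e \<in> edge_cone G"
  shows "edge_vec e \<in> ncone (set_mset G)"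
proof -
  have cnt: "\<And>e. count G e \<le> 1" using ws by (rule well_structured_count_le_1)
  have ind: "indep edge_vec G" using well_structured_good_graph[OF ws] by (simp add: good_graph_def)
  obtain c where c: "edge_vec e = (\<lambda>k. \<Sum>e\<in>set_mset G. c e * edge_vec e k)" "\<forall>e\<in>set_mset G. 0 \<le> c e"
    using e(2) by (auto simp: edge_cone_def)
  have c1: "edge_vec e k = (\<Sum>e\<in>#G. c e * edge_vec e k)" for k
    by (subst c(1)) (rule sum_set_mset_eq[OF cnt])
  obtain z :: "edge \<Rightarrow> int" where z: "\<And>k. edge_vec e k = (\<Sum>e\<in>#G. of_int (z e) * edge_vec e k)"
    using well_structured_zspan[OF ws e(1)] by (auto simp: zspan_def)
  have cz: "c e' = of_int (z e')" if "e' \<in># G" for e'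
  proof -
    have "(\<Sum>e\<in>#G. (c e - of_int (z e)) * edge_vec e k) =
        (\<Sum>e\<in>#G. c e * edge_vec e k) - (\<Sum>e\<in>#G. of_int (z e) * edge_vec e k)" for k
      by (induction G) (auto simp: algebra_simps)
    then have "(\<Sum>e\<in>#G. (c e - of_int (z e)) * edge_vec e k) = 0" for k
      using c1[of k] z[of k] by simp
    from indepD[OF ind this that] show ?thesis by simp
  qed
  define E where "E = (\<Sum>e'\<in>#G. replicate_mset (nat (z e')) e')"
  have "vsum E k = edge_vec e k" for k
  proof -
    have "vsum (\<Sum>e'\<in>#H. replicate_mset (nat (z e')) e') k = (\<Sum>e'\<in>#H. real (nat (z e')) * edge_vec e' k)" for H
      by (induction H) (auto simp: vsum_add vsum_replicate)
    then have "vsum E k = (\<Sum>e'\<in>#G. real (nat (z e')) * edge_vec e' k)" by (simp add: E_def)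
    also have "\<dots> = (\<Sum>e'\<in>#G. of_int (z e') * edge_vec e' k)"
    proof (rule sum_mset_coeff_cong)
      fix e' assume "e' \<in># G"
      then show "real (nat (z e')) = of_int (z e')" using cz[of e'] c(2) by auto
    qed
    finally show ?thesis using z by simp
  qed
  then have "edge_vec e = vsum E" by auto
  moreover have "set_mset (\<Sum>e'\<in>#H. replicate_mset (nat (z e')) e') \<subseteq> set_mset H" for H
    by (induction H) (auto split: if_splits)
  ultimately show ?thesis by (auto simp: ncone_def E_def)
qed

lemma trans_closure_eq:
  assumes "well_structured n G"
  shows "trans_closure n G = {e. edge_on n e \<and> edge_vec e \<in> ncone (set_mset G)}"
  using edge_cone_root_in_ncone[OF assms] ncone_subset_edge_cone by (auto simp: trans_closure_def)

text \<open>\<open>G\<close> already spans every edge vector, so one more edge would create a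
  dependence.\<close>

lemma well_structured_maximal_indep:
  assumes ws: "well_structured n G" and H: "indep edge_vec H" "graph_on n H"
    and sub: "set_mset G \<subseteq> set_mset H"
  shows "set_mset G = set_mset H"
proof (rule ccontr)
  assume "set_mset G \<noteq> set_mset H"
  then obtain e where e: "e \<in># H" "e \<notin># G" using sub by auto
  have "edge_on n e" using e H(2) by (auto simp: graph_on_def)
  then obtain z :: "edge \<Rightarrow> int" where z: "\<And>k. edge_vec e k = (\<Sum>e\<in>#G. of_int (z e) * edge_vec e k)"
    using well_structured_zspan[OF ws, of e] unfolding zspan_def by blast
  define c where "c e' = (if e' = e then -1 else if e' \<in># G then of_int (z e') else 0 :: real)" for e'
  have "(\<Sum>e'\<in>#H. c e' * edge_vec e' k) = 0" for k
  proof -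
    have "(\<Sum>e'\<in>#H. c e' * edge_vec e' k) = (\<Sum>e'\<in>set_mset H. c e' * edge_vec e' k)"
      by (rule sum_set_mset_eq[symmetric]) (rule indep_count[OF H(1)])
    also have "\<dots> = (\<Sum>e'\<in>insert e (set_mset G). c e' * edge_vec e' k)"
      by (rule sum.mono_neutral_right) (use sub e in \<open>auto simp: c_def\<close>)
    also have "\<dots> = - edge_vec e k + (\<Sum>e'\<in>set_mset G. c e' * edge_vec e' k)"
      using e(2) by (simp add: c_def)
    also have "(\<Sum>e'\<in>set_mset G. c e' * edge_vec e' k) = (\<Sum>e'\<in>set_mset G. of_int (z e') * edge_vec e' k)"
      by (rule sum.cong) (use e(2) in \<open>auto simp: c_def\<close>)
    also have "\<dots> = (\<Sum>e'\<in>#G. of_int (z e') * edge_vec e' k)"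
      by (rule sum_set_mset_eq) (rule well_structured_count_le_1[OF ws])
    finally show ?thesis using z[of k] by simp
  qed
  from indepD[OF H(1) this e(1)] show False by (simp add: c_def)
qed


section \<open>Compatible edges\<close>

text \<open>Conditions (i)--(v) on a pair of edges; condition (ii) uses both orders of the pair.\<close>

fun compat :: "edge \<Rightarrow> edge \<Rightarrow> bool" where
  "compat (i, j, s) (k, l, t) \<longleftrightarrow>
     \<not> (i < k \<and> k < j \<and> j < l) \<and>
     (s = Pos \<and> t = Pos \<and> i < j \<and> k < l \<longrightarrow> i < l) \<and>
     (s = Pos \<and> t = Pos \<and> i = j \<and> k < l \<longrightarrow> k \<le> i \<and> i \<le> l) \<and>
     (s = Pos \<and> t = Neg \<and> i = j \<longrightarrow> \<not> (k < i \<and> i < l)) \<and>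
     (s = Pos \<and> t = Neg \<and> i < j \<longrightarrow> \<not> (k \<le> i \<and> j \<le> l))"

definition compatible :: "edge set \<Rightarrow> bool" where
  "compatible A \<longleftrightarrow> (\<forall>e\<in>A. \<forall>f\<in>A. compat e f)"

lemma compatible_subset: "compatible A \<Longrightarrow> B \<subseteq> A \<Longrightarrow> compatible B"
  unfolding compatible_def by blast

lemma compatibleD: "compatible A \<Longrightarrow> e \<in> A \<Longrightarrow> f \<in> A \<Longrightarrow> compat e f"
  unfolding compatible_def by blast

text \<open>As a statement about pairs of edges, the conditions pass to subsets and can be checked
  for one inserted edge at a time.\<close>

lemma compat_conditions:
  "(noncrossing H \<and>
     (\<forall>i j k l. (i, j, Pos) \<in># H \<longrightarrow> (k, l, Pos) \<in># H \<longrightarrow> i < j \<longrightarrow> k < l \<longrightarrow> i < l \<and> k < j) \<and>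
     (\<forall>i k l. (i, i, Pos) \<in># H \<longrightarrow> (k, l, Pos) \<in># H \<longrightarrow> k < l \<longrightarrow> k \<le> i \<and> i \<le> l) \<and>
     \<not> (\<exists>i j k. (i, i, Pos) \<in># H \<and> (k, j, Neg) \<in># H \<and> k < i \<and> i < j) \<and>
     \<not> (\<exists>i j k l. (i, j, Pos) \<in># H \<and> (k, l, Neg) \<in># H \<and> k \<le> i \<and> i < j \<and> j \<le> l)) \<longleftrightarrow>
   compatible (set_mset H)" (is "?L \<longleftrightarrow> ?R")
proof
  assume L: ?L
  show ?R unfolding compatible_def
  proof (intro ballI)
    fix e f assume ef: "e \<in># H" "f \<in># H"
    obtain i j s where e: "e = (i, j, s)" by (cases e)
    obtain k l t where f: "f = (k, l, t)" by (cases f)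
    show "compat e f" unfolding e f compat.simps
    proof (intro conjI impI)
      show "\<not> (i < k \<and> k < j \<and> j < l)" using L ef unfolding e f noncrossing_def by blast
      show "i < l" if "s = Pos \<and> t = Pos \<and> i < j \<and> k < l" using L ef that unfolding e f by blast
      show "k \<le> i" "i \<le> l" if "s = Pos \<and> t = Pos \<and> i = j \<and> k < l" using L ef that unfolding e f by blast+
      show "\<not> (k < i \<and> i < l)" if "s = Pos \<and> t = Neg \<and> i = j" using L ef that unfolding e f by blast
      show "\<not> (k \<le> i \<and> j \<le> l)" if "s = Pos \<and> t = Neg \<and> i < j" using L ef that unfolding e f by blast
    qed
  qed
next
  assume R: ?R
  show ?L
  proof (intro conjI)
    show "noncrossing H" unfolding noncrossing_def
    proof (intro notI, elim exE conjE)
      fix i j k l s t assume "i < j" "j < k" "k < l" "(i, k, s) \<in># H" "(j, l, t) \<in># H"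
      then show False using compatibleD[OF R, of "(i, k, s)" "(j, l, t)"] by simp
    qed
    show "\<forall>i j k l. (i, j, Pos) \<in># H \<longrightarrow> (k, l, Pos) \<in># H \<longrightarrow> i < j \<longrightarrow> k < l \<longrightarrow> i < l \<and> k < j"
    proof (intro allI impI)
      fix i j k l assume "(i, j, Pos) \<in># H" "(k, l, Pos) \<in># H" "i < j" "k < l"
      then show "i < l \<and> k < j"
        using compatibleD[OF R, of "(i, j, Pos)" "(k, l, Pos)"] compatibleD[OF R, of "(k, l, Pos)" "(i, j, Pos)"]
        by simp
    qed
    show "\<forall>i k l. (i, i, Pos) \<in># H \<longrightarrow> (k, l, Pos) \<in># H \<longrightarrow> k < l \<longrightarrow> k \<le> i \<and> i \<le> l"
    proof (intro allI impI)
      fix i k l assume "(i, i, Pos) \<in># H" "(k, l, Pos) \<in># H" "k < l"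
      then show "k \<le> i \<and> i \<le> l" using compatibleD[OF R, of "(i, i, Pos)" "(k, l, Pos)"] by simp
    qed
    show "\<not> (\<exists>i j k. (i, i, Pos) \<in># H \<and> (k, j, Neg) \<in># H \<and> k < i \<and> i < j)"
    proof (intro notI, elim exE conjE)
      fix i j k assume "(i, i, Pos) \<in># H" "(k, j, Neg) \<in># H" "k < i" "i < j"
      then show False using compatibleD[OF R, of "(i, i, Pos)" "(k, j, Neg)"] by simp
    qed
    show "\<not> (\<exists>i j k l. (i, j, Pos) \<in># H \<and> (k, l, Neg) \<in># H \<and> k \<le> i \<and> i < j \<and> j \<le> l)"
    proof (intro notI, elim exE conjE)
      fix i j k l assume "(i, j, Pos) \<in># H" "(k, l, Neg) \<in># H" "k \<le> i" "i < j" "j \<le> l"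
      then show False using compatibleD[OF R, of "(i, j, Pos)" "(k, l, Neg)"] by simp
    qed
  qed
qed

lemma well_structured_iff:
  "well_structured n H \<longleftrightarrow> graph_on n H \<and> compatible (set_mset H) \<and> connected_on n H \<and>
     size (filter_mset is_loop H) = 1 \<and> \<not> (\<exists>vs es. nonloop_cycle H vs es)"
  unfolding well_structured_def compat_conditions[symmetric] by blast


section \<open>Alternating well-structured graphs with a common interior point\<close>

text \<open>What an alternating well-structured graph passes on to every multiset of its edges.
  Connectedness is dropped and multiplicities are allowed, so that edges can be removed one by one
  from a decomposition of a lattice point.\<close>

definition layered :: "nat \<Rightarrow> edge multiset \<Rightarrow> bool" where
  "layered n E \<longleftrightarrow> graph_on n E \<and> alternating E \<and> compatible (set_mset E) \<and>
     (\<forall>i j. (i, i, Pos) \<in># E \<longrightarrow> (j, j, Pos) \<in># E \<longrightarrow> i = j)"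

lemma layered_subset: "layered n E \<Longrightarrow> set_mset E' \<subseteq> set_mset E \<Longrightarrow> layered n E'"
  unfolding layered_def graph_on_def
  by (meson alternating_subset compatible_subset subsetD)

lemma well_structured_layered:
  assumes "well_structured n G" "alternating G" "set_mset E \<subseteq> set_mset G"
  shows "layered n E"
proof (rule layered_subset[OF _ assms(3)])
  obtain l where "(l, l, Pos) \<in># G" "\<And>e. e \<in># G \<Longrightarrow> is_loop e \<Longrightarrow> e = (l, l, Pos)"
    using well_structured_loop[OF assms(1)] by blast
  then have "i = j" if "(i, i, Pos) \<in># G" "(j, j, Pos) \<in># G" for i j
    using that by (metis is_loop.simps prod.inject)
  then show "layered n G"
    using assms(1,2) by (auto simp: layered_def well_structured_iff)
qed

text \<open>Nothing cancels at a vertex, so the signs of the incident edges can be read off the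
  point itself. This is what two decompositions of one point have in common.\<close>

lemma vsum_pos_iff:
  assumes "alternating E" "graph_on n E"
  shows "0 < vsum E k \<longleftrightarrow> (\<exists>e\<in>#E. (k, Pos) \<in> incidences e)"
proof -
  have on: "edge_on n e" if "e \<in># E" for e using assms(2) that by (simp add: graph_on_def)
  have *: "0 < vsum E k \<longleftrightarrow> (\<exists>e\<in>#E. 0 < edge_vec e k)" if "\<forall>e\<in>#E. 0 \<le> edge_vec e k"
  proof -
    have "0 \<le> vsum E k \<and> (0 < vsum E k \<longleftrightarrow> (\<exists>e\<in>#E. 0 < edge_vec e k))"
      using that
    proof (induction E)
      case (add e E)
      then show ?case by (simp add: vsum_add_mset) (smt (verit))
    qed simp
    then show ?thesis by simp
  qed
  have **: "vsum E k \<le> 0" if "\<forall>e\<in>#E. edge_vec e k \<le> 0"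
    using that by (induction E) (auto simp: vsum_add_mset add_nonpos_nonpos)
  have "0 < vsum E k \<longleftrightarrow> (\<exists>e\<in>#E. 0 < edge_vec e k)"
    using alternating_sign[OF assms, of k] * ** by (meson not_le)
  then show ?thesis using on edge_vec_pos_iff by blast
qed

lemma vsum_neg_iff:
  assumes "alternating E" "graph_on n E"
  shows "vsum E k < 0 \<longleftrightarrow> (\<exists>e\<in>#E. (k, Neg) \<in> incidences e)"
proof -
  have on: "edge_on n e" if "e \<in># E" for e using assms(2) that by (simp add: graph_on_def)
  have *: "vsum E k < 0 \<longleftrightarrow> (\<exists>e\<in>#E. edge_vec e k < 0)" if "\<forall>e\<in>#E. edge_vec e k \<le> 0"
  proof -
    have "vsum E k \<le> 0 \<and> (vsum E k < 0 \<longleftrightarrow> (\<exists>e\<in>#E. edge_vec e k < 0))"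
      using that
    proof (induction E)
      case (add e E)
      then show ?case by (simp add: vsum_add_mset) (smt (verit))
    qed simp
    then show ?thesis by simp
  qed
  have **: "0 \<le> vsum E k" if "\<forall>e\<in>#E. 0 \<le> edge_vec e k"
    using that by (induction E) (auto simp: vsum_add_mset)
  have "vsum E k < 0 \<longleftrightarrow> (\<exists>e\<in>#E. edge_vec e k < 0)"
    using alternating_sign[OF assms, of k] * ** by (meson not_le)
  then show ?thesis using on edge_vec_neg_iff by blast
qed

lemma neg_incidence: "edge_on n e \<Longrightarrow> (k, Neg) \<in> incidences e \<Longrightarrow> \<exists>i<k. e = (i, k, Neg)"
  by (cases e; cases "snd (snd e)") auto

lemma pos_incidence:
  assumes "edge_on n e" "(k, Pos) \<in> incidences e"
  shows "(\<exists>j>k. e = (k, j, Neg)) \<or> (\<exists>j>k. e = (k, j, Pos)) \<or> (\<exists>j<k. e = (j, k, Pos)) \<or> e = (k, k, Pos)"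
  using assms by (cases e; cases "snd (snd e)") force+

text \<open>The leftmost negative vertex must be joined to the nearest positive vertex on its left; once
  no negative vertices remain, the two outermost positive vertices must be joined.\<close>

lemma forced_negative_edge:
  assumes E: "layered n E"
    and j: "vsum E j < 0" "\<And>j'. j' < j \<Longrightarrow> 0 \<le> vsum E j'"
    and i: "i < j" "0 < vsum E i" "\<And>i'. i < i' \<Longrightarrow> i' < j \<Longrightarrow> vsum E i' \<le> 0"
  shows "(i, j, Neg) \<in># E"
proof -
  have alt: "alternating E" and on: "graph_on n E" and comp: "compatible (set_mset E)"
    using E by (auto simp: layered_def)
  have one: "edge_on n e" if "e \<in># E" for e using on that by (simp add: graph_on_def)
  obtain k where k: "(k, j, Neg) \<in># E" "k < j"
    using j(1) vsum_neg_iff[OF alt on, of j] neg_incidence one by metis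
  have "0 < vsum E k" using vsum_pos_iff[OF alt on, of k] k(1) by force
  then have "k \<le> i" using i(3)[of k] k(2) by force
  show ?thesis
  proof (cases "k = i")
    case True
    then show ?thesis using k by simp
  next
    case False
    \<comment> \<open>Now \<open>i\<close> lies strictly below \<open>(k, j, Neg)\<close>.
      Noncrossing with (iv) and (v) excludes positive edges and loops at \<open>i\<close>. A
      negative edge starting there cannot end before \<open>j\<close>, the leftmost negative vertex,
      nor beyond it, as it would cross.\<close>
    then have "k < i" using \<open>k \<le> i\<close> by simp
    obtain e where e: "e \<in># E" "(i, Pos) \<in> incidences e"
      using i(2) vsum_pos_iff[OF alt on, of i] by blast
    have c: "compat e (k, j, Neg)" "compat (k, j, Neg) e"
      using compatibleD[OF comp] e(1) k(1) by auto
    from pos_incidence[OF one[OF e(1)] e(2)] show ?thesis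
    proof (elim disjE exE conjE)
      fix l assume l: "i < l" "e = (i, l, Neg)"
      have "vsum E l < 0" using vsum_neg_iff[OF alt on, of l] e(1) l by force
      then have "j \<le> l" using j(2)[of l] by force
      moreover have "\<not> j < l" using c \<open>k < i\<close> i(1) l by auto
      ultimately show ?thesis using e l by (cases "l = j") auto
    qed (use c \<open>k < i\<close> i(1) in auto)
  qed
qed

text \<open>All edges are positive here. If the edges found at \<open>i\<close> and \<open>l\<close>
  did not join these vertices, they would be \<open>(i, j, Pos)\<close> and
  \<open>(k, l, Pos)\<close> with \<open>i < k\<close> and \<open>j < l\<close>. Two nonloops then
  cross or violate (ii), a loop and a nonloop violate (iii), and two loops at different vertices are
  excluded by \<open>layered\<close>.\<close>

lemma forced_positive_edge:
  assumes E: "layered n E"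
    and nn: "\<And>k. 0 \<le> vsum E k"
    and i: "0 < vsum E i" "\<And>k. 0 < vsum E k \<Longrightarrow> i \<le> k"
    and l: "0 < vsum E l" "\<And>k. 0 < vsum E k \<Longrightarrow> k \<le> l"
  shows "(i, l, Pos) \<in># E"
proof -
  have alt: "alternating E" and on: "graph_on n E" and comp: "compatible (set_mset E)"
    and loop: "\<And>i j. (i, i, Pos) \<in># E \<Longrightarrow> (j, j, Pos) \<in># E \<Longrightarrow> i = j"
    using E by (auto simp: layered_def)
  have one: "edge_on n e" if "e \<in># E" for e using on that by (simp add: graph_on_def)
  have noneg: "(k, j, Neg) \<notin># E" for k j
    using vsum_neg_iff[OF alt on, of j] nn[of j] by force
  have bd: "i \<le> a \<and> b \<le> l" if "(a, b, Pos) \<in># E" for a b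
    using vsum_pos_iff[OF alt on, of a] vsum_pos_iff[OF alt on, of b] i(2) l(2) that by force
  obtain e where e: "e \<in># E" "(i, Pos) \<in> incidences e"
    using i(1) vsum_pos_iff[OF alt on, of i] by blast
  obtain f where f: "f \<in># E" "(l, Pos) \<in> incidences f"
    using l(1) vsum_pos_iff[OF alt on, of l] by blast
  obtain j where j: "e = (i, j, Pos)" "i \<le> j"
    using pos_incidence[OF one[OF e(1)] e(2)] noneg bd e(1) by force
  obtain k where k: "f = (k, l, Pos)" "k \<le> l"
    using pos_incidence[OF one[OF f(1)] f(2)] noneg bd f(1) by force
  have c: "compat e f" "compat f e" using compatibleD[OF comp] e f by auto
  have "i \<le> k" "j \<le> l" using bd e f j k by auto
  show ?thesis
  proof (cases "j = l \<or> k = i")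
    case True
    then show ?thesis using e f j k by auto
  next
    case False
    then have "i < k" "j < l" using \<open>i \<le> k\<close> \<open>j \<le> l\<close> by auto
    then show ?thesis using c j k loop e(1) f(1) by (cases "i = j"; cases "k = l") auto
  qed
qed

text \<open>The forced edge depends on the point alone, so both multisets contain it, and removing
  it leaves a smaller instance. Independence could only compare combinations within one graph; here
  they may come from two different graphs.\<close>

lemma layered_vsum_inj:
  assumes "layered n E" "layered n E'" "vsum E = vsum E'"
  shows "E = E'"
  using assms
proof (induction "size E" arbitrary: E E')
  case 0
  have "2 * real (size E') = l1_norm n (vsum E')"
    using 0(3) l1_norm_vsum_alternating[of E' n] by (simp add: layered_def)
  also have "\<dots> = l1_norm n (vsum E)" by (simp only: 0(4))
  also have "\<dots> = 2 * real (size E)"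
    using 0(2) l1_norm_vsum_alternating[of E n] by (simp add: layered_def)
  finally have "size E' = size E" by simp
  then show ?case using 0(1) by simp
next
  case (Suc m)
  have alt: "alternating E" and on: "graph_on n E" using Suc.prems by (auto simp: layered_def)
  have alt': "alternating E'" and on': "graph_on n E'" using Suc.prems by (auto simp: layered_def)
  have one: "edge_on n e" if "e \<in># E" for e using on that by (simp add: graph_on_def)
  have "\<exists>e. e \<in># E \<and> e \<in># E'"
  proof (cases "\<exists>j. vsum E j < 0")
    case True
    define j where "j = (LEAST j. vsum E j < 0)"
    have j: "vsum E j < 0" "\<And>j'. j' < j \<Longrightarrow> 0 \<le> vsum E j'"
      using True unfolding j_def by (auto intro: LeastI_ex dest: not_less_Least simp: not_less)
    \<comment> \<open>Its maximum is the nearest positive vertex to the left of \<open>j\<close>; it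
      is nonempty because a negative edge into \<open>j\<close> starts at a positive vertex.\<close>
    define I where "I = {i. i < j \<and> 0 < vsum E i}"
    obtain k where k: "(k, j, Neg) \<in># E" "k < j"
      using j(1) vsum_neg_iff[OF alt on, of j] neg_incidence one by metis
    have "k \<in> I" using vsum_pos_iff[OF alt on, of k] k by (force simp: I_def)
    moreover have finI: "finite I" by (simp add: I_def)
    ultimately have "Max I \<in> I" by (intro Max_in) auto
    then have i: "Max I < j" "0 < vsum E (Max I)" by (auto simp: I_def)
    have i': "vsum E i' \<le> 0" if "Max I < i'" "i' < j" for i'
    proof (rule ccontr)
      assume "\<not> vsum E i' \<le> 0"
      then have "i' \<in> I" using that by (simp add: I_def)
      then show False using Max_ge[OF finI, of i'] that by simp
    qed
    have "(Max I, j, Neg) \<in># E" by (rule forced_negative_edge[OF Suc.prems(1) j i i'])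
    moreover have "(Max I, j, Neg) \<in># E'"
      by (rule forced_negative_edge[OF Suc.prems(2)]) (use j i i' Suc.prems(3) in auto)
    ultimately show ?thesis by blast
  next
    case False
    then have nn: "\<And>k. 0 \<le> vsum E k" by (auto simp: not_less)
    define I where "I = {i. 0 < vsum E i}"
    obtain e where e: "e \<in># E" using Suc.hyps(2) by (metis size_eq_Suc_imp_elem)
    obtain a where "(a, Pos) \<in> incidences e" by (cases e; cases "snd (snd e)") auto
    then have "a \<in> I" using vsum_pos_iff[OF alt on, of a] e by (auto simp: I_def)
    have "I \<subseteq> (\<Union>e\<in>set_mset E. endpoints e)"
    proof
      fix k assume "k \<in> I"
      then obtain e where "e \<in># E" "(k, Pos) \<in> incidences e" using vsum_pos_iff[OF alt on, of k] by (auto simp: I_def)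
      then show "k \<in> (\<Union>e\<in>set_mset E. endpoints e)" by (cases e; cases "snd (snd e)") force+
    qed
    then have fin: "finite I" by (rule finite_subset) (auto intro: finite_endpoints)
    have mem: "Min I \<in> I" "Max I \<in> I" using fin \<open>a \<in> I\<close> by (auto intro: Min_in Max_in)
    have *: "0 < vsum E (Min I)" "0 < vsum E (Max I)"
      "\<And>k. 0 < vsum E k \<Longrightarrow> Min I \<le> k" "\<And>k. 0 < vsum E k \<Longrightarrow> k \<le> Max I"
      using mem fin by (auto simp: I_def)
    have "(Min I, Max I, Pos) \<in># E" by (rule forced_positive_edge[OF Suc.prems(1) nn]) (use * in auto)
    moreover have "(Min I, Max I, Pos) \<in># E'"
      by (rule forced_positive_edge[OF Suc.prems(2)]) (use * nn Suc.prems(3) in auto)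
    ultimately show ?thesis by blast
  qed
  then obtain e where e: "e \<in># E" "e \<in># E'" by blast
  obtain F F' where F: "E = add_mset e F" "E' = add_mset e F'" using e by (metis mset_add)
  have "F = F'"
  proof (rule Suc.hyps(1))
    show "m = size F" using Suc.hyps(2) F by simp
    show "layered n F" "layered n F'" using Suc.prems F by (auto intro: layered_subset)
    show "vsum F = vsum F'"
    proof
      fix k
      show "vsum F k = vsum F' k"
        using fun_cong[OF Suc.prems(3), of k] by (simp add: F vsum_add_mset)
    qed
  qed
  then show ?case using F by simp
qed


section \<open>Reductions that preserve well-structuredness\<close>

text \<open>Each outcome contains a walk of two edges through all vertices touched by the rule, so
  the replaced edges can be bypassed. For the loop rule consecutive vertices of the walk may
  coincide.\<close>

lemma graph_rule_path:
  assumes "graph_rule L Rs" "R \<in> set Rs"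
  shows "\<exists>p q r e f. e \<in># R \<and> f \<in># R \<and> endpoints e = {p, q} \<and> endpoints f = {q, r} \<and>
    (\<forall>g\<in>#L. endpoints g \<subseteq> {p, q, r})"
proof -
  have witness: "\<exists>p q r e f. e \<in># R \<and> f \<in># R \<and> endpoints e = {p, q} \<and> endpoints f = {q, r} \<and>
    (\<forall>g\<in>#L. endpoints g \<subseteq> {p, q, r})"
    if "e \<in># R" "f \<in># R" "endpoints e = {p, q}" "endpoints f = {q, r}"
      "\<And>g. g \<in># L \<Longrightarrow> endpoints g \<subseteq> {p, q, r}" for e R f p q r
    using that by blast
  show ?thesis using assms(1)
  proof cases
    case (NegNeg i j k)
    then consider "R = {#(i, k, Neg), (i, j, Neg)#}" | "R = {#(j, k, Neg), (i, k, Neg)#}" using assms(2) by auto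
    then show ?thesis
    proof cases
      case 1 show ?thesis by (rule witness[of "(i, k, Neg)" R "(i, j, Neg)" k i j]) (use 1 NegNeg in auto)
    next
      case 2 show ?thesis by (rule witness[of "(j, k, Neg)" R "(i, k, Neg)" j k i]) (use 2 NegNeg in auto)
    qed
    next
    case (NegPos i j k)
    then consider "R = {#(i, k, Pos), (i, j, Neg)#}" | "R = {#(j, k, Pos), (i, k, Pos)#}" using assms(2) by auto
    then show ?thesis
    proof cases
      case 1 show ?thesis by (rule witness[of "(i, k, Pos)" R "(i, j, Neg)" k i j]) (use 1 NegPos in auto)
    next
      case 2 show ?thesis by (rule witness[of "(j, k, Pos)" R "(i, k, Pos)" j k i]) (use 2 NegPos in auto)
    qed
    next
    case (OuterNeg i j k)
    then consider "R = {#(j, k, Pos), (i, j, Pos)#}" | "R = {#(i, j, Pos), (i, k, Neg)#}" using assms(2) by auto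
    then show ?thesis
    proof cases
      case 1 show ?thesis by (rule witness[of "(j, k, Pos)" R "(i, j, Pos)" k j i]) (use 1 OuterNeg in auto)
    next
      case 2 show ?thesis by (rule witness[of "(i, j, Pos)" R "(i, k, Neg)" j i k]) (use 2 OuterNeg in auto)
    qed
    next
    case (OuterPos i j k)
    then consider "R = {#(j, k, Neg), (i, j, Pos)#}" | "R = {#(i, j, Pos), (i, k, Pos)#}" using assms(2) by auto
    then show ?thesis
    proof cases
      case 1 show ?thesis by (rule witness[of "(j, k, Neg)" R "(i, j, Pos)" k j i]) (use 1 OuterPos in auto)
    next
      case 2 show ?thesis by (rule witness[of "(i, j, Pos)" R "(i, k, Pos)" j i k]) (use 2 OuterPos in auto)
    qed
    next
    case (Loop i j)
    then consider "R = {#(i, i, Pos), (i, j, Neg)#}" | "R = {#(i, j, Pos), (i, i, Pos)#}" | "R = {#(j, j, Pos), (i, j, Pos)#}" using assms(2) by auto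
    then show ?thesis
    proof cases
      case 1 show ?thesis by (rule witness[of "(i, i, Pos)" R "(i, j, Neg)" i i j]) (use 1 Loop in auto)
    next
      case 2 show ?thesis by (rule witness[of "(i, j, Pos)" R "(i, i, Pos)" j i i]) (use 2 Loop in auto)
    next
      case 3 show ?thesis by (rule witness[of "(j, j, Pos)" R "(i, j, Pos)" j j i]) (use 3 Loop in auto)
    qed
  qed
qed

definition adj :: "sgraph \<Rightarrow> (nat \<times> nat) set" where
  "adj H = {(a, b). \<exists>e\<in>#H. endpoints e = {a, b}}"

lemma adjI:
  assumes "e \<in># H" "endpoints e = {a, b}"
  shows "(a, b) \<in> adj H" "(b, a) \<in> adj H"
proof -
  show "(a, b) \<in> adj H" using assms unfolding adj_def by blast
  have "endpoints e = {b, a}" using assms(2) by (simp only: insert_commute)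
  then show "(b, a) \<in> adj H" using assms(1) unfolding adj_def by blast
qed

lemma adjE:
  assumes "(a, b) \<in> adj H"
  obtains e where "e \<in># H" "endpoints e = {a, b}"
  using assms unfolding adj_def by blast

lemma connected_on_adj: "connected_on n H \<longleftrightarrow> (\<forall>u\<in>{1..n}. \<forall>v\<in>{1..n}. (u, v) \<in> (adj H)\<^sup>*)"
  unfolding connected_on_def adj_def by (rule refl)

lemma graph_rule_connected:
  assumes "graph_rule L Rs" "R \<in> set Rs" "connected_on n (L + G)"
  shows "connected_on n (R + G)"
proof -
  let ?A = "adj (R + G)"
  obtain p q r e f where *: "e \<in># R" "f \<in># R" "endpoints e = {p, q}" "endpoints f = {q, r}"
    "\<forall>g\<in>#L. endpoints g \<subseteq> {p, q, r}"
    using graph_rule_path[OF assms(1,2)] by (elim exE conjE) (rule that)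
  have "e \<in># R + G" "f \<in># R + G" using *(1,2) by simp_all
  note edges = adjI[OF this(1) *(3), THEN r_into_rtrancl] adjI[OF this(2) *(4), THEN r_into_rtrancl]
  have pr: "(p, r) \<in> ?A\<^sup>*" "(r, p) \<in> ?A\<^sup>*"
    using rtrancl_trans[OF edges(1) edges(3)] rtrancl_trans[OF edges(4) edges(2)] .
  have "adj (L + G) \<subseteq> ?A\<^sup>*"
  proof (rule subrelI)
    fix a b assume "(a, b) \<in> adj (L + G)"
    then obtain e where e: "e \<in># L + G" "endpoints e = {a, b}" by (rule adjE)
    show "(a, b) \<in> ?A\<^sup>*"
    proof (cases "e \<in># G")
      case True
      then have "e \<in># R + G" by simp
      from adjI(1)[OF this e(2)] show ?thesis by (rule r_into_rtrancl)
    next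
      case False
      then have "e \<in># L" using e(1) by simp
      then have "endpoints e \<subseteq> {p, q, r}" using *(5) by (rule bspec[rotated])
      then have "a \<in> {p, q, r}" "b \<in> {p, q, r}" unfolding e(2) by blast+
      then show ?thesis using pr edges by blast
    qed
  qed
  then have "(adj (L + G))\<^sup>* \<subseteq> ?A\<^sup>*" by (rule rtrancl_subset_rtrancl)
  then show ?thesis using assms(3) unfolding connected_on_adj by blast
qed

text \<open>Only compatibility depends on which pair is reduced. Connectedness and the number of
  loops survive every rule, and so does acyclicity, by way of unsigned independence.\<close>

lemma graph_rule_well_structured:
  assumes ws: "well_structured n (L + G)" and r: "graph_rule L Rs" "R \<in> set Rs"
    and comp: "compatible (set_mset (R + G))"
  shows "well_structured n (R + G)"
proof -
  have good: "good_graph n (size (L + G)) (R + G)"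
    by (rule graph_rule_good[OF r(1) well_structured_good_graph[OF ws] r(2)])
  moreover have "connected_on n (R + G)"
    using graph_rule_connected[OF r] ws by (simp add: well_structured_iff)
  ultimately show ?thesis
    using comp indep_unsigned_acyclic unfolding well_structured_iff good_graph_def by blast
qed

text \<open>An edge with the endpoints of the inserted edge and the opposite sign would conflict
  with it by (v); acyclicity excludes such an edge beforehand.\<close>

lemma well_structured_no_triangle:
  assumes "well_structured n T" "(i, j, s) \<in># T" "(j, k, t) \<in># T" "(i, k, u) \<in># T" "i < j" "j < k"
  shows False
proof -
  have "nonloop_cycle T [i, j, k] [(i, j, s), (j, k, t), (i, k, u)]"
    unfolding nonloop_cycle_def
  proof (intro conjI allI impI)
    show "mset [(i, j, s), (j, k, t), (i, k, u)] \<subseteq># T"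
      by (rule distinct_mset_subseteq) (use assms in auto)
    fix m assume "m < length [i, j, k]"
    then consider "m = 0" | "m = 1" | "m = 2" by fastforce
    then show "endpoints ([(i, j, s), (j, k, t), (i, k, u)] ! m) = {[i, j, k] ! m, [i, j, k] ! (Suc m mod length [i, j, k])}"
      by cases auto
  qed (use assms in auto)
  then show False using assms(1) by (auto simp: well_structured_def)
qed

section \<open>Compatibility of the edge inserted by a rule\<close>

lemma compatible_insert:
  assumes "compatible A" "\<And>f. f \<in> A \<Longrightarrow> compat g f \<and> compat f g" "compat g g"
  shows "compatible (insert g A)"
  using assms unfolding compatible_def by blast

text \<open>An edge that crosses \<open>(i, k, Neg)\<close> crosses one of the two given edges
  unless it has \<open>j\<close> as an endpoint, and a positive nonloop nested in it conflicts with
  one of them unless it joins \<open>i\<close> and \<open>k\<close>. The hypotheses after the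
  compatibility assumptions deal with these exceptions. The lemmas for the other rules follow the
  same pattern.\<close>

lemma compat_NegNeg:
  assumes "i < j" "j < k" "a \<le> b" "a = b \<Longrightarrow> s = Pos"
    and "compat (i, j, Neg) (a, b, s)" "compat (a, b, s) (i, j, Neg)"
    and "compat (j, k, Neg) (a, b, s)" "compat (a, b, s) (j, k, Neg)"
    and "s = Neg \<Longrightarrow> b = j \<Longrightarrow> i \<le> a" "\<not> (s = Pos \<and> b = j)" "\<not> (s = Pos \<and> a = j)"
    and "s = Neg \<Longrightarrow> a = j \<Longrightarrow> b \<le> k" "\<not> (s = Pos \<and> a = i \<and> b = k)"
  shows "compat (i, k, Neg) (a, b, s) \<and> compat (a, b, s) (i, k, Neg)"
  using assms unfolding compat.simps
  apply (cases s)
   apply (simp_all only: sign.distinct simp_thms)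
   apply (metis nat_less_le linorder_le_cases)
  apply (metis nat_neq_iff order_less_le order_less_trans)
  done

lemma compat_NegPos:
  assumes "i < j" "j < k" "a \<le> b" "a = b \<Longrightarrow> s = Pos"
    and "compat (i, j, Neg) (a, b, s)" "compat (a, b, s) (i, j, Neg)"
    and "compat (j, k, Pos) (a, b, s)" "compat (a, b, s) (j, k, Pos)"
    and "s = Neg \<Longrightarrow> b = j \<Longrightarrow> i \<le> a" "s = Pos \<Longrightarrow> a = j \<Longrightarrow> b \<le> k"
  shows "compat (i, k, Pos) (a, b, s) \<and> compat (a, b, s) (i, k, Pos)"
  using assms unfolding compat.simps
  apply (cases s)
   apply (simp_all only: sign.distinct simp_thms)
   apply (metis less_le_not_le linorder_cases order.strict_trans1)
  apply (metis linorder_not_less nat_less_le order_less_trans)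
  done

lemma compat_OuterPos:
  assumes "i < j" "j < k" "a \<le> b" "a = b \<Longrightarrow> s = Pos"
    and "compat (i, k, Pos) (a, b, s)" "compat (a, b, s) (i, k, Pos)"
    and "compat (j, k, Neg) (a, b, s)" "compat (a, b, s) (j, k, Neg)"
    and "s = Neg \<Longrightarrow> b = k \<Longrightarrow> j \<le> a" "s = Pos \<Longrightarrow> b = k \<Longrightarrow> a \<le> i" "\<not> (s = Neg \<and> a = i \<and> b = j)"
  shows "compat (i, j, Pos) (a, b, s) \<and> compat (a, b, s) (i, j, Pos)"
  using assms unfolding compat.simps
  apply (cases s)
   apply (simp_all only: sign.distinct simp_thms)
   apply (smt (verit, best) leI nless_le order.strict_trans1)
  apply (metis linorder_not_less nat_less_le order_less_le_trans)
  done

lemma compat_Loop_loop: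
  assumes "i < j" "a \<le> b" "a = b \<Longrightarrow> s = Pos"
    and "compat (i, j, Neg) (a, b, s)" "compat (a, b, s) (i, j, Neg)"
    and "compat (j, j, Pos) (a, b, s)" "compat (a, b, s) (j, j, Pos)"
    and "s = Neg \<Longrightarrow> b = j \<Longrightarrow> i \<le> a" "s = Pos \<Longrightarrow> a = j \<Longrightarrow> b = j"
  shows "compat (i, i, Pos) (a, b, s) \<and> compat (a, b, s) (i, i, Pos)"
  using assms unfolding compat.simps
  apply (cases s)
   apply (simp_all only: sign.distinct simp_thms)
   apply (metis linorder_not_le order_le_less order_less_trans)
  apply (metis linorder_cases order.strict_iff_order order_less_trans)
  done

lemma compat_Loop_Pos:
  assumes "i < j" "a \<le> b" "a = b \<Longrightarrow> s = Pos"
    and "compat (i, j, Neg) (a, b, s)" "compat (a, b, s) (i, j, Neg)"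
    and "compat (j, j, Pos) (a, b, s)" "compat (a, b, s) (j, j, Pos)"
    and "s = Neg \<Longrightarrow> b = j \<Longrightarrow> i \<le> a" "s = Pos \<Longrightarrow> a = j \<Longrightarrow> b = j" "s = Neg \<Longrightarrow> a = i \<Longrightarrow> b \<noteq> j"
    and "a = b \<Longrightarrow> a = j"
  shows "compat (i, j, Pos) (a, b, s) \<and> compat (a, b, s) (i, j, Pos)"
  using assms unfolding compat.simps
  apply (cases s)
   apply (simp_all only: sign.distinct simp_thms)
   apply (metis nat_less_le order_less_le_trans)
  apply (metis nat_less_le order_less_trans)
  done

text \<open>Outside the loop rule an outcome consists of edges of \<open>T\<close> and one inserted
  edge, so it is enough that this edge be compatible with all of \<open>T\<close>. The cases A to D
  are exclusive: each of them assumes the partners of the earlier ones to be absent at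
  \<open>j\<close>. The extremal choice of the pair settles the remaining edges at
  \<open>j\<close>.\<close>

lemma well_structured_reducible:
  assumes ws: "well_structured n T" and nalt: "\<not> alternating T"
  shows "\<exists>L Rs. graph_rule L Rs \<and> L \<subseteq># T \<and> (\<forall>R\<in>set Rs. well_structured n (R + (T - L)))"
proof -
  have on: "graph_on n T" and comp: "compatible (set_mset T)"
    using ws by (auto simp: well_structured_iff)
  have one: "1 \<le> a \<and> a \<le> b \<and> b \<le> n \<and> (a = b \<longrightarrow> s = Pos)" if "(a, b, s) \<in># T" for a b s
    using on that unfolding graph_on_def by fastforce
  have C: "compat e f" if "e \<in># T" "f \<in># T" for e f
    using compatibleD[OF comp] that by blast
  have reduce: ?thesis
    if r: "graph_rule {#x, y#} Rs" and xy: "x \<in># T" "y \<in># T" "x \<noteq> y"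
      and cR: "\<And>R. R \<in> set Rs \<Longrightarrow> compatible (set_mset (R + (T - {#x, y#})))" for x y Rs
  proof -
    have sub: "{#x, y#} \<subseteq># T" using xy by (simp add: insert_subset_eq_iff in_diff_count)
    then have T: "{#x, y#} + (T - {#x, y#}) = T" by (rule subset_mset.add_diff_inverse)
    have "well_structured n (R + (T - {#x, y#}))" if "R \<in> set Rs" for R
      by (rule graph_rule_well_structured[OF _ r that cR[OF that]]) (simp only: T ws)
    then show ?thesis using r sub by blast
  qed
  have sub: "set_mset (T - L) \<subseteq> set_mset T" for L by (auto dest: in_diffD)
  have cnt: "count T e \<le> 1" for e by (rule well_structured_count_le_1[OF ws])
  obtain i0 j e' where e': "(i0, j, Neg) \<in># T" "e' \<in># T" "(j, Pos) \<in> incidences e'"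
    using not_alternatingD[OF nalt on] by blast
  define I where "I = {i. (i, j, Neg) \<in># T}"
  have finI: "finite I" using one by (intro finite_subset[of I "{..n}"]) (force simp: I_def)+
  define i where "i = Min I"
  have iT: "(i, j, Neg) \<in># T" using Min_in[OF finI] e'(1) by (auto simp: I_def i_def)
  have imin: "i \<le> a" if "(a, j, Neg) \<in># T" for a
    using Min_le[OF finI, of a] that by (simp add: I_def i_def)
  have ij: "i < j" using one[OF iT] by (metis le_neq_implies_less sign.distinct(2))
  consider (A) k0 where "j < k0" "(j, k0, Pos) \<in># T"
    | (B) "\<And>k. j < k \<Longrightarrow> (j, k, Pos) \<notin># T" "(j, j, Pos) \<in># T"
    | (C) p0 where "\<And>k. j < k \<Longrightarrow> (j, k, Pos) \<notin># T" "(j, j, Pos) \<notin># T" "p0 < j" "(p0, j, Pos) \<in># T"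
    | (D) k0 where "\<And>k. j < k \<Longrightarrow> (j, k, Pos) \<notin># T" "(j, j, Pos) \<notin># T"
        "\<And>p. p < j \<Longrightarrow> (p, j, Pos) \<notin># T" "j < k0" "(j, k0, Neg) \<in># T"
  proof -
    have "edge_on n e'" using on e'(2) by (auto simp: graph_on_def)
    from pos_incidence[OF this e'(3)] show ?thesis using that e'(2) by blast
  qed
  \<comment> \<open>The pair of edges is chosen outermost at \<open>j\<close> in every case, except that \<open>OuterPos\<close> takes the
      innermost pair, so that no remaining edge at \<open>j\<close> crosses the new edge.\<close>
  then show ?thesis
  proof cases
    case A
    define K where "K = {k. j < k \<and> (j, k, Pos) \<in># T}"
    have finK: "finite K" using one by (intro finite_subset[of K "{..n}"]) (force simp: K_def)+
    define k where "k = Max K"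
    have "k \<in> K" unfolding k_def by (rule Max_in[OF finK]) (use A in \<open>auto simp: K_def\<close>)
    then have k: "j < k" "(j, k, Pos) \<in># T" by (auto simp: K_def)
    have kmax: "b \<le> k" if "(j, b, Pos) \<in># T" for b
    proof (cases "j < b")
      case True then show ?thesis using Max_ge[OF finK, of b] that by (simp add: K_def k_def)
    qed (use k in simp)
    have new: "compat (i, k, Pos) f \<and> compat f (i, k, Pos)" if f: "f \<in># T" for f
    proof -
      obtain a b s where abs: "f = (a, b, s)" by (cases f)
      have f': "(a, b, s) \<in># T" using f abs by simp
      have i_le: "i \<le> a" if "s = Neg" "b = j" using imin[of a] f' that by simp
      have le_k: "b \<le> k" if "s = Pos" "a = j" using kmax[of b] f' that by simp
      show ?thesis unfolding abs
        by (rule compat_NegPos[OF ij k(1) _ _ C[OF iT f'] C[OF f' iT] C[OF k(2) f'] C[OF f' k(2)] i_le le_k])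
          (use one[OF f'] in simp_all)
    qed
    have ins: "compatible (insert (i, k, Pos) (set_mset T))"
      by (rule compatible_insert[OF comp new]) (use ij k(1) in simp_all)
    show ?thesis
    proof (rule reduce[OF NegPos[OF ij k(1)] iT k(2)])
      fix R assume "R \<in> set [{#(i, k, Pos), (i, j, Neg)#}, {#(j, k, Pos), (i, k, Pos)#}]"
      then show "compatible (set_mset (R + (T - {#(i, j, Neg), (j, k, Pos)#})))"
        using iT k sub by (intro compatible_subset[OF ins]) auto
    qed simp
  next
    case B
    obtain l where l: "\<And>e. e \<in># T \<Longrightarrow> is_loop e \<Longrightarrow> e = (l, l, Pos)"
      using well_structured_loop[OF ws] by blast
    have loop: "a = j" if "(a, a, s) \<in># T" for a s
      using l[OF that] l[OF B(2)] by simp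
    have newl: "compat (i, i, Pos) f \<and> compat f (i, i, Pos)" if f: "f \<in># T" for f
    proof -
      obtain a b s where abs: "f = (a, b, s)" by (cases f)
      have f': "(a, b, s) \<in># T" using f abs by simp
      have i_le: "i \<le> a" if "s = Neg" "b = j" using imin[of a] f' that by simp
      have eq_j: "b = j" if "s = Pos" "a = j"
        using B(1)[of b] one[OF f'] f' that by (cases "b = j") auto
      show ?thesis unfolding abs
        by (rule compat_Loop_loop[OF ij _ _ C[OF iT f'] C[OF f' iT] C[OF B(2) f'] C[OF f' B(2)] i_le eq_j])
          (use one[OF f'] in simp_all)
    qed
    have newp: "compat (i, j, Pos) f \<and> compat f (i, j, Pos)" if f: "f \<in># T" "f \<noteq> (i, j, Neg)" for f
    proof -
      obtain a b s where abs: "f = (a, b, s)" by (cases f)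
      have f': "(a, b, s) \<in># T" using f(1) abs by simp
      have i_le: "i \<le> a" if "s = Neg" "b = j" using imin[of a] f' that by simp
      have eq_j: "b = j" if "s = Pos" "a = j"
        using B(1)[of b] one[OF f'] f' that by (cases "b = j") auto
      have ne_j: "b \<noteq> j" if "s = Neg" "a = i" using f(2) abs that by simp
      have loop_j: "a = j" if "a = b" using loop[of a s] f' that by simp
      show ?thesis unfolding abs
        by (rule compat_Loop_Pos[OF ij _ _ C[OF iT f'] C[OF f' iT] C[OF B(2) f'] C[OF f' B(2)] i_le eq_j ne_j loop_j])
          (use one[OF f'] in simp_all)
    qed
    have ins1: "compatible (insert (i, i, Pos) (set_mset T))"
      by (rule compatible_insert[OF comp newl]) auto
    have ins2: "compatible (insert (i, j, Pos) (insert (i, i, Pos) (set_mset T - {(i, j, Neg)})))"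
    proof (rule compatible_insert)
      show "compatible (insert (i, i, Pos) (set_mset T - {(i, j, Neg)}))"
        by (rule compatible_subset[OF ins1]) auto
      fix f assume "f \<in> insert (i, i, Pos) (set_mset T - {(i, j, Neg)})"
      then consider "f = (i, i, Pos)" | "f \<in># T" "f \<noteq> (i, j, Neg)" by blast
      then show "compat (i, j, Pos) f \<and> compat f (i, j, Pos)"
      proof cases
        case 1
        then show ?thesis using ij by simp
      next
        case 2
        then show ?thesis by (rule newp)
      qed
    qed (use ij in simp)
    \<comment> \<open>The inserted \<open>(i, j, Pos)\<close> conflicts with
      \<open>(i, j, Neg)\<close> by (v), so that edge must be gone from the rest; it is, since
      \<open>T\<close> has no repeated edges.\<close>
    have "(i, j, Neg) \<notin># T - {#(i, j, Neg), (j, j, Pos)#}"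
      using cnt[of "(i, j, Neg)"] by (simp add: in_diff_count not_less)
    then have rest: "set_mset (T - {#(i, j, Neg), (j, j, Pos)#}) \<subseteq> set_mset T - {(i, j, Neg)}"
      using sub by auto
    show ?thesis
    proof (rule reduce[OF Loop[OF ij] iT B(2)])
      fix R assume "R \<in> set [{#(i, i, Pos), (i, j, Neg)#}, {#(i, j, Pos), (i, i, Pos)#}, {#(j, j, Pos), (i, j, Pos)#}]"
      then consider "R = {#(i, i, Pos), (i, j, Neg)#}" | "R = {#(i, j, Pos), (i, i, Pos)#}" | "R = {#(j, j, Pos), (i, j, Pos)#}"
        by auto
      then show "compatible (set_mset (R + (T - {#(i, j, Neg), (j, j, Pos)#})))"
      proof cases
        case 1 then show ?thesis using iT rest by (intro compatible_subset[OF ins1]) auto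
      next
        case 2 then show ?thesis using rest by (intro compatible_subset[OF ins2]) auto
      next
        case 3 then show ?thesis using rest B(2) by (intro compatible_subset[OF ins2]) auto
      qed
    qed simp
  next
    case C': C
    define K where "K = {p. p < j \<and> (p, j, Pos) \<in># T}"
    have finK: "finite K" by (intro finite_subset[of K "{..j}"]) (auto simp: K_def)
    define p where "p = Max K"
    have "p \<in> K" unfolding p_def by (rule Max_in[OF finK]) (use C' in \<open>auto simp: K_def\<close>)
    then have p: "p < j" "(p, j, Pos) \<in># T" by (auto simp: K_def)
    have pmax: "b \<le> p" if "(b, j, Pos) \<in># T" for b
    proof -
      have "b < j" using one[OF that] C'(2) that by (cases "b = j") auto
      then show ?thesis using Max_ge[OF finK, of b] that by (simp add: K_def p_def)
    qed
    \<comment> \<open>By (v) the edge \<open>(p, j, Pos)\<close> is not nested in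
      \<open>(i, j, Neg)\<close>.\<close>
    have pi: "p < i" using C[OF p(2) iT] p(1) by simp
    have new: "compat (p, i, Pos) f \<and> compat f (p, i, Pos)" if f: "f \<in># T" for f
    proof -
      obtain a b s where abs: "f = (a, b, s)" by (cases f)
      have f': "(a, b, s) \<in># T" using f abs by simp
      have tri: "\<not> (s = Neg \<and> a = p \<and> b = i)"
        using well_structured_no_triangle[OF ws _ iT p(2) pi ij] f' by blast
      have i_le: "i \<le> a" if "s = Neg" "b = j" using imin[of a] f' that by simp
      have le_p: "a \<le> p" if "s = Pos" "b = j" using pmax[of a] f' that by simp
      show ?thesis unfolding abs
        by (rule compat_OuterPos[OF pi ij _ _ C[OF p(2) f'] C[OF f' p(2)] C[OF iT f'] C[OF f' iT] i_le le_p tri])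
          (use one[OF f'] in simp_all)
    qed
    have ins: "compatible (insert (p, i, Pos) (set_mset T))"
      by (rule compatible_insert[OF comp new]) (use pi in auto)
    show ?thesis
    proof (rule reduce[OF OuterPos[OF pi ij] p(2) iT])
      fix R assume "R \<in> set [{#(i, j, Neg), (p, i, Pos)#}, {#(p, i, Pos), (p, j, Pos)#}]"
      then show "compatible (set_mset (R + (T - {#(p, j, Pos), (i, j, Neg)#})))"
        using iT p sub by (intro compatible_subset[OF ins]) auto
    qed simp
  next
    case D
    define K where "K = {k. (j, k, Neg) \<in># T}"
    have finK: "finite K" using one by (intro finite_subset[of K "{..n}"]) (force simp: K_def)+
    define k where "k = Max K"
    have "k \<in> K" unfolding k_def by (rule Max_in[OF finK]) (use D in \<open>auto simp: K_def\<close>)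
    then have kT: "(j, k, Neg) \<in># T" by (auto simp: K_def)
    have jk: "j < k" using one[OF kT] by (metis le_neq_implies_less sign.distinct(2))
    have kmax: "b \<le> k" if "(j, b, Neg) \<in># T" for b
      using Max_ge[OF finK, of b] that by (simp add: K_def k_def)
    have new: "compat (i, k, Neg) f \<and> compat f (i, k, Neg)" if f: "f \<in># T" for f
    proof -
      obtain a b s where abs: "f = (a, b, s)" by (cases f)
      have f': "(a, b, s) \<in># T" using f abs by simp
      have tri: "\<not> (s = Pos \<and> a = i \<and> b = k)"
        using well_structured_no_triangle[OF ws iT kT _ ij jk] f' by blast
      have no_left: "\<not> (s = Pos \<and> b = j)"
      proof
        assume "s = Pos \<and> b = j"
        then show False using one[OF f'] D(2) D(3)[of a] f' by (cases "a = j") auto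
      qed
      have no_right: "\<not> (s = Pos \<and> a = j)"
      proof
        assume "s = Pos \<and> a = j"
        then show False using one[OF f'] D(2) D(1)[of b] f' by (cases "b = j") auto
      qed
      have i_le: "i \<le> a" if "s = Neg" "b = j" using imin[of a] f' that by simp
      have le_k: "b \<le> k" if "s = Neg" "a = j" using kmax[of b] f' that by simp
      show ?thesis unfolding abs
        by (rule compat_NegNeg[OF ij jk _ _ C[OF iT f'] C[OF f' iT] C[OF kT f'] C[OF f' kT] i_le no_left no_right le_k tri])
          (use one[OF f'] in simp_all)
    qed
    have ins: "compatible (insert (i, k, Neg) (set_mset T))"
      by (rule compatible_insert[OF comp new]) (use ij jk in auto)
    show ?thesis
    proof (rule reduce[OF NegNeg[OF ij jk] iT kT])
      fix R assume "R \<in> set [{#(i, k, Neg), (i, j, Neg)#}, {#(j, k, Neg), (i, k, Neg)#}]"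
      then show "compatible (set_mset (R + (T - {#(i, j, Neg), (j, k, Neg)#})))"
        using iT kT sub by (intro compatible_subset[OF ins]) auto
    qed (use ij in simp)
  qed
qed

text \<open>The term \<open>3 * n\<close> makes every negative edge heavier than every positive one and keeps the
  subtraction from truncating.\<close>

fun edge_weight :: "nat \<Rightarrow> edge \<Rightarrow> nat" where
  "edge_weight n (i, j, Neg) = 3 * n + i - j"
| "edge_weight n (i, j, Pos) = i + j"

lemma graph_rule_weight:
  assumes "graph_rule L Rs" "R \<in> set Rs" "graph_on n L"
  shows "(\<Sum>e\<in>#R. edge_weight n e) < (\<Sum>e\<in>#L. edge_weight n e)"
  using assms by cases (auto simp: graph_on_def)

text \<open>After each reduction the point \<open>p\<close> selects an outcome whose cone still
  contains it. The weight makes this descent terminate, which can only happen at an alternating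
  graph.\<close>

lemma ncone_alternating_cover:
  assumes "well_structured n T" "p \<in> ncone (set_mset T)"
  shows "\<exists>G. well_structured n G \<and> alternating G \<and> size G = size T \<and>
    (\<forall>e\<in>#G. edge_vec e \<in> ncone (set_mset T)) \<and> p \<in> ncone (set_mset G)"
  using assms
proof (induction "\<Sum>e\<in>#T. edge_weight n e" arbitrary: T rule: less_induct)
  case less
  show ?case
  proof (cases "alternating T")
    case True
    then show ?thesis using less.prems edge_vec_in_ncone by blast
  next
    case False
    obtain L Rs where L: "graph_rule L Rs" "L \<subseteq># T" "\<And>R. R \<in> set Rs \<Longrightarrow> well_structured n (R + (T - L))"
      using well_structured_reducible[OF less.prems(1) False] by blast
    have T: "L + (T - L) = T" using L(2) by (rule subset_mset.add_diff_inverse)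
    have "p \<in> ncone (set_mset (L + (T - L)))" using less.prems(2) by (simp only: T)
    then obtain R where R: "R \<in> set Rs" "p \<in> ncone (set_mset (R + (T - L)))"
      using graph_rule_ncone[OF L(1), of "T - L"] by blast
    have "graph_on n L" using less.prems(1) L(2) by (auto simp: well_structured_def graph_on_def dest: mset_subset_eqD)
    then have "(\<Sum>e\<in>#R. edge_weight n e) < (\<Sum>e\<in>#L. edge_weight n e)"
      by (rule graph_rule_weight[OF L(1) R(1)])
    moreover have "(\<Sum>e\<in>#T. edge_weight n e) = (\<Sum>e\<in>#L. edge_weight n e) + (\<Sum>e\<in>#T - L. edge_weight n e)"
      by (subst T[symmetric]) simp
    ultimately have "(\<Sum>e\<in>#R + (T - L). edge_weight n e) < (\<Sum>e\<in>#T. edge_weight n e)" by simp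
    from less.hyps[OF this L(3)[OF R(1)] R(2)] obtain G where G: "well_structured n G" "alternating G"
      "size G = size (R + (T - L))" "\<And>e. e \<in># G \<Longrightarrow> edge_vec e \<in> ncone (set_mset (R + (T - L)))"
      "p \<in> ncone (set_mset G)" by blast
    have "size (R + (T - L)) = size (L + (T - L))" using graph_rule_size[OF L(1) R(1)] by simp
    then have "size G = size T" using G(3) by (simp only: T)
    moreover have "ncone (set_mset (R + (T - L))) \<subseteq> ncone (set_mset T)"
    proof (rule ncone_closed)
      fix e assume "e \<in># R + (T - L)"
      then consider "e \<in># R" | "e \<in># T - L" by auto
      then show "edge_vec e \<in> ncone (set_mset T)"
      proof cases
        case 1
        have "set_mset L \<subseteq> set_mset T" using L(2) by (rule set_mset_mono)
        then show ?thesis using graph_rule_edge_vec[OF L(1) R(1) 1] ncone_mono by blast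
      next
        case 2
        then show ?thesis by (intro edge_vec_in_ncone) (rule in_diffD)
      qed
    qed
    ultimately show ?thesis using G by blast
  qed
qed


section \<open>Counting lattice points\<close>

lemma alt_ws_spanning_eq:
  assumes "well_structured n T"
  shows "alt_ws_spanning n T = {G. well_structured n G \<and> alternating G \<and>
     (\<forall>e\<in>#G. edge_vec e \<in> ncone (set_mset T))}"
  using trans_closure_eq[OF assms]
  by (auto simp: alt_ws_spanning_def spanning_graph_of_closure_def well_structured_def graph_on_def)

text \<open>The point \<open>vsum G\<close> lies in the cone of a graph \<open>H\<close> obtained
  from \<open>T\<close> by reductions, which has \<open>size T\<close> edges. Unique decomposition
  embeds \<open>G\<close> in \<open>H\<close>, and equality of the edge sets follows because a
  well-structured graph is maximal among independent ones.\<close>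

lemma alt_ws_spanning_size:
  assumes T: "well_structured n T" and G: "G \<in> alt_ws_spanning n T"
  shows "size G = size T"
proof -
  have ws: "well_structured n G" and alt: "alternating G"
    and cl: "\<And>e. e \<in># G \<Longrightarrow> edge_vec e \<in> ncone (set_mset T)"
    using G by (auto simp: alt_ws_spanning_eq[OF T])
  have "vsum G \<in> ncone (set_mset G)" by (auto simp: ncone_def)
  then have "vsum G \<in> ncone (set_mset T)" using ncone_closed[OF cl] by blast
  then obtain H where H: "well_structured n H" "alternating H" "size H = size T" "vsum G \<in> ncone (set_mset H)"
    using ncone_alternating_cover[OF T] by blast
  then obtain E where E: "set_mset E \<subseteq> set_mset H" "vsum G = vsum E" by (auto simp: ncone_def)
  have "G = E"
    by (rule layered_vsum_inj[OF well_structured_layered[OF ws alt] well_structured_layered[OF H(1,2) E(1)] E(2)]) simp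
  then have "set_mset G = set_mset H"
    using well_structured_maximal_indep[OF ws] well_structured_good_graph[OF H(1)] E(1)
    by (simp add: good_graph_def)
  then show ?thesis
    using size_eq_card_set_mset[OF well_structured_count_le_1[OF ws]]
      size_eq_card_set_mset[OF well_structured_count_le_1[OF H(1)]] H(3) by simp
qed

text \<open>All graphs counted have \<open>size T\<close> edges, so each contributes the same
  binomial coefficient to the covering and to the packing estimate. The bounds are those of
  \<open>reduced_form_bounds\<close> with \<open>f_number n T\<close> in place of the coefficient
  sum.\<close>

lemma alt_ws_spanning_bounds:
  assumes T: "well_structured n T"
  defines "m \<equiv> size T"
  shows "f_number n T * ((m + r - 1) choose r) \<le> card (closed_points n (m + r) T)"
    and "card (closed_points n r T) \<le> f_number n T * ((m + r - 1) choose r)"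
proof -
  let ?S = "alt_ws_spanning n T"
  have on: "graph_on n T" using T by (simp add: well_structured_def)
  have S: "well_structured n G" "alternating G" "ncone (set_mset G) \<subseteq> ncone (set_mset T)"
      "size G = m" "indep edge_vec G" "graph_on n G" if "G \<in> ?S" for G
  proof -
    show ws: "well_structured n G" and "alternating G"
      using that by (auto simp: alt_ws_spanning_eq[OF T])
    show "ncone (set_mset G) \<subseteq> ncone (set_mset T)"
      by (rule ncone_closed) (use that in \<open>auto simp: alt_ws_spanning_eq[OF T]\<close>)
    show "size G = m" unfolding m_def by (rule alt_ws_spanning_size[OF T that])
    show "indep edge_vec G" "graph_on n G" using well_structured_good_graph[OF ws] by (auto simp: good_graph_def)
  qed
  have "closed_points n r T \<subseteq> (\<Union>G\<in>?S. closed_points n r G)"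
  proof
    fix p assume p: "p \<in> closed_points n r T"
    then obtain G where "well_structured n G" "alternating G"
      "\<forall>e\<in>#G. edge_vec e \<in> ncone (set_mset T)" "p \<in> ncone (set_mset G)"
      using ncone_alternating_cover[OF T, of p] by (auto simp: closed_points_def)
    then show "p \<in> (\<Union>G\<in>?S. closed_points n r G)"
      using p by (auto simp: closed_points_def alt_ws_spanning_eq[OF T])
  qed
  moreover have "finite (\<Union>G\<in>?S. closed_points n r G)"
    using finite_alt_ws_spanning S(6) finite_closed_points by (intro finite_UN_I) auto
  ultimately have "card (closed_points n r T) \<le> card (\<Union>G\<in>?S. closed_points n r G)"
    by (rule card_mono[rotated])
  also have "\<dots> \<le> (\<Sum>G\<in>?S. card (closed_points n r G))"
    by (rule card_UN_le[OF finite_alt_ws_spanning])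
  also have "\<dots> = (\<Sum>G\<in>?S. (m + r - 1) choose r)"
    by (rule sum.cong[OF refl], unfold closed_points_def, subst card_ncone_alternating) (use S in auto)
  finally show "card (closed_points n r T) \<le> f_number n T * ((m + r - 1) choose r)"
    by (simp add: f_number_def)
  have "open_points n (m + r) G \<inter> open_points n (m + r) G' = {}"
    if GG: "G \<in> ?S" "G' \<in> ?S" "G \<noteq> G'" for G G'
  proof (rule ccontr)
    assume "\<not> ?thesis"
    then obtain p where "p \<in> nint (set_mset G)" "p \<in> nint (set_mset G')" by (auto simp: open_points_def)
    then obtain E E' where E: "set_mset E = set_mset G" "p = vsum E" "set_mset E' = set_mset G'" "p = vsum E'"
      by (auto simp: nint_def)
    have "E = E'"
    proof (rule layered_vsum_inj)
      show "layered n E" "layered n E'"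
        using well_structured_layered[OF S(1,2)[OF GG(1)], of E] well_structured_layered[OF S(1,2)[OF GG(2)], of E'] E(1,3)
        by auto
      show "vsum E = vsum E'" using E(2,4) by metis
    qed
    then have "set_mset G = set_mset G'" using E by simp
    \<comment> \<open>Without repeated edges a graph is determined by its edge set.\<close>
    moreover have "count H e = (if e \<in># H then 1 else 0)" if "H \<in> ?S" for H e
    proof (cases "e \<in># H")
      case True
      then have "1 \<le> count H e" by simp
      then have "count H e = 1" using well_structured_count_le_1[OF S(1)[OF that], of e] by linarith
      then show ?thesis using True by simp
    qed (simp add: not_in_iff)
    ultimately show False using GG by (auto simp: multiset_eq_iff)
  qed
  then have "card (\<Union>G\<in>?S. open_points n (m + r) G) = (\<Sum>G\<in>?S. card (open_points n (m + r) G))"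
    using finite_alt_ws_spanning S(6) finite_open_points by (intro card_UN_disjoint) auto
  also have "\<dots> = (\<Sum>G\<in>?S. (m + r - 1) choose r)"
  proof (rule sum.cong[OF refl])
    fix G assume "G \<in> ?S"
    then show "card (open_points n (m + r) G) = (m + r - 1) choose r"
      using card_nint_alternating[of G n r] S[of G] by (simp add: open_points_def)
  qed
  finally have "f_number n T * ((m + r - 1) choose r) = card (\<Union>G\<in>?S. open_points n (m + r) G)"
    by (simp add: f_number_def)
  also have "\<dots> \<le> card (closed_points n (m + r) T)"
  proof (rule card_mono[OF finite_closed_points[OF on]])
    show "(\<Union>G\<in>?S. open_points n (m + r) G) \<subseteq> closed_points n (m + r) T"
      using S(3) nint_subset_ncone by (fastforce simp: open_points_def closed_points_def)
  qed
  finally show "f_number n T * ((m + r - 1) choose r) \<le> card (closed_points n (m + r) T)" .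
qed

theorem theorem27:
  fixes n :: nat and T :: sgraph and P :: cpoly
  assumes "well_structured n T"
    and "reduced_form_of (graph_monomial T) P"
  shows "eval_cpoly (\<lambda>_. 1) P = of_nat (f_number n T)"
proof -
  let ?N = "eval_cpoly (\<lambda>_. 1) P" and ?K = "of_nat (f_number n T) :: rat" and ?m = "size T"
  note red = reduced_form_bounds[OF well_structured_good_graph[OF assms(1)] assms(2)]
  note alt = alt_ws_spanning_bounds[OF assms(1)]
  have lo: "?K * of_nat ((?m + r - 1) choose r) \<le> of_nat (card (closed_points n (?m + r) T))" for r
    using alt(1)[of r] by (simp only: of_nat_le_iff of_nat_mult[symmetric])
  have up: "of_nat (card (closed_points n r T)) \<le> ?K * of_nat ((?m + r - 1) choose r)" for r
    using alt(2)[of r] by (simp only: of_nat_le_iff of_nat_mult[symmetric])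
  \<comment> \<open>The lower bound for \<open>?N\<close> and the upper bound for \<open>?K\<close>
    meet at \<open>closed_points n (?m + r) T\<close>, which gives the hypothesis of
    \<open>growth_compare\<close>. The reverse inequality exchanges the two roles.\<close>
  have "?N \<le> ?K"
    by (rule growth_compare[where m = ?m]) (use red(1,2) up order_trans in \<open>blast, auto\<close>)
  moreover have "?K \<le> ?N"
    by (rule growth_compare[where m = ?m]) (use red(1,3) lo order_trans in \<open>blast, auto\<close>)
  ultimately show ?thesis by (rule antisym)
qed

end
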